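(* Let $\Gamma_1$ be a group. The morphism $\mathrm{Rep}^{\Gamma_1}_G\to\mathrm{PC}^{\Gamma_1}_G$, $\rho\mapsto\Theta_\rho$, induces an isomorphism of $\mathcal{O}$-schemes $$\mathrm{Rep}^{\Gamma_1}_G/\!\!/G^0\xrightarrow{\ \cong\ }\mathrm{PC}^{\Gamma_1}_G,$$ equivalently the induced map $\mathcal{O}(\mathrm{PC}^{\Gamma_1}_G)\to\mathcal{O}(\mathrm{Rep}^{\Gamma_1}_G)^{G^0}$ is an isomorphism.
   Context: $\mathcal{O}$ is a commutative ring with $\mathrm{Spec}\,\mathcal{O}$ connected. $G$ is a generalised torus over $\mathcal{O}$: a smooth affine $\mathcal{O}$-group scheme whose neutral component $G^0$ has geometric fibres tori and with $G/G^0$ finite (étale); moreover $G^0$ is a split torus and $G/G^0$ is a constant group scheme. $\Gamma_1$ is an abstract group. $\mathrm{Rep}^{\Gamma_1}_G$ is the affine $\mathcal{O}$-scheme representing $A\mapsto\mathrm{Hom}_{\mathrm{Grp}}(\Gamma_1,G(A))$, with $G^0$ acting by conjugation; $\mathrm{Rep}^{\Gamma_1}_G/\!\!/G^0=\mathrm{Spec}\,\mathcal{O}(\mathrm{Rep}^{\Gamma_1}_G)^{G^0}$. A $G$-pseudocharacter of $\Gamma_1$ over an $\mathcal{O}$-algebra $A$ is a family of $\mathcal{O}$-algebra maps $\Theta_n:\mathcal{O}[G^n]^{G^0}\to\mathrm{Map}(\Gamma_1^n,A)$ ($n\ge1$; $G^0$ acting on $G^n$ by simultaneous conjugation) satisfying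 $\Theta_n(f^\zeta)(\gamma_1,\dots,\gamma_n)=\Theta_m(f)(\gamma_{\zeta(1)},\dots,\gamma_{\zeta(m)})$ for all maps $\zeta:\{1..m\}\to\{1..n\}$, where $f^\zeta(g_1,\dots,g_n)=f(g_{\zeta(1)},\dots,g_{\zeta(m)})$, and $\Theta_{n+1}(\hat f)(\gamma_1,\dots,\gamma_{n+1})=\Theta_n(f)(\gamma_1,\dots,\gamma_n\gamma_{n+1})$, where $\hat f(g_1,\dots,g_{n+1})=f(g_1,\dots,g_ng_{n+1})$. The functor of $G$-pseudocharacters is represented by an affine $\mathcal{O}$-scheme $\mathrm{PC}^{\Gamma_1}_G$. For $\rho:\Gamma_1\to G(A)$, $(\Theta_\rho)_n(f)(\gamma_1,\dots,\gamma_n)=f(\rho(\gamma_1),\dots,\rho(\gamma_n))$; this map is $G^0$-invariant. *)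

theory Defs
  imports
    "HOL-Library.Multiset"
    "HOL-Analysis.Abstract_Topology_2"
    "HOL-Algebra.Free_Abelian_Groups"
    "HOL-Algebra.QuotRing"
    "HOL-Algebra.Module"
begin

section \<open>Commutative algebras, generators and relations\<close>

definition alg_hom ::
  "('k, 'm) ring_scheme \<Rightarrow> ('k, 'a, 'r) module_scheme \<Rightarrow> ('k, 'b, 's) module_scheme \<Rightarrow> ('a \<Rightarrow> 'b) set"
  where "alg_hom R A B =
    {\<phi> \<in> ring_hom A B. \<forall>k \<in> carrier R. \<forall>a \<in> carrier A. \<phi> (k \<odot>\<^bsub>A\<^esub> a) = k \<odot>\<^bsub>B\<^esub> \<phi> a}"

definition alg_iso ::
  "('k, 'm) ring_scheme \<Rightarrow> ('k, 'a, 'r) module_scheme \<Rightarrow> ('k, 'b, 's) module_scheme \<Rightarrow> ('a \<Rightarrow> 'b) set"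
  where "alg_iso R A B = {\<phi> \<in> alg_hom R A B. bij_betw \<phi> (carrier A) (carrier B)}"

definition base_alg :: "('k, 'm) ring_scheme \<Rightarrow> ('k, 'k) module"
  where "base_alg R =
    \<lparr>carrier = carrier R, mult = mult R, one = \<one>\<^bsub>R\<^esub>, zero = \<zero>\<^bsub>R\<^esub>, add = add R, smult = mult R\<rparr>"

definition alg_quot :: "('k, 'a, 'r) module_scheme \<Rightarrow> 'a set \<Rightarrow> ('k, 'a set) module"
  where "alg_quot A I =
    \<lparr>carrier = carrier (A Quot I), mult = mult (A Quot I), one = \<one>\<^bsub>A Quot I\<^esub>,
     zero = \<zero>\<^bsub>A Quot I\<^esub>, add = add (A Quot I),
     smult = (\<lambda>k C. \<Union>a \<in> C. I +>\<^bsub>A\<^esub> (k \<odot>\<^bsub>A\<^esub> a))\<rparr>"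

text \<open>The map on a quotient induced by a map that is constant on cosets.\<close>

definition quot_lift :: "('a \<Rightarrow> 'b) \<Rightarrow> 'a set \<Rightarrow> 'b"
  where "quot_lift \<phi> C = the_elem (\<phi> ` C)"

definition monoid_alg :: "('k, 'm) ring_scheme \<Rightarrow> ('n, 'r) monoid_scheme \<Rightarrow> ('k, 'n \<Rightarrow> 'k) module"
  where "monoid_alg R M =
    \<lparr>carrier = {p. range p \<subseteq> carrier R \<and> finite {m. p m \<noteq> \<zero>\<^bsub>R\<^esub>} \<and> {m. p m \<noteq> \<zero>\<^bsub>R\<^esub>} \<subseteq> carrier M},
     mult = (\<lambda>p q m. \<Oplus>\<^bsub>R\<^esub>c \<in> {(a, b). p a \<noteq> \<zero>\<^bsub>R\<^esub> \<and> q b \<noteq> \<zero>\<^bsub>R\<^esub> \<and> a \<otimes>\<^bsub>M\<^esub> b = m}.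
       p (fst c) \<otimes>\<^bsub>R\<^esub> q (snd c)),
     one = (\<lambda>m. if m = \<one>\<^bsub>M\<^esub> then \<one>\<^bsub>R\<^esub> else \<zero>\<^bsub>R\<^esub>),
     zero = (\<lambda>m. \<zero>\<^bsub>R\<^esub>),
     add = (\<lambda>p q m. p m \<oplus>\<^bsub>R\<^esub> q m),
     smult = (\<lambda>k p m. k \<otimes>\<^bsub>R\<^esub> p m)\<rparr>"

definition monom_at :: "('k, 'm) ring_scheme \<Rightarrow> 'n \<Rightarrow> 'n \<Rightarrow> 'k"
  where "monom_at R m = (\<lambda>m'. if m' = m then \<one>\<^bsub>R\<^esub> else \<zero>\<^bsub>R\<^esub>)"

text \<open>Monomials in the variables \<open>X\<close> are the finite multisets on \<open>X\<close>.\<close>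

definition poly_alg :: "('k, 'm) ring_scheme \<Rightarrow> 'x set \<Rightarrow> ('k, 'x multiset \<Rightarrow> 'k) module"
  where "poly_alg R X = monoid_alg R \<lparr>carrier = {m. set_mset m \<subseteq> X}, mult = (+), one = {#}\<rparr>"

definition pvar :: "('k, 'm) ring_scheme \<Rightarrow> 'x \<Rightarrow> 'x multiset \<Rightarrow> 'k"
  where "pvar R x = monom_at R {#x#}"

definition peval ::
  "('k, 'm) ring_scheme \<Rightarrow> ('k, 'a, 'r) module_scheme \<Rightarrow> ('x \<Rightarrow> 'a) \<Rightarrow> ('x multiset \<Rightarrow> 'k) \<Rightarrow> 'a"
  where "peval R A v p =
    (\<Oplus>\<^bsub>A\<^esub>m \<in> {m. p m \<noteq> \<zero>\<^bsub>R\<^esub>}. p m \<odot>\<^bsub>A\<^esub> (\<Otimes>\<^bsub>A\<^esub>x \<in> set_mset m. v x [^]\<^bsub>A\<^esub> count m x))"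

text \<open>The \<open>R\<close>-algebra with a family of elements \<open>(t\<^sub>x)\<close>, \<open>x \<in> X\<close>, that is universal among those satisfying
  \<open>C T t\<close>: the quotient of the polynomial ring by the smallest ideal modulo which the variables
  satisfy \<open>C\<close>. It is only used for conditions \<open>C\<close> that amount to a set of polynomial equations
  between the \<open>t\<^sub>x\<close>, so that this ideal is the one generated by the corresponding relators.\<close>

type_synonym ('k, 'x) univ = "('x multiset \<Rightarrow> 'k) set"

definition univ_ideal ::
  "('k, 'm) ring_scheme \<Rightarrow> 'x set \<Rightarrow> (('k, ('k, 'x) univ) module \<Rightarrow> ('x \<Rightarrow> ('k, 'x) univ) \<Rightarrow> bool) \<Rightarrow>
   ('x multiset \<Rightarrow> 'k) set"
  where "univ_ideal R X C =
    \<Inter> {I. ideal I (poly_alg R X) \<and> C (alg_quot (poly_alg R X) I) (\<lambda>x. I +>\<^bsub>poly_alg R X\<^esub> pvar R x)}"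

definition univ_alg ::
  "('k, 'm) ring_scheme \<Rightarrow> 'x set \<Rightarrow> (('k, ('k, 'x) univ) module \<Rightarrow> ('x \<Rightarrow> ('k, 'x) univ) \<Rightarrow> bool) \<Rightarrow>
   ('k, ('k, 'x) univ) module"
  where "univ_alg R X C = alg_quot (poly_alg R X) (univ_ideal R X C)"

definition univ_gen ::
  "('k, 'm) ring_scheme \<Rightarrow> 'x set \<Rightarrow> (('k, ('k, 'x) univ) module \<Rightarrow> ('x \<Rightarrow> ('k, 'x) univ) \<Rightarrow> bool) \<Rightarrow>
   'x \<Rightarrow> ('k, 'x) univ"
  where "univ_gen R X C x = univ_ideal R X C +>\<^bsub>poly_alg R X\<^esub> pvar R x"

text \<open>The homomorphism from the universal algebra to \<open>A\<close> classifying a family \<open>v\<close> in \<open>A\<close>.\<close>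

definition univ_lift ::
  "('k, 'm) ring_scheme \<Rightarrow> ('k, 'a, 'r) module_scheme \<Rightarrow> ('x \<Rightarrow> 'a) \<Rightarrow> ('k, 'x) univ \<Rightarrow> 'a"
  where "univ_lift R A v = quot_lift (peval R A v)"

text \<open>The tensor product of commutative algebras, constructed as their coproduct: one generator
  for each element of \<open>A\<close> and of \<open>B\<close>, universal for both inclusions being homomorphisms.
  The class of \<open>Inl a\<close> is \<open>a \<otimes> 1\<close> and that of \<open>Inr b\<close> is \<open>1 \<otimes> b\<close>.\<close>

definition tensor_cond ::
  "('k, 'm) ring_scheme \<Rightarrow> ('k, 'a, 'r) module_scheme \<Rightarrow> ('k, 'b, 's) module_scheme \<Rightarrow>
   ('k, 't) module \<Rightarrow> ('a + 'b \<Rightarrow> 't) \<Rightarrow> bool"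
  where "tensor_cond R A B T t \<longleftrightarrow>
    (\<lambda>a. t (Inl a)) \<in> alg_hom R A T \<and> (\<lambda>b. t (Inr b)) \<in> alg_hom R B T"

definition tensor ::
  "('k, 'm) ring_scheme \<Rightarrow> ('k, 'a, 'r) module_scheme \<Rightarrow> ('k, 'b, 's) module_scheme \<Rightarrow>
   ('k, ('k, 'a + 'b) univ) module"
  where "tensor R A B = univ_alg R (carrier A <+> carrier B) (tensor_cond R A B)"

definition tensor_inl ::
  "('k, 'm) ring_scheme \<Rightarrow> ('k, 'a, 'r) module_scheme \<Rightarrow> ('k, 'b, 's) module_scheme \<Rightarrow>
   'a \<Rightarrow> ('k, 'a + 'b) univ"
  where "tensor_inl R A B a = univ_gen R (carrier A <+> carrier B) (tensor_cond R A B) (Inl a)"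

definition tensor_inr ::
  "('k, 'm) ring_scheme \<Rightarrow> ('k, 'a, 'r) module_scheme \<Rightarrow> ('k, 'b, 's) module_scheme \<Rightarrow>
   'b \<Rightarrow> ('k, 'a + 'b) univ"
  where "tensor_inr R A B b = univ_gen R (carrier A <+> carrier B) (tensor_cond R A B) (Inr b)"

definition tensor_lift ::
  "('k, 'm) ring_scheme \<Rightarrow> ('k, 'c, 'r) module_scheme \<Rightarrow> ('a \<Rightarrow> 'c) \<Rightarrow> ('b \<Rightarrow> 'c) \<Rightarrow>
   ('k, 'a + 'b) univ \<Rightarrow> 'c"
  where "tensor_lift R C x y = univ_lift R C (case_sum x y)"


section \<open>Affine group schemes\<close>

text \<open>An affine \<open>R\<close>-group scheme is given by its coordinate ring, a commutative Hopf algebra.\<close>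

record ('k, 'h) hopf = "('k, 'h) module" +
  comult :: "'h \<Rightarrow> ('k, 'h + 'h) univ"
  counit :: "'h \<Rightarrow> 'k"
  antipode :: "'h \<Rightarrow> 'h"

text \<open>\<open>G(A)\<close> and its group structure.\<close>

definition pt_mult ::
  "('k, 'm) ring_scheme \<Rightarrow> ('k, 'h, 's) hopf_scheme \<Rightarrow> ('k, 'a, 'r) module_scheme \<Rightarrow>
   ('h \<Rightarrow> 'a) \<Rightarrow> ('h \<Rightarrow> 'a) \<Rightarrow> 'h \<Rightarrow> 'a"
  where "pt_mult R G A x y = (\<lambda>h \<in> carrier G. tensor_lift R A x y (comult G h))"

definition pt_one ::
  "('k, 'h, 's) hopf_scheme \<Rightarrow> ('k, 'a, 'r) module_scheme \<Rightarrow> 'h \<Rightarrow> 'a"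
  where "pt_one G A = (\<lambda>h \<in> carrier G. counit G h \<odot>\<^bsub>A\<^esub> \<one>\<^bsub>A\<^esub>)"

definition pt_inv :: "('k, 'h, 's) hopf_scheme \<Rightarrow> ('h \<Rightarrow> 'a) \<Rightarrow> 'h \<Rightarrow> 'a"
  where "pt_inv G x = (\<lambda>h \<in> carrier G. x (antipode G h))"

definition pt_group ::
  "('k, 'm) ring_scheme \<Rightarrow> ('k, 'h, 's) hopf_scheme \<Rightarrow> ('k, 'a, 'r) module_scheme \<Rightarrow> ('h \<Rightarrow> 'a) monoid"
  where "pt_group R G A =
    \<lparr>carrier = alg_hom R G A \<inter> extensional (carrier G), mult = pt_mult R G A, one = pt_one G A\<rparr>"

definition pt_conj ::
  "('k, 'm) ring_scheme \<Rightarrow> ('k, 'h, 's) hopf_scheme \<Rightarrow> ('k, 'a, 'r) module_scheme \<Rightarrow>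
   ('h \<Rightarrow> 'a) \<Rightarrow> ('h \<Rightarrow> 'a) \<Rightarrow> 'h \<Rightarrow> 'a"
  where "pt_conj R G A g x = pt_mult R G A (pt_mult R G A g x) (pt_inv G g)"

text \<open>The Hopf algebra axioms. Coassociativity is read in \<open>(H \<otimes> H) \<otimes> H\<close>, with \<open>x\<close>, \<open>y\<close>, \<open>z\<close> the
  three inclusions of \<open>H\<close>; for points \<open>x\<close>, \<open>y\<close> with values in a common algebra,
  \<^const>\<open>pt_mult\<close> is the convolution \<open>(x \<cdot> y) \<circ> \<Delta>\<close>.\<close>

definition affine_group_scheme :: "('k, 'm) ring_scheme \<Rightarrow> ('k, 'h, 's) hopf_scheme \<Rightarrow> bool"
  where "affine_group_scheme R G \<longleftrightarrow>
    algebra R G \<and>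
    comult G \<in> alg_hom R G (tensor R G G) \<and>
    counit G \<in> alg_hom R G (base_alg R) \<and>
    antipode G \<in> alg_hom R G G \<and>
    (let T = tensor R (tensor R G G) G;
         x = (\<lambda>h. tensor_inl R (tensor R G G) G (tensor_inl R G G h));
         y = (\<lambda>h. tensor_inl R (tensor R G G) G (tensor_inr R G G h));
         z = (\<lambda>h. tensor_inr R (tensor R G G) G h)
     in pt_mult R G T (pt_mult R G T x y) z = pt_mult R G T x (pt_mult R G T y z)) \<and>
    (let e = pt_one G G; i = (\<lambda>h \<in> carrier G. h)
     in pt_mult R G G e i = i \<and> pt_mult R G G i e = i \<and>
        pt_mult R G G (pt_inv G i) i = e \<and> pt_mult R G G i (pt_inv G i) = e)"

text \<open>The comorphisms of homomorphisms of group schemes (note the reversal of direction).\<close>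

definition hopf_hom ::
  "('k, 'm) ring_scheme \<Rightarrow> ('k, 'a, 'r) hopf_scheme \<Rightarrow> ('k, 'b, 's) hopf_scheme \<Rightarrow> ('a \<Rightarrow> 'b) set"
  where "hopf_hom R A B =
    {\<phi> \<in> alg_hom R A B.
      (\<forall>a \<in> carrier A. comult B (\<phi> a) =
        tensor_lift R (tensor R B B) (\<lambda>a. tensor_inl R B B (\<phi> a)) (\<lambda>a. tensor_inr R B B (\<phi> a))
          (comult A a)) \<and>
      (\<forall>a \<in> carrier A. counit B (\<phi> a) = counit A a)}"

definition hopf_iso ::
  "('k, 'm) ring_scheme \<Rightarrow> ('k, 'a, 'r) hopf_scheme \<Rightarrow> ('k, 'b, 's) hopf_scheme \<Rightarrow> ('a \<Rightarrow> 'b) set"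
  where "hopf_iso R A B = {\<phi> \<in> hopf_hom R A B. bij_betw \<phi> (carrier A) (carrier B)}"

text \<open>The diagonalisable group scheme with character group \<open>M\<close>: characters are group-like.\<close>

definition diagonalisable :: "('k, 'm) ring_scheme \<Rightarrow> ('n, 'r) monoid_scheme \<Rightarrow> ('k, 'n \<Rightarrow> 'k) hopf"
  where "diagonalisable R M =
    (let B = monoid_alg R M; T = tensor R B B
     in \<lparr>carrier = carrier B, mult = mult B, one = \<one>\<^bsub>B\<^esub>, zero = \<zero>\<^bsub>B\<^esub>, add = add B, smult = smult B,
         comult = (\<lambda>p. \<Oplus>\<^bsub>T\<^esub>m \<in> {m. p m \<noteq> \<zero>\<^bsub>R\<^esub>}. p m \<odot>\<^bsub>T\<^esub>
           (tensor_inl R B B (monom_at R m) \<otimes>\<^bsub>T\<^esub> tensor_inr R B B (monom_at R m))),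
         counit = (\<lambda>p. \<Oplus>\<^bsub>R\<^esub>m \<in> {m. p m \<noteq> \<zero>\<^bsub>R\<^esub>}. p m),
         antipode = (\<lambda>p m. if m \<in> carrier M then p (inv\<^bsub>M\<^esub> m) else \<zero>\<^bsub>R\<^esub>)\<rparr>)"

definition split_torus :: "('k, 'm) ring_scheme \<Rightarrow> ('k, 'h, 's) hopf_scheme \<Rightarrow> bool"
  where "split_torus R T \<longleftrightarrow>
    (\<exists>r::nat. hopf_iso R (diagonalisable R (free_Abelian_group {..<r})) T \<noteq> {})"

text \<open>The constant group scheme of a finite group \<open>D\<close>; its coordinate ring is the ring of functions
  from \<open>D\<close> to \<open>R\<close>, extended by zero outside the carrier.\<close>

definition fun_alg :: "('k, 'm) ring_scheme \<Rightarrow> 'd set \<Rightarrow> ('k, 'd \<Rightarrow> 'k) module"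
  where "fun_alg R D =
    \<lparr>carrier = {f. \<forall>d. (d \<in> D \<longrightarrow> f d \<in> carrier R) \<and> (d \<notin> D \<longrightarrow> f d = \<zero>\<^bsub>R\<^esub>)},
     mult = (\<lambda>f g d. f d \<otimes>\<^bsub>R\<^esub> g d),
     one = (\<lambda>d. if d \<in> D then \<one>\<^bsub>R\<^esub> else \<zero>\<^bsub>R\<^esub>),
     zero = (\<lambda>d. \<zero>\<^bsub>R\<^esub>),
     add = (\<lambda>f g d. f d \<oplus>\<^bsub>R\<^esub> g d),
     smult = (\<lambda>k f d. k \<otimes>\<^bsub>R\<^esub> f d)\<rparr>"

definition constant_group_scheme ::
  "('k, 'm) ring_scheme \<Rightarrow> ('d, 'r) monoid_scheme \<Rightarrow> ('k, 'd \<Rightarrow> 'k) hopf"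
  where "constant_group_scheme R D =
    (let B = fun_alg R (carrier D); T = tensor R B B
     in \<lparr>carrier = carrier B, mult = mult B, one = \<one>\<^bsub>B\<^esub>, zero = \<zero>\<^bsub>B\<^esub>, add = add B, smult = smult B,
         comult = (\<lambda>f. \<Oplus>\<^bsub>T\<^esub>c \<in> carrier D \<times> carrier D. f (fst c \<otimes>\<^bsub>D\<^esub> snd c) \<odot>\<^bsub>T\<^esub>
           (tensor_inl R B B (monom_at R (fst c)) \<otimes>\<^bsub>T\<^esub> tensor_inr R B B (monom_at R (snd c)))),
         counit = (\<lambda>f. f \<one>\<^bsub>D\<^esub>),
         antipode = (\<lambda>f d. if d \<in> carrier D then f (inv\<^bsub>D\<^esub> d) else \<zero>\<^bsub>R\<^esub>)\<rparr>)"


section \<open>Spectra, smoothness, neutral component, quotients\<close>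

definition spec :: "('a, 'r) ring_scheme \<Rightarrow> 'a set set"
  where "spec A = {P. primeideal P A}"

definition zariski :: "('a, 'r) ring_scheme \<Rightarrow> 'a set topology"
  where "zariski A = topology (\<lambda>U. \<exists>S \<subseteq> carrier A. U = {P \<in> spec A. \<not> S \<subseteq> P})"

lemma istopology_zariski:
  assumes "cring A"
  shows "istopology (\<lambda>U. \<exists>S \<subseteq> carrier A. U = {P \<in> spec A. \<not> S \<subseteq> P})"
  unfolding istopology_def
proof (intro conjI allI impI)
  interpret cring A by fact
  fix U V assume "\<exists>S \<subseteq> carrier A. U = {P \<in> spec A. \<not> S \<subseteq> P}" "\<exists>S \<subseteq> carrier A. V = {P \<in> spec A. \<not> S \<subseteq> P}"
  then obtain S T where S: "S \<subseteq> carrier A" "U = {P \<in> spec A. \<not> S \<subseteq> P}" and T: "T \<subseteq> carrier A" "V = {P \<in> spec A. \<not> T \<subseteq> P}" by blast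
  have "U \<inter> V = {P \<in> spec A. \<not> {s \<otimes>\<^bsub>A\<^esub> t |s t. s \<in> S \<and> t \<in> T} \<subseteq> P}"
  proof (rule Set.set_eqI)
    fix P
    have *: "(\<not> S \<subseteq> P \<and> \<not> T \<subseteq> P) = (\<not> {s \<otimes>\<^bsub>A\<^esub> t |s t. s \<in> S \<and> t \<in> T} \<subseteq> P)" if "P \<in> spec A"
    proof -
      interpret P: primeideal P A using that by (simp add: spec_def)
      show ?thesis using S T P.I_prime P.I_l_closed P.I_r_closed by (auto simp: subset_iff) blast+
    qed
    show "P \<in> U \<inter> V \<longleftrightarrow> P \<in> {P \<in> spec A. \<not> {s \<otimes>\<^bsub>A\<^esub> t |s t. s \<in> S \<and> t \<in> T} \<subseteq> P}"
      using * S T by blast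
  qed
  moreover have "{s \<otimes>\<^bsub>A\<^esub> t |s t. s \<in> S \<and> t \<in> T} \<subseteq> carrier A" using S T by auto
  ultimately show "\<exists>S \<subseteq> carrier A. U \<inter> V = {P \<in> spec A. \<not> S \<subseteq> P}" by blast
next
  fix K assume K: "\<forall>U \<in> K. \<exists>S \<subseteq> carrier A. U = {P \<in> spec A. \<not> S \<subseteq> P}"
  then obtain F where F: "\<And>U. U \<in> K \<Longrightarrow> F U \<subseteq> carrier A \<and> U = {P \<in> spec A. \<not> F U \<subseteq> P}" by metis
  have "\<Union>K = {P \<in> spec A. \<not> (\<Union>U\<in>K. F U) \<subseteq> P}" using F by (auto simp: subset_iff) blast+
  moreover have "(\<Union>U\<in>K. F U) \<subseteq> carrier A" using F by blast
  ultimately show "\<exists>S \<subseteq> carrier A. \<Union>K = {P \<in> spec A. \<not> S \<subseteq> P}" by blast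
qed

definition spec_map :: "('a, 'r) ring_scheme \<Rightarrow> ('a \<Rightarrow> 'b) \<Rightarrow> 'b set \<Rightarrow> 'a set"
  where "spec_map A \<phi> Q = {a \<in> carrier A. \<phi> a \<in> Q}"

definition structure_map :: "('k, 'a, 'r) module_scheme \<Rightarrow> 'k \<Rightarrow> 'a"
  where "structure_map A k = k \<odot>\<^bsub>A\<^esub> \<one>\<^bsub>A\<^esub>"

definition finitely_presented :: "('k, 'm) ring_scheme \<Rightarrow> ('k, 'a, 'r) module_scheme \<Rightarrow> bool"
  where "finitely_presented R A \<longleftrightarrow>
    (\<exists>(n::nat) F. finite F \<and> F \<subseteq> carrier (poly_alg R {..<n}) \<and>
       alg_iso R (alg_quot (poly_alg R {..<n}) (Idl\<^bsub>poly_alg R {..<n}\<^esub> F)) A \<noteq> {})"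

text \<open>Infinitesimal lifting. The test algebras are those carried by a fixed type that contains an
  isomorphic copy of every countably generated \<open>R\<close>-algebra; for finitely presented \<open>A\<close> this is
  the same as testing on all algebras, because it suffices to test on the first-order thickening
  \<open>R[x\<^sub>1, \<dots>, x\<^sub>n] / I\<^sup>2\<close> of \<open>A = R[x\<^sub>1, \<dots>, x\<^sub>n] / I\<close>.\<close>

definition formally_smooth :: "('k, 'm) ring_scheme \<Rightarrow> ('k, 'a, 'r) module_scheme \<Rightarrow> bool"
  where "formally_smooth R A \<longleftrightarrow>
    (\<forall>(B :: ('k, ('k, nat) univ) module) I.
       algebra R B \<and> ideal I B \<and> (\<forall>a \<in> I. \<forall>b \<in> I. a \<otimes>\<^bsub>B\<^esub> b = \<zero>\<^bsub>B\<^esub>) \<longrightarrow>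
       (\<forall>\<psi> \<in> alg_hom R A (alg_quot B I). \<exists>\<phi> \<in> alg_hom R A B. \<forall>a \<in> carrier A. I +>\<^bsub>B\<^esub> \<phi> a = \<psi> a))"

definition smooth :: "('k, 'm) ring_scheme \<Rightarrow> ('k, 'a, 'r) module_scheme \<Rightarrow> bool"
  where "smooth R A \<longleftrightarrow> finitely_presented R A \<and> formally_smooth R A"

text \<open>\<open>Spec B \<longrightarrow> Spec A\<close> is an open immersion: there are \<open>f \<in> F\<close> such that the \<open>D(\<phi> f)\<close> cover
  \<open>Spec B\<close> and \<open>A\<^sub>f \<longrightarrow> B\<^sub>\<phi>\<^sub>f\<close> is injective and surjective for each of them.\<close>

definition open_immersion :: "('a, 'r) ring_scheme \<Rightarrow> ('b, 's) ring_scheme \<Rightarrow> ('a \<Rightarrow> 'b) \<Rightarrow> bool"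
  where "open_immersion A B \<phi> \<longleftrightarrow> \<phi> \<in> ring_hom A B \<and>
    (\<exists>F \<subseteq> carrier A. Idl\<^bsub>B\<^esub> (\<phi> ` F) = carrier B \<and>
      (\<forall>f \<in> F.
        (\<forall>a \<in> carrier A. (\<exists>n::nat. \<phi> f [^]\<^bsub>B\<^esub> n \<otimes>\<^bsub>B\<^esub> \<phi> a = \<zero>\<^bsub>B\<^esub>) \<longrightarrow>
           (\<exists>n::nat. f [^]\<^bsub>A\<^esub> n \<otimes>\<^bsub>A\<^esub> a = \<zero>\<^bsub>A\<^esub>)) \<and>
        (\<forall>b \<in> carrier B. \<exists>a \<in> carrier A. \<exists>n::nat. \<phi> f [^]\<^bsub>B\<^esub> n \<otimes>\<^bsub>B\<^esub> b = \<phi> a)))"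

text \<open>\<open>G0\<close>, via \<open>\<iota>\<close>, is the open subgroup scheme of \<open>G\<close> whose fibre over each \<open>p \<in> Spec R\<close> is the
  connected component of the neutral element \<open>\<epsilon>\<^sup>-\<^sup>1(p)\<close> in the fibre of \<open>G\<close> over \<open>p\<close>.
  Topologically, the fibre over \<open>p\<close> is the subspace of \<open>Spec \<O>(G)\<close> lying over \<open>p\<close>.\<close>

definition is_neutral_component ::
  "('k, 'm) ring_scheme \<Rightarrow> ('k, 'h, 's) hopf_scheme \<Rightarrow> ('k, 'h0, 't) hopf_scheme \<Rightarrow> ('h \<Rightarrow> 'h0) \<Rightarrow> bool"
  where "is_neutral_component R G G0 \<iota> \<longleftrightarrow>
    \<iota> \<in> hopf_hom R G G0 \<and> open_immersion G G0 \<iota> \<and>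
    (\<forall>p \<in> spec R.
      let fibre = {Q \<in> spec G. spec_map R (structure_map G) Q = p}
      in spec_map G \<iota> ` spec G0 \<inter> fibre =
         connected_component_of_set (subtopology (zariski G) fibre) (spec_map G (counit G) p))"

text \<open>Flatness by the equational criterion: every linear relation in \<open>M\<close> is a consequence of
  linear relations in \<open>R\<close>.\<close>

definition flat :: "('k, 'm) ring_scheme \<Rightarrow> ('k, 'a, 'r) module_scheme \<Rightarrow> bool"
  where "flat R M \<longleftrightarrow>
    (\<forall>(n::nat) a x. a \<in> {..<n} \<rightarrow> carrier R \<and> x \<in> {..<n} \<rightarrow> carrier M \<and>
        (\<Oplus>\<^bsub>M\<^esub>i \<in> {..<n}. a i \<odot>\<^bsub>M\<^esub> x i) = \<zero>\<^bsub>M\<^esub> \<longrightarrow>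
      (\<exists>(m::nat) b y. (\<forall>i<n. \<forall>j<m. b i j \<in> carrier R) \<and> y \<in> {..<m} \<rightarrow> carrier M \<and>
        (\<forall>i<n. x i = (\<Oplus>\<^bsub>M\<^esub>j \<in> {..<m}. b i j \<odot>\<^bsub>M\<^esub> y j)) \<and>
        (\<forall>j<m. (\<Oplus>\<^bsub>R\<^esub>i \<in> {..<n}. a i \<otimes>\<^bsub>R\<^esub> b i j) = \<zero>\<^bsub>R\<^esub>)))"

definition restrict_scalars :: "('q \<Rightarrow> 'a) \<Rightarrow> ('k, 'a, 'r) module_scheme \<Rightarrow> ('q, 'a) module"
  where "restrict_scalars \<phi> A =
    \<lparr>carrier = carrier A, mult = mult A, one = \<one>\<^bsub>A\<^esub>, zero = \<zero>\<^bsub>A\<^esub>, add = add A,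
     smult = (\<lambda>q a. \<phi> q \<otimes>\<^bsub>A\<^esub> a)\<rparr>"

text \<open>\<open>G \<longrightarrow> Q\<close>, with comorphism \<open>\<pi>\<close>, is the fppf quotient of \<open>G\<close> by \<open>N\<close>: it is faithfully flat and
  finitely presented, and \<open>N \<longrightarrow> G\<close>, with comorphism \<open>\<iota>\<close>, is its kernel, i.e. \<open>\<O>(N)\<close> is the
  quotient of \<open>\<O>(G)\<close> by the ideal generated by the augmentation ideal of \<open>\<O>(Q)\<close>.\<close>

definition is_quotient_by ::
  "('k, 'm) ring_scheme \<Rightarrow> ('k, 'h, 's) hopf_scheme \<Rightarrow> ('k, 'n, 't) hopf_scheme \<Rightarrow> ('h \<Rightarrow> 'n) \<Rightarrow>
   ('k, 'q, 'u) hopf_scheme \<Rightarrow> ('q \<Rightarrow> 'h) \<Rightarrow> bool"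
  where "is_quotient_by R G N \<iota> Q \<pi> \<longleftrightarrow>
    \<iota> \<in> hopf_hom R G N \<and> \<pi> \<in> hopf_hom R Q G \<and>
    \<iota> ` carrier G = carrier N \<and>
    {h \<in> carrier G. \<iota> h = \<zero>\<^bsub>N\<^esub>} = Idl\<^bsub>G\<^esub> (\<pi> ` {q \<in> carrier Q. counit Q q = \<zero>\<^bsub>R\<^esub>}) \<and>
    finitely_presented Q (restrict_scalars \<pi> G) \<and>
    flat Q (restrict_scalars \<pi> G) \<and> spec_map Q \<pi> ` spec G = spec Q"


section \<open>Powers of a group scheme and conjugation invariants\<close>

text \<open>The coordinate ring of \<open>G\<^sup>I\<close>, i.e. the \<open>I\<close>-fold tensor power of \<open>\<O>(G)\<close>.\<close>

definition gpow_cond ::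
  "('k, 'm) ring_scheme \<Rightarrow> ('k, 'h, 's) hopf_scheme \<Rightarrow> 'i set \<Rightarrow> ('k, 't) module \<Rightarrow> ('i \<times> 'h \<Rightarrow> 't) \<Rightarrow> bool"
  where "gpow_cond R G I T t \<longleftrightarrow> (\<forall>i \<in> I. (\<lambda>h. t (i, h)) \<in> alg_hom R G T)"

definition gpow ::
  "('k, 'm) ring_scheme \<Rightarrow> ('k, 'h, 's) hopf_scheme \<Rightarrow> 'i set \<Rightarrow> ('k, ('k, 'i \<times> 'h) univ) module"
  where "gpow R G I = univ_alg R (I \<times> carrier G) (gpow_cond R G I)"

text \<open>The \<open>i\<close>-th projection \<open>G\<^sup>I \<longrightarrow> G\<close>, as a point of \<open>G\<close> with values in \<open>\<O>(G\<^sup>I)\<close>.\<close>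

definition gpow_pt ::
  "('k, 'm) ring_scheme \<Rightarrow> ('k, 'h, 's) hopf_scheme \<Rightarrow> 'i set \<Rightarrow> 'i \<Rightarrow> 'h \<Rightarrow> ('k, 'i \<times> 'h) univ"
  where "gpow_pt R G I i = (\<lambda>h \<in> carrier G. univ_gen R (I \<times> carrier G) (gpow_cond R G I) (i, h))"

text \<open>The value \<open>f((x\<^sub>i)\<^sub>i)\<close> of \<open>f \<in> \<O>(G\<^sup>I)\<close> at a family of points of \<open>G(A)\<close>.\<close>

definition gpow_eval ::
  "('k, 'm) ring_scheme \<Rightarrow> ('k, 'a, 'r) module_scheme \<Rightarrow> ('i \<Rightarrow> 'h \<Rightarrow> 'a) \<Rightarrow>
   ('k, 'i \<times> 'h) univ \<Rightarrow> 'a"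
  where "gpow_eval R A x = univ_lift R A (\<lambda>(i, h). x i h)"

text \<open>The subalgebra of elements \<open>b\<close> with \<open>\<delta>(b) = b \<otimes> 1\<close>, for a coaction \<open>\<delta> : B \<longrightarrow> B \<otimes> C\<close>.\<close>

definition coinvariants ::
  "('k, 'm) ring_scheme \<Rightarrow> ('k, 'b) module \<Rightarrow> ('k, 'c, 's) module_scheme \<Rightarrow>
   ('b \<Rightarrow> ('k, 'b + 'c) univ) \<Rightarrow> ('k, 'b) module"
  where "coinvariants R B C \<delta> = B\<lparr>carrier := {b \<in> carrier B. \<delta> b = tensor_inl R B C b}\<rparr>"

text \<open>For \<open>\<O>(X) = B\<close>, the point of \<open>G(B \<otimes> \<O>(G0))\<close> obtained from \<open>x \<in> G(B)\<close> by conjugation with the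
  universal point of \<open>G0\<close>: \<open>g x g\<^sup>-\<^sup>1\<close>.\<close>

definition univ_conj ::
  "('k, 'm) ring_scheme \<Rightarrow> ('k, 'h, 's) hopf_scheme \<Rightarrow> ('k, 'h0, 't) hopf_scheme \<Rightarrow> ('h \<Rightarrow> 'h0) \<Rightarrow>
   ('k, 'b) module \<Rightarrow> ('h \<Rightarrow> 'b) \<Rightarrow> 'h \<Rightarrow> ('k, 'b + 'h0) univ"
  where "univ_conj R G G0 \<iota> B x =
    pt_conj R G (tensor R B G0) (\<lambda>h \<in> carrier G. tensor_inr R B G0 (\<iota> h))
      (\<lambda>h \<in> carrier G. tensor_inl R B G0 (x h))"

definition gpow_inv ::
  "('k, 'm) ring_scheme \<Rightarrow> ('k, 'h, 's) hopf_scheme \<Rightarrow> ('k, 'h0, 't) hopf_scheme \<Rightarrow> ('h \<Rightarrow> 'h0) \<Rightarrow>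
   'i set \<Rightarrow> ('k, ('k, 'i \<times> 'h) univ) module"
  where "gpow_inv R G G0 \<iota> I =
    (let B = gpow R G I
     in coinvariants R B G0
          (gpow_eval R (tensor R B G0) (\<lambda>i. univ_conj R G G0 \<iota> B (gpow_pt R G I i))))"


section \<open>The representation scheme\<close>

text \<open>\<open>\<O>(Rep)\<close> is the algebra carrying the universal representation \<open>\<Gamma> \<longrightarrow> G(\<O>(Rep))\<close>; its generators
  \<open>(\<gamma>, h)\<close> are the values \<open>h(\<rho>(\<gamma>))\<close>.\<close>

definition rep_cond ::
  "('k, 'm) ring_scheme \<Rightarrow> ('k, 'h, 's) hopf_scheme \<Rightarrow> ('g, 'u) monoid_scheme \<Rightarrow>
   ('k, 't) module \<Rightarrow> ('g \<times> 'h \<Rightarrow> 't) \<Rightarrow> bool"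
  where "rep_cond R G \<Gamma> T t \<longleftrightarrow> (\<lambda>\<gamma>. \<lambda>h \<in> carrier G. t (\<gamma>, h)) \<in> hom \<Gamma> (pt_group R G T)"

definition rep_alg ::
  "('k, 'm) ring_scheme \<Rightarrow> ('k, 'h, 's) hopf_scheme \<Rightarrow> ('g, 'u) monoid_scheme \<Rightarrow>
   ('k, ('k, 'g \<times> 'h) univ) module"
  where "rep_alg R G \<Gamma> = univ_alg R (carrier \<Gamma> \<times> carrier G) (rep_cond R G \<Gamma>)"

definition univ_rep ::
  "('k, 'm) ring_scheme \<Rightarrow> ('k, 'h, 's) hopf_scheme \<Rightarrow> ('g, 'u) monoid_scheme \<Rightarrow>
   'g \<Rightarrow> 'h \<Rightarrow> ('k, 'g \<times> 'h) univ"
  where "univ_rep R G \<Gamma> \<gamma> =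
    (\<lambda>h \<in> carrier G. univ_gen R (carrier \<Gamma> \<times> carrier G) (rep_cond R G \<Gamma>) (\<gamma>, h))"

text \<open>The homomorphism \<open>\<O>(Rep) \<longrightarrow> A\<close> classifying a representation \<open>\<rho> : \<Gamma> \<longrightarrow> G(A)\<close>.\<close>

definition rep_classify ::
  "('k, 'm) ring_scheme \<Rightarrow> ('k, 'a, 'r) module_scheme \<Rightarrow> ('g \<Rightarrow> 'h \<Rightarrow> 'a) \<Rightarrow> ('k, 'g \<times> 'h) univ \<Rightarrow> 'a"
  where "rep_classify R A \<rho> = univ_lift R A (\<lambda>(\<gamma>, h). \<rho> \<gamma> h)"

definition rep_inv ::
  "('k, 'm) ring_scheme \<Rightarrow> ('k, 'h, 's) hopf_scheme \<Rightarrow> ('k, 'h0, 't) hopf_scheme \<Rightarrow> ('h \<Rightarrow> 'h0) \<Rightarrow>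
   ('g, 'u) monoid_scheme \<Rightarrow> ('k, ('k, 'g \<times> 'h) univ) module"
  where "rep_inv R G G0 \<iota> \<Gamma> =
    (let B = rep_alg R G \<Gamma>
     in coinvariants R B G0
          (rep_classify R (tensor R B G0) (\<lambda>\<gamma>. univ_conj R G G0 \<iota> B (univ_rep R G \<Gamma> \<gamma>))))"


section \<open>Pseudocharacters\<close>

text \<open>\<open>f\<^sup>\<zeta>(g\<^sub>1, \<dots>, g\<^sub>n) = f(g\<^sub>\<zeta>\<^sub>(\<^sub>1\<^sub>), \<dots>, g\<^sub>\<zeta>\<^sub>(\<^sub>m\<^sub>))\<close>\<close>

definition pc_subst ::
  "('k, 'm) ring_scheme \<Rightarrow> ('k, 'h, 's) hopf_scheme \<Rightarrow> nat \<Rightarrow> (nat \<Rightarrow> nat) \<Rightarrow>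
   ('k, nat \<times> 'h) univ \<Rightarrow> ('k, nat \<times> 'h) univ"
  where "pc_subst R G n \<zeta> = gpow_eval R (gpow R G {1..n}) (\<lambda>i. gpow_pt R G {1..n} (\<zeta> i))"

text \<open>\<open>(g\<^sub>1, \<dots>, g\<^sub>n\<^sub>+\<^sub>1) \<mapsto> (g\<^sub>1, \<dots>, g\<^sub>n g\<^sub>n\<^sub>+\<^sub>1)\<close>\<close>

definition merge_last :: "('a \<Rightarrow> 'a \<Rightarrow> 'a) \<Rightarrow> nat \<Rightarrow> (nat \<Rightarrow> 'a) \<Rightarrow> nat \<Rightarrow> 'a"
  where "merge_last mul n g = (\<lambda>i \<in> {1..n}. if i = n then mul (g n) (g (n + 1)) else g i)"

definition pc_hat ::
  "('k, 'm) ring_scheme \<Rightarrow> ('k, 'h, 's) hopf_scheme \<Rightarrow> nat \<Rightarrow>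
   ('k, nat \<times> 'h) univ \<Rightarrow> ('k, nat \<times> 'h) univ"
  where "pc_hat R G n =
    (let B = gpow R G {1..n + 1}
     in gpow_eval R B (merge_last (pt_mult R G B) n (gpow_pt R G {1..n + 1})))"

text \<open>\<open>\<Theta> n f \<gamma>\<close> stands for \<open>\<Theta>\<^sub>n(f)(\<gamma>\<^sub>1, \<dots>, \<gamma>\<^sub>n)\<close>; the algebra structure of \<open>Map(\<Gamma>\<^sup>n, A)\<close> is
  pointwise.\<close>

definition pseudocharacter ::
  "('k, 'm) ring_scheme \<Rightarrow> ('k, 'h, 's) hopf_scheme \<Rightarrow> ('k, 'h0, 't) hopf_scheme \<Rightarrow> ('h \<Rightarrow> 'h0) \<Rightarrow>
   ('g, 'u) monoid_scheme \<Rightarrow> ('k, 'a, 'r) module_scheme \<Rightarrow>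
   (nat \<Rightarrow> ('k, nat \<times> 'h) univ \<Rightarrow> (nat \<Rightarrow> 'g) \<Rightarrow> 'a) \<Rightarrow> bool"
  where "pseudocharacter R G G0 \<iota> \<Gamma> A \<Theta> \<longleftrightarrow>
    (\<forall>n \<ge> 1. \<forall>\<gamma> \<in> {1..n} \<rightarrow>\<^sub>E carrier \<Gamma>.
       (\<lambda>f. \<Theta> n f \<gamma>) \<in> alg_hom R (gpow_inv R G G0 \<iota> {1..n}) A) \<and>
    (\<forall>m \<ge> 1. \<forall>n \<ge> 1. \<forall>\<zeta> \<in> {1..m} \<rightarrow> {1..n}.
       \<forall>f \<in> carrier (gpow_inv R G G0 \<iota> {1..m}). \<forall>\<gamma> \<in> {1..n} \<rightarrow>\<^sub>E carrier \<Gamma>.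
         \<Theta> n (pc_subst R G n \<zeta> f) \<gamma> = \<Theta> m f (\<lambda>i \<in> {1..m}. \<gamma> (\<zeta> i))) \<and>
    (\<forall>n \<ge> 1. \<forall>f \<in> carrier (gpow_inv R G G0 \<iota> {1..n}). \<forall>\<gamma> \<in> {1..n + 1} \<rightarrow>\<^sub>E carrier \<Gamma>.
         \<Theta> (n + 1) (pc_hat R G n f) \<gamma> = \<Theta> n f (merge_last (mult \<Gamma>) n \<gamma>))"

text \<open>\<open>\<O>(PC)\<close> is the algebra carrying the universal pseudocharacter; its generators \<open>(n, f, \<gamma>)\<close> are the
  values \<open>\<Theta>\<^sub>n(f)(\<gamma>)\<close>.\<close>

definition pc_vars ::
  "('k, 'm) ring_scheme \<Rightarrow> ('k, 'h, 's) hopf_scheme \<Rightarrow> ('k, 'h0, 't) hopf_scheme \<Rightarrow> ('h \<Rightarrow> 'h0) \<Rightarrow>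
   ('g, 'u) monoid_scheme \<Rightarrow> (nat \<times> ('k, nat \<times> 'h) univ \<times> (nat \<Rightarrow> 'g)) set"
  where "pc_vars R G G0 \<iota> \<Gamma> =
    {(n, f, \<gamma>). n \<ge> 1 \<and> f \<in> carrier (gpow_inv R G G0 \<iota> {1..n}) \<and> \<gamma> \<in> {1..n} \<rightarrow>\<^sub>E carrier \<Gamma>}"

definition pc_alg ::
  "('k, 'm) ring_scheme \<Rightarrow> ('k, 'h, 's) hopf_scheme \<Rightarrow> ('k, 'h0, 't) hopf_scheme \<Rightarrow> ('h \<Rightarrow> 'h0) \<Rightarrow>
   ('g, 'u) monoid_scheme \<Rightarrow>
   ('k, ('k, nat \<times> ('k, nat \<times> 'h) univ \<times> (nat \<Rightarrow> 'g)) univ) module"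
  where "pc_alg R G G0 \<iota> \<Gamma> =
    univ_alg R (pc_vars R G G0 \<iota> \<Gamma>)
      (\<lambda>T t. pseudocharacter R G G0 \<iota> \<Gamma> T (\<lambda>n f \<gamma>. t (n, f, \<gamma>)))"

text \<open>The homomorphism \<open>\<O>(PC) \<longrightarrow> A\<close> classifying a pseudocharacter \<open>\<Theta>\<close> over \<open>A\<close>.\<close>

definition pc_classify ::
  "('k, 'm) ring_scheme \<Rightarrow> ('k, 'a, 'r) module_scheme \<Rightarrow>
   (nat \<Rightarrow> ('k, nat \<times> 'h) univ \<Rightarrow> (nat \<Rightarrow> 'g) \<Rightarrow> 'a) \<Rightarrow>
   ('k, nat \<times> ('k, nat \<times> 'h) univ \<times> (nat \<Rightarrow> 'g)) univ \<Rightarrow> 'a"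
  where "pc_classify R A \<Theta> = univ_lift R A (\<lambda>(n, f, \<gamma>). \<Theta> n f \<gamma>)"

text \<open>\<open>\<Theta>\<^sub>\<rho>\<close>\<close>

definition pc_of_rep ::
  "('k, 'm) ring_scheme \<Rightarrow> ('k, 'a, 'r) module_scheme \<Rightarrow> ('g \<Rightarrow> 'h \<Rightarrow> 'a) \<Rightarrow>
   nat \<Rightarrow> ('k, nat \<times> 'h) univ \<Rightarrow> (nat \<Rightarrow> 'g) \<Rightarrow> 'a"
  where "pc_of_rep R A \<rho> n f \<gamma> = gpow_eval R A (\<lambda>i. \<rho> (\<gamma> i)) f"

text \<open>The comorphism \<open>\<O>(PC) \<longrightarrow> \<O>(Rep)\<close> of \<open>\<rho> \<mapsto> \<Theta>\<^sub>\<rho>\<close>: by Yoneda, it classifies the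
  pseudocharacter of the universal representation.\<close>

definition rep_to_pc ::
  "('k, 'm) ring_scheme \<Rightarrow> ('k, 'h, 's) hopf_scheme \<Rightarrow> ('g, 'u) monoid_scheme \<Rightarrow>
   ('k, nat \<times> ('k, nat \<times> 'h) univ \<times> (nat \<Rightarrow> 'g)) univ \<Rightarrow>
   ('k, 'g \<times> 'h) univ"
  where "rep_to_pc R G \<Gamma> =
    pc_classify R (rep_alg R G \<Gamma>) (pc_of_rep R (rep_alg R G \<Gamma>) (univ_rep R G \<Gamma>))"

end

theory Submission
  imports Defs
begin

text \<open>A split torus is linearly reductive: for a comodule \<open>B\<close> over \<open>\<O>(G0) = R[M]\<close> the projection to the
  component of weight zero, the Reynolds operator \<open>E\<close>, is natural in \<open>B\<close> and maps onto the invariants.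
  The ring \<open>\<O>(Rep)\<close> is the quotient of \<open>F = \<O>(G\<^sup>\<Gamma>)\<close>, with universal points \<open>x\<^sub>\<gamma>\<close>, by the ideal
  spanned by the differences \<open>f(\<dots>, x\<^sub>\<gamma> x\<^sub>\<gamma>\<^sub>') - f(\<dots>, x\<^sub>\<gamma>\<^sub>\<gamma>\<^sub>')\<close> with \<open>f \<in> \<O>(G\<^sup>n)\<close>. Applying \<open>E\<close>, its
  invariant part is spanned by the same differences with \<open>f\<close> invariant. These are the relations imposed by
  the multiplicativity axiom of pseudocharacters, and the other axioms present the ring of invariants of \<open>F\<close>.\<close>

section \<open>Monoid algebras\<close>

text \<open>Two obstacles shape the proof. The multiplicativity relations generate an ideal of
  \<open>F\<close>, while pseudocharacters see invariant functions only. But a multiple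
  \<open>q (h(x_\<gamma> x_\<gamma>') - h(x_\<gamma>\<gamma>'))\<close> is again a difference of two
  values of one function, namely of \<open>q h\<close> with a further variable reserved for
  \<open>h\<close>. So multiples cost nothing, and it is enough that \<open>E\<close> is additive
  and commutes with substitutions. The kernel is never described by generators: the universal
  property of \<open>O(Rep)\<close> is tested on a quotient of \<open>F\<close>. This needs an
  additive map from \<open>F\<close> to \<open>O(PC)\<close>, which is well defined because any two
  presentations can be rewritten over one tuple of distinct group elements, where
  \<open>O(G^N)\<close> is a retract of \<open>F\<close>. The other obstacle is formal. Tensor
  products, \<open>O(G^I)\<close>, \<open>O(Rep)\<close> and \<open>O(PC)\<close> are quotients by
  the intersection of all ideals modulo which a predicate holds, and an arbitrary predicate may fail
  modulo the intersection. Each predicate is therefore shown to be reflected by jointly injective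
  families; all universal properties rest on this.\<close>

locale monoid_algebra = cring R + M: comm_monoid M
  for R :: "('k, 'r) ring_scheme" (structure) and M :: "('n, 's) monoid_scheme"
begin

abbreviation P where "P \<equiv> monoid_alg R M"
abbreviation supp where "supp p \<equiv> {m. p m \<noteq> \<zero>}"

definition term_at :: "'k \<Rightarrow> 'n \<Rightarrow> 'n \<Rightarrow> 'k"
  where "term_at c m = (\<lambda>x. if x = m then c else \<zero>)"

lemma carrier_iff: "p \<in> carrier P \<longleftrightarrow> (\<forall>m. p m \<in> carrier R) \<and> finite (supp p) \<and> supp p \<subseteq> carrier M"
  by (auto simp: monoid_alg_def)

lemma coeff_closed [simp]: "p \<in> carrier P \<Longrightarrow> p m \<in> carrier R"
  by (simp add: carrier_iff)

lemma finite_supp: "p \<in> carrier P \<Longrightarrow> finite (supp p)"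
  by (simp add: carrier_iff)

lemma supp_subset: "p \<in> carrier P \<Longrightarrow> supp p \<subseteq> carrier M"
  by (simp add: carrier_iff)

lemma zero_eq: "\<zero>\<^bsub>P\<^esub> = (\<lambda>m. \<zero>)" and add_eq: "p \<oplus>\<^bsub>P\<^esub> q = (\<lambda>m. p m \<oplus> q m)"
  and one_eq: "\<one>\<^bsub>P\<^esub> = term_at \<one> \<one>\<^bsub>M\<^esub>"
  by (simp_all add: monoid_alg_def term_at_def)

text \<open>The definition sums over a set of pairs that depends on \<open>p\<close>,
  \<open>q\<close> and \<open>m\<close>. A fixed rectangle \<open>S \<times> T\<close> containing
  the supports lets products with different factors be compared term by term.\<close>

lemma mult_eq:
  assumes p: "p \<in> carrier P" and q: "q \<in> carrier P"
    and S: "finite S" "supp p \<subseteq> S" and T: "finite T" "supp q \<subseteq> T"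
  shows "(p \<otimes>\<^bsub>P\<^esub> q) m = (\<Oplus>c \<in> S \<times> T. if fst c \<otimes>\<^bsub>M\<^esub> snd c = m then p (fst c) \<otimes> q (snd c) else \<zero>)"
proof -
  have "(p \<otimes>\<^bsub>P\<^esub> q) m = (\<Oplus>c \<in> {(a, b). p a \<noteq> \<zero> \<and> q b \<noteq> \<zero> \<and> a \<otimes>\<^bsub>M\<^esub> b = m}. p (fst c) \<otimes> q (snd c))"
    by (simp add: monoid_alg_def)
  also have "\<dots> = (\<Oplus>c \<in> S \<times> T. if fst c \<otimes>\<^bsub>M\<^esub> snd c = m then p (fst c) \<otimes> q (snd c) else \<zero>)"
    by (rule add.finprod_mono_neutral_cong_left) (use assms in auto)
  finally show ?thesis .
qed

lemma add_closed: "p \<in> carrier P \<Longrightarrow> q \<in> carrier P \<Longrightarrow> p \<oplus>\<^bsub>P\<^esub> q \<in> carrier P"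
proof -
  assume p: "p \<in> carrier P" and q: "q \<in> carrier P"
  have "supp (p \<oplus>\<^bsub>P\<^esub> q) \<subseteq> supp p \<union> supp q" by (auto simp: add_eq)
  with p q show ?thesis
    by (auto simp: carrier_iff add_eq intro: finite_subset)
qed

lemma mult_closed: "p \<in> carrier P \<Longrightarrow> q \<in> carrier P \<Longrightarrow> p \<otimes>\<^bsub>P\<^esub> q \<in> carrier P"
proof -
  assume p: "p \<in> carrier P" and q: "q \<in> carrier P"
  have "supp (p \<otimes>\<^bsub>P\<^esub> q) \<subseteq> (\<lambda>(a, b). a \<otimes>\<^bsub>M\<^esub> b) ` (supp p \<times> supp q)"
  proof
    fix m assume m: "m \<in> supp (p \<otimes>\<^bsub>P\<^esub> q)"
    show "m \<in> (\<lambda>(a, b). a \<otimes>\<^bsub>M\<^esub> b) ` (supp p \<times> supp q)"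
    proof (rule ccontr)
      assume "m \<notin> (\<lambda>(a, b). a \<otimes>\<^bsub>M\<^esub> b) ` (supp p \<times> supp q)"
      then have "(p \<otimes>\<^bsub>P\<^esub> q) m = (\<Oplus>c \<in> supp p \<times> supp q. \<zero>)"
        by (subst mult_eq[OF p q finite_supp[OF p] order.refl finite_supp[OF q] order.refl])
          (rule add.finprod_cong', auto simp: p q)
      with m show False by simp
    qed
  qed
  moreover have "finite ((\<lambda>(a, b). a \<otimes>\<^bsub>M\<^esub> b) ` (supp p \<times> supp q))"
    using p q by (simp add: finite_supp)
  moreover have "(\<lambda>(a, b). a \<otimes>\<^bsub>M\<^esub> b) ` (supp p \<times> supp q) \<subseteq> carrier M"
    using supp_subset[OF p] supp_subset[OF q] by fastforce
  moreover have "(p \<otimes>\<^bsub>P\<^esub> q) m \<in> carrier R" for m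
    by (subst mult_eq[OF p q finite_supp[OF p] order.refl finite_supp[OF q] order.refl])
      (auto intro!: add.finprod_closed simp: p q)
  ultimately show ?thesis
    by (simp add: carrier_iff) (meson finite_subset order.trans)
qed

lemma term_closed [simp]: "c \<in> carrier R \<Longrightarrow> m \<in> carrier M \<Longrightarrow> term_at c m \<in> carrier P"
  by (auto simp: carrier_iff term_at_def)

lemma term_mult:
  assumes "c \<in> carrier R" "d \<in> carrier R" "a \<in> carrier M" "b \<in> carrier M"
  shows "term_at c a \<otimes>\<^bsub>P\<^esub> term_at d b = term_at (c \<otimes> d) (a \<otimes>\<^bsub>M\<^esub> b)"
proof
  fix m
  have "(term_at c a \<otimes>\<^bsub>P\<^esub> term_at d b) m
      = (\<Oplus>x \<in> {a} \<times> {b}. if fst x \<otimes>\<^bsub>M\<^esub> snd x = m then term_at c a (fst x) \<otimes> term_at d b (snd x) else \<zero>)"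
    by (rule mult_eq) (use assms in simp_all, auto simp: term_at_def)
  also have "\<dots> = term_at (c \<otimes> d) (a \<otimes>\<^bsub>M\<^esub> b) m"
    using assms by (simp add: term_at_def)
  finally show "(term_at c a \<otimes>\<^bsub>P\<^esub> term_at d b) m = term_at (c \<otimes> d) (a \<otimes>\<^bsub>M\<^esub> b) m" .
qed

lemma mult_comm:
  assumes p: "p \<in> carrier P" and q: "q \<in> carrier P"
  shows "p \<otimes>\<^bsub>P\<^esub> q = q \<otimes>\<^bsub>P\<^esub> p"
proof
  fix m
  let ?f = "\<lambda>p q c. if fst c \<otimes>\<^bsub>M\<^esub> snd c = m then p (fst c) \<otimes> q (snd c) else \<zero>"
  have "(q \<otimes>\<^bsub>P\<^esub> p) m = (\<Oplus>c \<in> prod.swap ` (supp p \<times> supp q). ?f q p c)"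
    using p q by (subst mult_eq[of q p "supp q" "supp p"]) (auto simp: finite_supp product_swap)
  also have "\<dots> = (\<Oplus>c \<in> supp p \<times> supp q. ?f q p (prod.swap c))"
    by (rule add.finprod_reindex) (auto simp: p q)
  also have "\<dots> = (\<Oplus>c \<in> supp p \<times> supp q. ?f p q c)"
    using supp_subset[OF p] supp_subset[OF q]
    by (intro add.finprod_cong') (auto simp: p q m_comm M.m_comm subset_iff)
  also have "\<dots> = (p \<otimes>\<^bsub>P\<^esub> q) m"
    using p q by (subst mult_eq[of p q "supp p" "supp q"]) (auto simp: finite_supp)
  finally show "(p \<otimes>\<^bsub>P\<^esub> q) m = (q \<otimes>\<^bsub>P\<^esub> p) m" ..
qed

lemma distrib_right:
  assumes p: "p \<in> carrier P" and q: "q \<in> carrier P" and r: "r \<in> carrier P"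
  shows "(p \<oplus>\<^bsub>P\<^esub> q) \<otimes>\<^bsub>P\<^esub> r = p \<otimes>\<^bsub>P\<^esub> r \<oplus>\<^bsub>P\<^esub> q \<otimes>\<^bsub>P\<^esub> r"
proof
  fix m
  let ?S = "supp p \<union> supp q" and ?T = "supp r"
  let ?f = "\<lambda>p c. if fst c \<otimes>\<^bsub>M\<^esub> snd c = m then p (fst c) \<otimes> r (snd c) else \<zero>"
  have fin: "finite ?S" "finite ?T" using p q r by (auto simp: finite_supp)
  have "((p \<oplus>\<^bsub>P\<^esub> q) \<otimes>\<^bsub>P\<^esub> r) m = (\<Oplus>c \<in> ?S \<times> ?T. ?f (p \<oplus>\<^bsub>P\<^esub> q) c)"
    by (rule mult_eq) (use fin p q r add_closed in \<open>auto simp: add_eq\<close>)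
  also have "\<dots> = (\<Oplus>c \<in> ?S \<times> ?T. ?f p c \<oplus> ?f q c)"
    by (rule add.finprod_cong') (auto simp: add_eq l_distr p q r)
  also have "\<dots> = (\<Oplus>c \<in> ?S \<times> ?T. ?f p c) \<oplus> (\<Oplus>c \<in> ?S \<times> ?T. ?f q c)"
    by (rule add.finprod_multf) (auto simp: p q r)
  also have "\<dots> = (p \<otimes>\<^bsub>P\<^esub> r \<oplus>\<^bsub>P\<^esub> q \<otimes>\<^bsub>P\<^esub> r) m"
    using fin p q r by (simp add: add_eq mult_eq[of p r ?S ?T] mult_eq[of q r ?S ?T])
  finally show "((p \<oplus>\<^bsub>P\<^esub> q) \<otimes>\<^bsub>P\<^esub> r) m = (p \<otimes>\<^bsub>P\<^esub> r \<oplus>\<^bsub>P\<^esub> q \<otimes>\<^bsub>P\<^esub> r) m" .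
qed

lemma distrib_left:
  assumes p: "p \<in> carrier P" and q: "q \<in> carrier P" and r: "r \<in> carrier P"
  shows "r \<otimes>\<^bsub>P\<^esub> (p \<oplus>\<^bsub>P\<^esub> q) = r \<otimes>\<^bsub>P\<^esub> p \<oplus>\<^bsub>P\<^esub> r \<otimes>\<^bsub>P\<^esub> q"
  using assms by (simp add: mult_comm[of r] add_closed distrib_right)

text \<open>Induction on the finite support, removing one coefficient at a time. Identities additive
  in \<open>p\<close>, such as associativity and multiplicativity of evaluations, are thereby
  reduced to monomials.\<close>

lemma term_induct [consumes 1, case_names zero add]:
  assumes "p \<in> carrier P" and Z: "Q \<zero>\<^bsub>P\<^esub>"
    and A: "\<And>p c m. p \<in> carrier P \<Longrightarrow> Q p \<Longrightarrow> c \<in> carrier R \<Longrightarrow> m \<in> carrier M \<Longrightarrow> p m = \<zero> \<Longrightarrow>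
      Q (p \<oplus>\<^bsub>P\<^esub> term_at c m)"
  shows "Q p"
proof -
  have "Q p" if "finite S" "p \<in> carrier P" "supp p = S" for S p
    using that
  proof (induction S arbitrary: p)
    case empty
    then have "p = \<zero>\<^bsub>P\<^esub>" by (auto simp: zero_eq)
    with Z show ?case by simp
  next
    case (insert m S)
    let ?p = "p (m := \<zero>)"
    have s: "supp ?p = S" using insert by auto
    have m: "m \<in> carrier M" using insert.prems supp_subset by blast
    have c: "?p \<in> carrier P" using insert.prems s insert.hyps
      unfolding carrier_iff s by (auto simp: carrier_iff)
    have "p = ?p \<oplus>\<^bsub>P\<^esub> term_at (p m) m"
      using insert.prems by (auto simp: add_eq term_at_def)
    moreover have "Q (?p \<oplus>\<^bsub>P\<^esub> term_at (p m) m)"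
      using insert.IH[OF c s] c m insert.prems by (intro A) (simp_all del: fun_upd_apply, simp)
    ultimately show ?case by simp
  qed
  with assms(1) show ?thesis using finite_supp by blast
qed

lemma abelian_group_P: "abelian_group P"
proof (rule abelian_groupI)
  fix p assume p: "p \<in> carrier P"
  have "(\<lambda>m. \<ominus> p m) \<in> carrier P"
    using p by (auto simp: carrier_iff elim!: rev_finite_subset) 
  moreover have "(\<lambda>m. \<ominus> p m) \<oplus>\<^bsub>P\<^esub> p = \<zero>\<^bsub>P\<^esub>"
    using p by (auto simp: add_eq zero_eq l_neg)
  ultimately show "\<exists>q\<in>carrier P. q \<oplus>\<^bsub>P\<^esub> p = \<zero>\<^bsub>P\<^esub>" by blast
qed (auto intro: add_closed, auto simp: add_eq zero_eq a_ac carrier_iff)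

lemma one_closed': "\<one>\<^bsub>P\<^esub> \<in> carrier P"
  by (simp add: one_eq)

lemma mult_zero: "p \<in> carrier P \<Longrightarrow> p \<otimes>\<^bsub>P\<^esub> \<zero>\<^bsub>P\<^esub> = \<zero>\<^bsub>P\<^esub>" "p \<in> carrier P \<Longrightarrow> \<zero>\<^bsub>P\<^esub> \<otimes>\<^bsub>P\<^esub> p = \<zero>\<^bsub>P\<^esub>"
  by (auto simp: monoid_alg_def)

lemma mult_assoc:
  assumes p: "p \<in> carrier P" and q: "q \<in> carrier P" and r: "r \<in> carrier P"
  shows "(p \<otimes>\<^bsub>P\<^esub> q) \<otimes>\<^bsub>P\<^esub> r = p \<otimes>\<^bsub>P\<^esub> (q \<otimes>\<^bsub>P\<^esub> r)"
  using p
proof (induction p rule: term_induct)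
  case zero
  then show ?case using q r by (simp add: mult_zero mult_closed)
next
  case (add p c m)
  have "(term_at c m \<otimes>\<^bsub>P\<^esub> q) \<otimes>\<^bsub>P\<^esub> r = term_at c m \<otimes>\<^bsub>P\<^esub> (q \<otimes>\<^bsub>P\<^esub> r)"
    using q
  proof (induction q rule: term_induct)
    case zero
    then show ?case using add r by (simp add: mult_zero mult_closed)
  next
    case (add q d n)
    have "(term_at c m \<otimes>\<^bsub>P\<^esub> term_at d n) \<otimes>\<^bsub>P\<^esub> r = term_at c m \<otimes>\<^bsub>P\<^esub> (term_at d n \<otimes>\<^bsub>P\<^esub> r)"
      using r
    proof (induction r rule: term_induct)
      case zero
      then show ?case using add \<open>c \<in> _\<close> \<open>m \<in> _\<close> by (simp add: mult_zero mult_closed)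
    next
      case (add r e l)
      then show ?case using \<open>c \<in> _\<close> \<open>m \<in> _\<close> \<open>d \<in> _\<close> \<open>n \<in> _\<close>
        by (simp add: distrib_left mult_closed add_closed term_mult m_assoc M.m_assoc)
    qed
    then show ?case using add \<open>c \<in> _\<close> \<open>m \<in> _\<close> r
      by (simp add: distrib_left distrib_right mult_closed add_closed)
  qed
  then show ?case using add q r
    by (simp add: distrib_right mult_closed add_closed)
qed

lemma mult_one: "p \<in> carrier P \<Longrightarrow> \<one>\<^bsub>P\<^esub> \<otimes>\<^bsub>P\<^esub> p = p"
proof (induction p rule: term_induct)
  case zero
  then show ?case by (simp add: mult_zero one_closed')
next
  case (add p c m)
  have "\<one>\<^bsub>P\<^esub> \<otimes>\<^bsub>P\<^esub> term_at c m = term_at c m"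
    using add by (simp add: one_eq term_mult)
  then show ?case using add by (simp add: distrib_left one_closed')
qed

lemma cring_P: "cring P"
  by (intro cringI abelian_group_P comm_monoidI distrib_right)
    (auto simp: mult_closed one_closed' mult_assoc mult_one intro: mult_comm)

lemma const_ring_hom: "(\<lambda>c. term_at c \<one>\<^bsub>M\<^esub>) \<in> ring_hom R P"
  by (rule ring_hom_memI) (auto simp: term_mult one_eq, auto simp: term_at_def add_eq)

end

section \<open>The universal property of monoid algebras\<close>

definition meval where
  "meval R C \<sigma> \<mu> p = (\<Oplus>\<^bsub>C\<^esub>m \<in> {m. p m \<noteq> \<zero>\<^bsub>R\<^esub>}. \<sigma> (p m) \<otimes>\<^bsub>C\<^esub> \<mu> m)"

locale monoid_algebra_eval = monoid_algebra R M + C: cring C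
  for R :: "('k, 'r) ring_scheme" (structure) and M :: "('n, 's) monoid_scheme"
    and C :: "('c, 't) ring_scheme" +
  fixes \<sigma> \<mu>
  assumes \<sigma>: "\<sigma> \<in> ring_hom R C"
    and \<mu>_closed: "\<And>m. m \<in> carrier M \<Longrightarrow> \<mu> m \<in> carrier C"
    and \<mu>_one: "\<mu> \<one>\<^bsub>M\<^esub> = \<one>\<^bsub>C\<^esub>"
    and \<mu>_mult: "\<And>m n. m \<in> carrier M \<Longrightarrow> n \<in> carrier M \<Longrightarrow> \<mu> (m \<otimes>\<^bsub>M\<^esub> n) = \<mu> m \<otimes>\<^bsub>C\<^esub> \<mu> n"
begin

abbreviation ev where "ev \<equiv> meval R C \<sigma> \<mu>"

lemma \<sigma>_zero: "\<sigma> \<zero> = \<zero>\<^bsub>C\<^esub>"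
  by (rule ring_hom_zero[OF \<sigma>]) (simp_all add: ring_axioms C.ring_axioms)

lemma \<sigma>_closed: "c \<in> carrier R \<Longrightarrow> \<sigma> c \<in> carrier C"
  by (rule ring_hom_closed[OF \<sigma>])

lemma eval_eq:
  assumes p: "p \<in> carrier P" and S: "finite S" "supp p \<subseteq> S" "S \<subseteq> carrier M"
  shows "ev p = (\<Oplus>\<^bsub>C\<^esub>m \<in> S. \<sigma> (p m) \<otimes>\<^bsub>C\<^esub> \<mu> m)"
  unfolding meval_def
  by (rule C.add.finprod_mono_neutral_cong_left) (use assms in \<open>auto simp: \<sigma>_zero \<sigma>_closed \<mu>_closed subset_iff\<close>)

lemma eval_closed: "p \<in> carrier P \<Longrightarrow> ev p \<in> carrier C"
  using supp_subset[of p] by (auto simp: meval_def \<sigma>_closed \<mu>_closed intro!: C.finsum_closed)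

lemma eval_term:
  assumes "c \<in> carrier R" "m \<in> carrier M"
  shows "ev (term_at c m) = \<sigma> c \<otimes>\<^bsub>C\<^esub> \<mu> m"
  using assms by (subst eval_eq[of _ "{m}"]) (simp_all add: \<sigma>_closed \<mu>_closed, auto simp: term_at_def \<sigma>_closed \<mu>_closed)

lemma eval_add:
  assumes p: "p \<in> carrier P" and q: "q \<in> carrier P"
  shows "ev (p \<oplus>\<^bsub>P\<^esub> q) = ev p \<oplus>\<^bsub>C\<^esub> ev q"
proof -
  let ?S = "supp p \<union> supp q"
  have fin: "finite ?S" and S: "?S \<subseteq> carrier M"
    using p q finite_supp supp_subset by auto
  have "ev (p \<oplus>\<^bsub>P\<^esub> q) = (\<Oplus>\<^bsub>C\<^esub>m \<in> ?S. \<sigma> (p m \<oplus> q m) \<otimes>\<^bsub>C\<^esub> \<mu> m)"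
    using p q fin S by (subst eval_eq[of _ ?S]) (auto simp: add_closed, auto simp: add_eq)
  also have "\<dots> = (\<Oplus>\<^bsub>C\<^esub>m \<in> ?S. \<sigma> (p m) \<otimes>\<^bsub>C\<^esub> \<mu> m \<oplus>\<^bsub>C\<^esub> \<sigma> (q m) \<otimes>\<^bsub>C\<^esub> \<mu> m)"
    using p q S by (intro C.add.finprod_cong')
      (auto simp: ring_hom_add[OF \<sigma>] C.l_distr \<sigma>_closed \<mu>_closed subset_iff)
  also have "\<dots> = ev p \<oplus>\<^bsub>C\<^esub> ev q"
    using p q S fin
    by (subst C.add.finprod_multf) (auto simp: \<sigma>_closed \<mu>_closed eval_eq[of _ ?S] subset_iff)
  finally show ?thesis .
qed

lemma eval_zero: "ev \<zero>\<^bsub>P\<^esub> = \<zero>\<^bsub>C\<^esub>"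
  by (simp add: meval_def zero_eq)

lemma eval_mult:
  assumes p: "p \<in> carrier P" and q: "q \<in> carrier P"
  shows "ev (p \<otimes>\<^bsub>P\<^esub> q) = ev p \<otimes>\<^bsub>C\<^esub> ev q"
  using p
proof (induction p rule: term_induct)
  case zero
  then show ?case using q by (simp add: mult_zero eval_zero eval_closed)
next
  case (add p c m)
  have "ev (term_at c m \<otimes>\<^bsub>P\<^esub> q) = ev (term_at c m) \<otimes>\<^bsub>C\<^esub> ev q"
    using q
  proof (induction q rule: term_induct)
    case zero
    then show ?case using add by (simp add: mult_zero eval_zero eval_closed)
  next
    case (add q d n)
    have "ev (term_at c m \<otimes>\<^bsub>P\<^esub> term_at d n) = ev (term_at c m) \<otimes>\<^bsub>C\<^esub> ev (term_at d n)"
      using add \<open>c \<in> _\<close> \<open>m \<in> _\<close>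
      by (simp add: term_mult eval_term \<mu>_mult ring_hom_mult[OF \<sigma>] C.m_ac \<sigma>_closed \<mu>_closed)
    then show ?case using add \<open>c \<in> _\<close> \<open>m \<in> _\<close>
      by (simp add: distrib_left mult_closed add_closed eval_add eval_closed C.r_distr)
  qed
  then show ?case using add q
    by (simp add: distrib_right mult_closed add_closed eval_add eval_closed C.l_distr)
qed

lemma eval_ring_hom: "ev \<in> ring_hom P C"
proof (rule ring_hom_memI)
  show "ev \<one>\<^bsub>P\<^esub> = \<one>\<^bsub>C\<^esub>"
    by (simp add: one_eq eval_term \<mu>_one ring_hom_one[OF \<sigma>])
qed (auto simp: eval_closed eval_add eval_mult)

end

section \<open>Homomorphisms and quotients of algebras\<close>

lemma alg_homI:
  assumes "f \<in> ring_hom A B"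
    and "\<And>k a. k \<in> carrier R \<Longrightarrow> a \<in> carrier A \<Longrightarrow> f (k \<odot>\<^bsub>A\<^esub> a) = k \<odot>\<^bsub>B\<^esub> f a"
  shows "f \<in> alg_hom R A B"
  using assms by (simp add: alg_hom_def)

lemma alg_hom_ring_hom: "f \<in> alg_hom R A B \<Longrightarrow> f \<in> ring_hom A B"
  by (simp add: alg_hom_def)

lemma alg_hom_closed: "f \<in> alg_hom R A B \<Longrightarrow> a \<in> carrier A \<Longrightarrow> f a \<in> carrier B"
  by (simp add: alg_hom_def ring_hom_def Pi_def)

lemma alg_hom_add:
  "f \<in> alg_hom R A B \<Longrightarrow> a \<in> carrier A \<Longrightarrow> b \<in> carrier A \<Longrightarrow> f (a \<oplus>\<^bsub>A\<^esub> b) = f a \<oplus>\<^bsub>B\<^esub> f b"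
  by (simp add: alg_hom_def ring_hom_def)

lemma alg_hom_mult:
  "f \<in> alg_hom R A B \<Longrightarrow> a \<in> carrier A \<Longrightarrow> b \<in> carrier A \<Longrightarrow> f (a \<otimes>\<^bsub>A\<^esub> b) = f a \<otimes>\<^bsub>B\<^esub> f b"
  by (simp add: alg_hom_def ring_hom_def)

lemma alg_hom_one: "f \<in> alg_hom R A B \<Longrightarrow> f \<one>\<^bsub>A\<^esub> = \<one>\<^bsub>B\<^esub>"
  by (simp add: alg_hom_def ring_hom_def)

lemma alg_hom_smult:
  "f \<in> alg_hom R A B \<Longrightarrow> k \<in> carrier R \<Longrightarrow> a \<in> carrier A \<Longrightarrow> f (k \<odot>\<^bsub>A\<^esub> a) = k \<odot>\<^bsub>B\<^esub> f a"
  by (simp add: alg_hom_def)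

lemma algebra_cring: "algebra R A \<Longrightarrow> cring A"
  by (rule algebra.M_cring)

lemma algebra_ring: "algebra R A \<Longrightarrow> ring A"
  by (rule cring.axioms(1)[OF algebra.M_cring])

lemma algebra_base: "algebra R A \<Longrightarrow> cring R"
  by (rule algebra.R_cring)

lemma alg_hom_zero: "f \<in> alg_hom R A B \<Longrightarrow> algebra R A \<Longrightarrow> algebra R B \<Longrightarrow> f \<zero>\<^bsub>A\<^esub> = \<zero>\<^bsub>B\<^esub>"
  by (rule ring_hom_zero) (simp_all add: alg_hom_ring_hom algebra_ring)

lemma alg_hom_cong:
  assumes "f \<in> alg_hom R A B" "algebra R A" "\<And>a. a \<in> carrier A \<Longrightarrow> g a = f a"
  shows "g \<in> alg_hom R A B"
proof -
  interpret algebra R A by fact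
  show ?thesis
    using assms(1,3) unfolding alg_hom_def ring_hom_def by auto
qed

lemma alg_hom_compose:
  "f \<in> alg_hom R A B \<Longrightarrow> g \<in> alg_hom R B C \<Longrightarrow> (\<lambda>a. g (f a)) \<in> alg_hom R A C"
  by (auto intro!: alg_homI ring_hom_memI
      simp: alg_hom_closed alg_hom_add alg_hom_mult alg_hom_one alg_hom_smult)

lemma alg_hom_id: "(\<lambda>a. a) \<in> alg_hom R A A"
  by (auto simp: alg_hom_def ring_hom_def)

lemma algebra_structure_mult:
  assumes "algebra R A" "k \<in> carrier R" "a \<in> carrier A"
  shows "structure_map A k \<otimes>\<^bsub>A\<^esub> a = k \<odot>\<^bsub>A\<^esub> a"
proof -
  interpret algebra R A by fact
  show ?thesis using assms(2,3) by (simp add: structure_map_def smult_assoc2)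
qed

lemma structure_map_ring_hom:
  assumes "algebra R A"
  shows "structure_map A \<in> ring_hom R A"
proof -
  interpret algebra R A by fact
  show ?thesis
    by (rule ring_hom_memI) (auto simp: structure_map_def smult_l_distr smult_assoc1 smult_assoc2)
qed

lemma structure_map_closed: "algebra R A \<Longrightarrow> k \<in> carrier R \<Longrightarrow> structure_map A k \<in> carrier A"
  by (rule ring_hom_closed[OF structure_map_ring_hom])

lemma alg_hom_structure_map:
  assumes "f \<in> alg_hom R A B" "algebra R A" "k \<in> carrier R"
  shows "f (structure_map A k) = structure_map B k"
proof -
  interpret algebra R A by fact
  show ?thesis using assms by (simp add: structure_map_def alg_hom_smult alg_hom_one)
qed

text \<open>The scalar action is multiplication by the image of the scalar under the structure map,
  so linearity of a ring homomorphism only has to be checked on constants.\<close>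

lemma alg_hom_from_structure_map:
  assumes "algebra R A" "algebra R B" "f \<in> ring_hom A B"
    and "\<And>k. k \<in> carrier R \<Longrightarrow> f (structure_map A k) = structure_map B k"
  shows "f \<in> alg_hom R A B"
proof (rule alg_homI[OF assms(3)])
  fix k a assume k: "k \<in> carrier R" and a: "a \<in> carrier A"
  have "f (k \<odot>\<^bsub>A\<^esub> a) = f (structure_map A k \<otimes>\<^bsub>A\<^esub> a)"
    using assms k a by (simp add: algebra_structure_mult)
  also have "\<dots> = structure_map B k \<otimes>\<^bsub>B\<^esub> f a"
    using assms k a by (simp add: ring_hom_mult structure_map_closed)
  also have "\<dots> = k \<odot>\<^bsub>B\<^esub> f a"
    using assms k a by (simp add: algebra_structure_mult ring_hom_closed)
  finally show "f (k \<odot>\<^bsub>A\<^esub> a) = k \<odot>\<^bsub>B\<^esub> f a" .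
qed

lemma algebra_from_structure_map:
  fixes R (structure)
  assumes "cring R" "cring A" "s \<in> ring_hom R A"
    and sm: "\<And>k a. k \<in> carrier R \<Longrightarrow> a \<in> carrier A \<Longrightarrow> k \<odot>\<^bsub>A\<^esub> a = s k \<otimes>\<^bsub>A\<^esub> a"
  shows "algebra R A"
proof -
  interpret R: cring R by fact
  interpret A: cring A by fact
  have s: "\<And>k. k \<in> carrier R \<Longrightarrow> s k \<in> carrier A"
    using assms(3) by (rule ring_hom_closed)
  show ?thesis
    by (rule algebraI[OF assms(1,2)])
      (auto simp: sm s ring_hom_add[OF assms(3)] ring_hom_mult[OF assms(3)] ring_hom_one[OF assms(3)]
        A.l_distr A.r_distr A.m_assoc)
qed

lemma cring_cong:
  assumes "cring A" "carrier B = carrier A" "mult B = mult A" "one B = one A" "zero B = zero A" "add B = add A"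
  shows "cring B"
proof -
  interpret A: cring A by fact
  show ?thesis
  proof (rule cringI)
    show "abelian_group B"
      by (rule abelian_groupI) (use assms in \<open>auto simp: A.a_assoc intro: A.a_comm A.l_neg\<close>)
    show "comm_monoid B"
      by (rule comm_monoidI) (use assms in \<open>auto simp: A.m_assoc intro: A.m_comm\<close>)
  qed (use assms in \<open>auto simp: A.l_distr\<close>)
qed

lemma ring_hom_cong:
  assumes "carrier B = carrier A" "mult B = mult A" "one B = one A" "add B = add A"
  shows "ring_hom B C = ring_hom A C" "ring_hom C B = ring_hom C A"
  using assms by (simp_all add: ring_hom_def)

locale algebra_quotient = algebra R A + ideal I A
  for R :: "('k, 'm) ring_scheme" and A :: "('k, 'a, 'r) module_scheme" and I
begin

abbreviation Q where "Q \<equiv> alg_quot A I"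
abbreviation cls where "cls a \<equiv> I +>\<^bsub>A\<^esub> a"

lemma cls_closed: "a \<in> carrier A \<Longrightarrow> cls a \<in> carrier Q"
  by (auto simp: alg_quot_def FactRing_def A_RCOSETS_def' )

lemma carrier_cases:
  assumes "C \<in> carrier Q" obtains a where "a \<in> carrier A" "C = cls a"
  using assms by (auto simp: alg_quot_def FactRing_def A_RCOSETS_def')

lemma cls_eq_iff:
  assumes "a \<in> carrier A" "b \<in> carrier A"
  shows "cls a = cls b \<longleftrightarrow> a \<ominus>\<^bsub>A\<^esub> b \<in> I"
  using quotient_eq_iff_same_a_r_cos[OF ideal_axioms assms] by simp

text \<open>The scalar action on the quotient is a union over all representatives of the coset. It
  is a single coset because \<open>k (b - a)\<close> equals \<open>(k 1) (b - a)\<close>, which lies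
  in the ideal with \<open>b - a\<close>.\<close>

lemma cls_smult:
  assumes k: "k \<in> carrier R" and a: "a \<in> carrier A"
  shows "k \<odot>\<^bsub>Q\<^esub> cls a = cls (k \<odot>\<^bsub>A\<^esub> a)"
proof -
  have "cls (k \<odot>\<^bsub>A\<^esub> b) = cls (k \<odot>\<^bsub>A\<^esub> a)" if b: "b \<in> cls a" for b
  proof -
    have bA: "b \<in> carrier A" using b a a_r_coset_subset_G[OF a_subset] by blast
    have "cls b = cls a" using a_repr_independence'[OF b a] by simp
    then have "b \<ominus>\<^bsub>A\<^esub> a \<in> I" using cls_eq_iff[OF bA a] by simp
    then have "structure_map A k \<otimes>\<^bsub>A\<^esub> (b \<ominus>\<^bsub>A\<^esub> a) \<in> I"
      using k by (intro I_l_closed) (auto simp: structure_map_def)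
    also have "structure_map A k \<otimes>\<^bsub>A\<^esub> (b \<ominus>\<^bsub>A\<^esub> a) = k \<odot>\<^bsub>A\<^esub> b \<ominus>\<^bsub>A\<^esub> k \<odot>\<^bsub>A\<^esub> a"
      using k a bA by (simp add: algebra_structure_mult[OF algebra_axioms] a_minus_def smult_r_distr smult_r_minus)
    finally show ?thesis using k a bA by (subst cls_eq_iff) auto
  qed
  then have "(\<Union>b \<in> cls a. cls (k \<odot>\<^bsub>A\<^esub> b)) = (\<Union>b \<in> cls a. cls (k \<odot>\<^bsub>A\<^esub> a))"
    by (intro SUP_cong refl)
  also have "\<dots> = cls (k \<odot>\<^bsub>A\<^esub> a)"
    using a_rcos_self[OF a] by blast
  finally show ?thesis by (simp add: alg_quot_def)
qed

lemma cls_ring_hom: "cls \<in> ring_hom A Q"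
  using rcos_ring_hom by (simp add: alg_quot_def ring_hom_def)

lemma algebra_Q: "algebra R Q"
proof (rule algebra_from_structure_map)
  show "cring R" by (rule R.is_cring)
  show "cring Q"
    by (rule cring_cong[OF quotient_is_cring]) (simp_all add: alg_quot_def is_cring)
  show "(\<lambda>k. cls (structure_map A k)) \<in> ring_hom R Q"
    using ring_hom_trans[OF structure_map_ring_hom[OF algebra_axioms] cls_ring_hom] by (simp add: comp_def)
  fix k C assume k: "k \<in> carrier R" and "C \<in> carrier Q"
  then obtain a where a: "a \<in> carrier A" "C = cls a" using carrier_cases by blast
  have s: "structure_map A k \<in> carrier A"
    using k structure_map_closed[OF algebra_axioms] by blast
  show "k \<odot>\<^bsub>Q\<^esub> C = cls (structure_map A k) \<otimes>\<^bsub>Q\<^esub> C"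
    using k a s by (simp add: cls_smult ring_hom_mult[OF cls_ring_hom, symmetric] algebra_structure_mult[OF algebra_axioms])
qed

lemma cls_alg_hom: "cls \<in> alg_hom R A Q"
  by (rule alg_homI[OF cls_ring_hom]) (simp add: cls_smult)

text \<open>\<open>quot_lift\<close> picks the only element of the image of a coset; there is only
  one since \<open>f\<close> vanishes on \<open>I\<close>.\<close>

lemma quot_lift_cls:
  assumes f: "f \<in> alg_hom R A C" and C: "algebra R C" and fI: "\<And>a. a \<in> I \<Longrightarrow> f a = \<zero>\<^bsub>C\<^esub>"
    and a: "a \<in> carrier A"
  shows "quot_lift f (cls a) = f a"
proof -
  interpret C: algebra R C by fact
  have "f b = f a" if b: "b \<in> cls a" for b
  proof -
    obtain i where i: "i \<in> I" "b = i \<oplus>\<^bsub>A\<^esub> a"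
      using b by (auto simp: a_r_coset_def r_coset_def)
    then show ?thesis
      using fI[OF i(1)] a_Hcarr[OF i(1)] a alg_hom_closed[OF f a] by (simp add: alg_hom_add[OF f])
  qed
  moreover have "a \<in> cls a" using a_rcos_self[OF a] .
  ultimately have "f ` cls a = {f a}" by blast
  then show ?thesis by (simp add: quot_lift_def)
qed

lemma quot_lift_alg_hom:
  assumes f: "f \<in> alg_hom R A C" and C: "algebra R C" and fI: "\<And>a. a \<in> I \<Longrightarrow> f a = \<zero>\<^bsub>C\<^esub>"
  shows "quot_lift f \<in> alg_hom R Q C"
proof -
  note l = quot_lift_cls[OF f C fI]
  note h = cls_alg_hom
  show ?thesis
  proof (intro alg_homI ring_hom_memI)
    fix x assume "x \<in> carrier Q"
    then obtain a where a: "a \<in> carrier A" "x = cls a" by (rule carrier_cases)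
    then show "quot_lift f x \<in> carrier C" by (simp add: l alg_hom_closed[OF f])
    fix k assume "k \<in> carrier R"
    then show "quot_lift f (k \<odot>\<^bsub>Q\<^esub> x) = k \<odot>\<^bsub>C\<^esub> quot_lift f x"
      using a by (simp add: l alg_hom_smult[OF f] alg_hom_smult[OF h, symmetric])
  next
    fix x y assume "x \<in> carrier Q" "y \<in> carrier Q"
    then obtain a b where a: "a \<in> carrier A" "x = cls a" and b: "b \<in> carrier A" "y = cls b"
      using carrier_cases by metis
    then show "quot_lift f (x \<otimes>\<^bsub>Q\<^esub> y) = quot_lift f x \<otimes>\<^bsub>C\<^esub> quot_lift f y"
      "quot_lift f (x \<oplus>\<^bsub>Q\<^esub> y) = quot_lift f x \<oplus>\<^bsub>C\<^esub> quot_lift f y"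
      by (simp_all add: l alg_hom_mult[OF f] alg_hom_mult[OF h, symmetric] alg_hom_add[OF f] alg_hom_add[OF h, symmetric])
  next
    show "quot_lift f \<one>\<^bsub>Q\<^esub> = \<one>\<^bsub>C\<^esub>"
      by (simp add: l alg_hom_one[OF f] alg_hom_one[OF h, symmetric])
  qed
qed

end

section \<open>Monoid algebras as algebras\<close>

context monoid_algebra
begin

lemma algebra_P: "algebra R P"
proof (rule algebra_from_structure_map[OF is_cring cring_P const_ring_hom])
  fix k p assume k: "k \<in> carrier R" and "p \<in> carrier P"
  from this(2) show "k \<odot>\<^bsub>P\<^esub> p = term_at k \<one>\<^bsub>M\<^esub> \<otimes>\<^bsub>P\<^esub> p"
  proof (induction p rule: term_induct)
    case zero
    then show ?case using k by (simp add: mult_zero) (simp add: monoid_alg_def)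
  next
    case (add p c m)
    have "k \<odot>\<^bsub>P\<^esub> (p \<oplus>\<^bsub>P\<^esub> term_at c m) = k \<odot>\<^bsub>P\<^esub> p \<oplus>\<^bsub>P\<^esub> term_at (k \<otimes> c) m"
      using add.hyps k by (auto simp: monoid_alg_def r_distr term_at_def)
    then show ?case using add k by (simp add: distrib_left term_mult)
  qed
qed

lemma structure_map_P: "k \<in> carrier R \<Longrightarrow> structure_map P k = term_at k \<one>\<^bsub>M\<^esub>"
  by (auto simp: structure_map_def monoid_alg_def term_at_def)

end

text \<open>\<^term>\<open>monoid_alg A M\<close> with its scalars restricted from \<open>A\<close> to the base ring of \<open>A\<close>.\<close>

definition alg_monoid :: "('k, 'a, 'r) module_scheme \<Rightarrow> ('n, 's) monoid_scheme \<Rightarrow> ('k, 'n \<Rightarrow> 'a) module"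
  where "alg_monoid A M =
    \<lparr>carrier = carrier (monoid_alg A M), mult = mult (monoid_alg A M), one = one (monoid_alg A M),
     zero = zero (monoid_alg A M), add = add (monoid_alg A M), smult = (\<lambda>k p m. k \<odot>\<^bsub>A\<^esub> p m)\<rparr>"

definition mconst where "mconst A M a = (\<lambda>m. if m = \<one>\<^bsub>M\<^esub> then a else \<zero>\<^bsub>A\<^esub>)"

locale algebra_monoid = algebra R A + monoid_algebra A M
  for R :: "('k, 'm) ring_scheme" and A :: "('k, 'a, 'r) module_scheme" and M :: "('n, 's) monoid_scheme"
begin

abbreviation AM where "AM \<equiv> alg_monoid A M"

lemma AM_simps:
  "carrier AM = carrier P" "mult AM = mult P" "one AM = one P" "zero AM = zero P" "add AM = add P"
  by (simp_all add: alg_monoid_def)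

lemma mconst_eq: "mconst A M a = term_at a \<one>\<^bsub>M\<^esub>"
  by (simp add: mconst_def term_at_def)

lemma monom_eq: "monom_at A m = term_at \<one>\<^bsub>A\<^esub> m"
  by (simp add: monom_at_def term_at_def)

lemma AM_ring_hom: "ring_hom C AM = ring_hom C P" "ring_hom AM C = ring_hom P C"
  by (simp_all add: ring_hom_cong[OF AM_simps(1,2,3,5)])

lemma mconst_ring_hom: "mconst A M \<in> ring_hom A AM"
  using const_ring_hom by (simp add: AM_ring_hom mconst_eq[abs_def])

lemma AM_cring: "cring AM"
  by (rule cring_cong[OF cring_P]) (simp_all add: AM_simps)

lemma AM_smult_term:
  assumes "k \<in> carrier R" "p \<in> carrier P"
  shows "k \<odot>\<^bsub>AM\<^esub> p = mconst A M (structure_map A k) \<otimes>\<^bsub>AM\<^esub> p"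
  using assms(2)
proof (induction p rule: term_induct)
  case zero
  then show ?case using assms(1)
    by (simp add: AM_simps mult_zero mconst_eq structure_map_closed[OF algebra_axioms])
      (simp add: alg_monoid_def zero_eq)
next
  case (add p c m)
  have "k \<odot>\<^bsub>AM\<^esub> (p \<oplus>\<^bsub>P\<^esub> term_at c m) = k \<odot>\<^bsub>AM\<^esub> p \<oplus>\<^bsub>P\<^esub> term_at (k \<odot>\<^bsub>A\<^esub> c) m"
    using add.hyps assms(1) by (auto simp: alg_monoid_def add_eq smult_r_distr term_at_def)
  then show ?case using add assms(1)
    by (simp add: AM_simps distrib_left term_mult mconst_eq structure_map_closed[OF algebra_axioms]
      algebra_structure_mult[OF algebra_axioms])
qed

lemma algebra_AM: "algebra R AM"
proof (rule algebra_from_structure_map[OF R.is_cring AM_cring])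
  show "(\<lambda>k. mconst A M (structure_map A k)) \<in> ring_hom R AM"
    using ring_hom_trans[OF structure_map_ring_hom[OF algebra_axioms] mconst_ring_hom] by (simp add: comp_def)
qed (simp add: AM_smult_term AM_simps)

lemma mconst_alg_hom: "mconst A M \<in> alg_hom R A AM"
proof (rule alg_homI[OF mconst_ring_hom])
  fix k a assume "k \<in> carrier R" "a \<in> carrier A"
  then show "mconst A M (k \<odot>\<^bsub>A\<^esub> a) = k \<odot>\<^bsub>AM\<^esub> mconst A M a"
    by (auto simp: mconst_def alg_monoid_def)
qed

lemma monom_closed: "m \<in> carrier M \<Longrightarrow> monom_at A m \<in> carrier AM"
  by (simp add: AM_simps monom_eq)

lemma monom_mult:
  "m \<in> carrier M \<Longrightarrow> n \<in> carrier M \<Longrightarrow> monom_at A (m \<otimes>\<^bsub>M\<^esub> n) = monom_at A m \<otimes>\<^bsub>AM\<^esub> monom_at A n"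
  by (simp add: AM_simps monom_eq term_mult)

lemma monom_one: "monom_at A \<one>\<^bsub>M\<^esub> = \<one>\<^bsub>AM\<^esub>"
  by (simp add: AM_simps monom_eq one_eq)

lemma mconst_monom:
  "a \<in> carrier A \<Longrightarrow> m \<in> carrier M \<Longrightarrow> mconst A M a \<otimes>\<^bsub>AM\<^esub> monom_at A m = term_at a m"
  by (simp add: AM_simps monom_eq mconst_eq term_mult)

end

section \<open>Polynomial algebras\<close>

definition mset_monoid :: "'x set \<Rightarrow> 'x multiset monoid"
  where "mset_monoid X = \<lparr>carrier = {m. set_mset m \<subseteq> X}, mult = (+), one = {#}\<rparr>"

lemma comm_monoid_mset: "comm_monoid (mset_monoid X)"
  by (rule comm_monoidI) (auto simp: mset_monoid_def)

lemma poly_alg_eq: "poly_alg R X = monoid_alg R (mset_monoid X)"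
  by (simp add: poly_alg_def mset_monoid_def)

lemma monoid_algebra_poly: "cring R \<Longrightarrow> monoid_algebra R (mset_monoid X)"
  by (simp add: monoid_algebra_def comm_monoid_mset)

lemma algebra_poly: "cring R \<Longrightarrow> algebra R (poly_alg R X)"
  unfolding poly_alg_eq by (rule monoid_algebra.algebra_P[OF monoid_algebra_poly])

lemma pvar_closed:
  assumes "cring R" "x \<in> X"
  shows "pvar R x \<in> carrier (poly_alg R X)"
proof -
  interpret monoid_algebra R "mset_monoid X" by (rule monoid_algebra_poly[OF assms(1)])
  have "term_at \<one>\<^bsub>R\<^esub> {#x#} \<in> carrier P"
    using assms(2) by (intro term_closed) (auto simp: mset_monoid_def)
  then show ?thesis by (simp add: poly_alg_eq pvar_def monom_at_def term_at_def)
qed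

lemma poly_induct [consumes 2, case_names const var add mult]:
  assumes R: "cring R" and "p \<in> carrier (poly_alg R X)"
    and const: "\<And>k. k \<in> carrier R \<Longrightarrow> Q (structure_map (poly_alg R X) k)"
    and var: "\<And>x. x \<in> X \<Longrightarrow> Q (pvar R x)"
    and add: "\<And>p q. p \<in> carrier (poly_alg R X) \<Longrightarrow> q \<in> carrier (poly_alg R X) \<Longrightarrow> Q p \<Longrightarrow> Q q \<Longrightarrow>
      Q (p \<oplus>\<^bsub>poly_alg R X\<^esub> q)"
    and mult: "\<And>p q. p \<in> carrier (poly_alg R X) \<Longrightarrow> q \<in> carrier (poly_alg R X) \<Longrightarrow> Q p \<Longrightarrow> Q q \<Longrightarrow>
      Q (p \<otimes>\<^bsub>poly_alg R X\<^esub> q)"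
  shows "Q p"
proof -
  interpret monoid_algebra R "mset_monoid X" by (rule monoid_algebra_poly[OF R])
  have e: "poly_alg R X = P" by (simp add: poly_alg_eq)
  have one: "\<one>\<^bsub>mset_monoid X\<^esub> = {#}" by (simp add: mset_monoid_def)
  have mon: "m \<in> carrier (mset_monoid X) \<longleftrightarrow> set_mset m \<subseteq> X" for m by (simp add: mset_monoid_def)
  have t: "Q (term_at c m)" if "c \<in> carrier R" "set_mset m \<subseteq> X" for c m
    using that(2)
  proof (induction m)
    case empty
    then show ?case using const[OF that(1)] that(1) by (simp add: e structure_map_P one)
  next
    case (add x m)
    have "pvar R x \<otimes>\<^bsub>P\<^esub> term_at c m = term_at c (add_mset x m)"
      using add.prems that(1) term_mult[of "\<one>\<^bsub>R\<^esub>" c "{#x#}" m]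
      by (simp add: pvar_def monom_at_def term_at_def mon) (simp add: mset_monoid_def)
    moreover have "Q (pvar R x \<otimes>\<^bsub>P\<^esub> term_at c m)"
      using add var[of x] mult[of "pvar R x" "term_at c m"] that(1) pvar_closed[OF R, of x X]
      by (simp add: e mon)
    ultimately show ?case by simp
  qed
  have z: "Q \<zero>\<^bsub>P\<^esub>" using t[of "\<zero>\<^bsub>R\<^esub>" "{#}"] by (simp add: term_at_def zero_eq)
  from assms(2) have "p \<in> carrier P" by (simp add: e)
  then show ?thesis
  proof (induction p rule: term_induct)
    case zero
    show ?case by (rule z)
  next
    case (add p c m)
    then show ?case using assms(5)[of p "term_at c m"] t[of c m] by (simp add: e mon)
  qed
qed

text \<open>The character of the free commutative monoid that extends \<open>v\<close>. It exhibits
  \<open>peval\<close> as an instance of \<open>meval\<close>, so that the polynomial ring inherits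
  its universal property from monoid algebras.\<close>

definition mset_eval where
  "mset_eval A v m = (\<Otimes>\<^bsub>A\<^esub>x \<in> set_mset m. v x [^]\<^bsub>A\<^esub> count m x)"

lemma mset_eval_mult:
  assumes "cring A" and v: "\<And>x. x \<in> X \<Longrightarrow> v x \<in> carrier A" and m: "set_mset m \<subseteq> X" and n: "set_mset n \<subseteq> X"
  shows "mset_eval A v (m + n) = mset_eval A v m \<otimes>\<^bsub>A\<^esub> mset_eval A v n"
proof -
  interpret cring A by fact
  let ?S = "set_mset (m + n)"
  have v': "v x \<in> carrier A" if "x \<in># m \<or> x \<in># n" for x using that v m n by auto
  \<comment> \<open>Both monomials are evaluated over a common index set; variables missing from
    \<open>k\<close> get exponent zero.\<close>
  have *: "mset_eval A v k = (\<Otimes>\<^bsub>A\<^esub>x \<in> ?S. v x [^]\<^bsub>A\<^esub> count k x)" if "k = m \<or> k = n" for k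
  proof -
    have z: "x \<notin># k \<Longrightarrow> count k x = 0" for x by (simp add: not_in_iff)
    show ?thesis unfolding mset_eval_def
      by (rule finprod_mono_neutral_cong_left) (use that v' in \<open>auto simp: z\<close>)
  qed
  have "mset_eval A v (m + n) = (\<Otimes>\<^bsub>A\<^esub>x \<in> ?S. v x [^]\<^bsub>A\<^esub> count m x \<otimes>\<^bsub>A\<^esub> v x [^]\<^bsub>A\<^esub> count n x)"
    unfolding mset_eval_def by (rule finprod_cong') (use v' in \<open>auto simp: nat_pow_mult\<close>)
  also have "\<dots> = mset_eval A v m \<otimes>\<^bsub>A\<^esub> mset_eval A v n"
    by (subst finprod_multf) (use v' in \<open>auto simp: *\<close>)
  finally show ?thesis .
qed

lemma mset_eval_closed:
  assumes "cring A" "\<And>x. x \<in> X \<Longrightarrow> v x \<in> carrier A" "set_mset m \<subseteq> X"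
  shows "mset_eval A v m \<in> carrier A"
proof -
  interpret cring A by fact
  show ?thesis unfolding mset_eval_def by (rule finprod_closed) (use assms in auto)
qed

lemma
  assumes A: "algebra R A" and v: "\<And>x. x \<in> X \<Longrightarrow> v x \<in> carrier A"
  shows peval_alg_hom: "peval R A v \<in> alg_hom R (poly_alg R X) A"
    and peval_pvar: "x \<in> X \<Longrightarrow> peval R A v (pvar R x) = v x"
proof -
  interpret A: algebra R A by fact
  have R: "cring R" by (rule A.R_cring)
  interpret monoid_algebra_eval R "mset_monoid X" A "structure_map A" "mset_eval A v"
    by (intro monoid_algebra_eval.intro monoid_algebra_poly[OF R] A.M_cring monoid_algebra_eval_axioms.intro
        structure_map_ring_hom[OF A])
      (auto simp: mset_monoid_def mset_eval_mult[OF A.M_cring v] mset_eval_closed[OF A.M_cring v],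
       simp add: mset_eval_def)
  have e: "poly_alg R X = P" by (simp add: poly_alg_eq)
  have pe: "peval R A v p = ev p" if p: "p \<in> carrier P" for p
  proof -
    have *: "set_mset m \<subseteq> X" if "p m \<noteq> \<zero>\<^bsub>R\<^esub>" for m
      using supp_subset[OF p] that by (auto simp: mset_monoid_def)
    show ?thesis
      unfolding peval_def meval_def mset_eval_def[symmetric]
      by (rule A.M.add.finprod_cong')
        (use p * in \<open>auto simp: algebra_structure_mult[OF A] mset_eval_closed[OF A.M_cring v]\<close>)
  qed
  have "ev \<in> alg_hom R P A"
  proof (rule alg_hom_from_structure_map[OF algebra_P A eval_ring_hom])
    fix k assume k: "k \<in> carrier R"
    then show "ev (structure_map P k) = structure_map A k"
      by (simp add: structure_map_P eval_term \<mu>_one structure_map_closed[OF A])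
  qed
  then show "peval R A v \<in> alg_hom R (poly_alg R X) A"
    unfolding e by (rule alg_hom_cong[OF _ algebra_P pe])
  assume x: "x \<in> X"
  have "pvar R x = term_at \<one>\<^bsub>R\<^esub> {#x#}" by (simp add: pvar_def monom_at_def term_at_def)
  then show "peval R A v (pvar R x) = v x"
    using x v[OF x] pe[of "pvar R x"] pvar_closed[OF R x]
    by (simp add: e eval_term mset_monoid_def mset_eval_def ring_hom_one[OF \<sigma>])
qed

lemma alg_hom_ring_hom_ring:
  "f \<in> alg_hom R A B \<Longrightarrow> algebra R A \<Longrightarrow> algebra R B \<Longrightarrow> ring_hom_ring A B f"
  by (rule ring_hom_ringI2) (simp_all add: algebra_ring alg_hom_ring_hom)

lemma alg_hom_kernel_ideal:
  "f \<in> alg_hom R A B \<Longrightarrow> algebra R A \<Longrightarrow> algebra R B \<Longrightarrow> ideal {a \<in> carrier A. f a = \<zero>\<^bsub>B\<^esub>} A"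
  using ring_hom_ring.kernel_is_ideal[OF alg_hom_ring_hom_ring] by (simp add: a_kernel_def')

lemma alg_hom_minus:
  assumes "f \<in> alg_hom R A B" "algebra R A" "algebra R B" "a \<in> carrier A" "b \<in> carrier A"
  shows "f (a \<ominus>\<^bsub>A\<^esub> b) = f a \<ominus>\<^bsub>B\<^esub> f b"
proof -
  interpret ring_hom_ring A B f by (rule alg_hom_ring_hom_ring[OF assms(1-3)])
  show ?thesis using assms(4,5) by (simp add: a_minus_def)
qed

lemma algebra_minus_closed:
  "algebra R A \<Longrightarrow> a \<in> carrier A \<Longrightarrow> b \<in> carrier A \<Longrightarrow> a \<ominus>\<^bsub>A\<^esub> b \<in> carrier A"
  by (rule abelian_group.minus_closed[OF ring.is_abelian_group[OF algebra_ring]])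

lemma algebra_minus_eq_zero_iff:
  assumes "algebra R A" "a \<in> carrier A" "b \<in> carrier A"
  shows "a \<ominus>\<^bsub>A\<^esub> b = \<zero>\<^bsub>A\<^esub> \<longleftrightarrow> a = b"
proof -
  interpret algebra R A by fact
  show ?thesis using assms(2,3) by (metis a_minus_def M.add.inv_closed M.minus_equality M.r_neg)
qed

section \<open>Universal algebras\<close>

text \<open>The conditions defining our universal algebras are all equational, hence reflected by jointly
  injective families of homomorphisms. Here the family is \<open>\<phi> j : T \<longrightarrow> A j\<close>, mapping \<open>t\<close> to \<open>s j\<close>.\<close>

definition jointly_embeds where
  "jointly_embeds R X T t J A \<phi> s \<longleftrightarrow> algebra R T \<and> (\<forall>x \<in> X. t x \<in> carrier T) \<and>
    (\<forall>j \<in> J. algebra R (A j) \<and> \<phi> j \<in> alg_hom R T (A j) \<and> (\<forall>x \<in> X. \<phi> j (t x) = s j x)) \<and>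
    (\<forall>a \<in> carrier T. \<forall>b \<in> carrier T. (\<forall>j \<in> J. \<phi> j a = \<phi> j b) \<longrightarrow> a = b)"

text \<open>The families are indexed by ideals of the polynomial ring because
  \<open>gen_cond\<close> applies this to all quotients satisfying \<open>C\<close>. Target algebras
  of other types are not covered; for them reflection is a hypothesis of
  \<open>lift_alg_hom\<close>.\<close>

definition univ_reflects ::
  "('k, 'm) ring_scheme \<Rightarrow> 'x set \<Rightarrow> (('k, ('k, 'x) univ) module \<Rightarrow> ('x \<Rightarrow> ('k, 'x) univ) \<Rightarrow> bool) \<Rightarrow> bool"
  where "univ_reflects R X C \<longleftrightarrow>
    (\<forall>T t (J :: ('x multiset \<Rightarrow> 'k) set set) (A :: _ \<Rightarrow> ('k, ('k, 'x) univ) module) \<phi> s.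
      jointly_embeds R X T t J A \<phi> s \<and> (\<forall>j \<in> J. C (A j) (s j)) \<longrightarrow> C T t)"

lemma jointly_embedsD:
  assumes "jointly_embeds R X T t J A \<phi> s"
  shows "algebra R T" "x \<in> X \<Longrightarrow> t x \<in> carrier T" "j \<in> J \<Longrightarrow> algebra R (A j)"
    "j \<in> J \<Longrightarrow> \<phi> j \<in> alg_hom R T (A j)" "j \<in> J \<Longrightarrow> x \<in> X \<Longrightarrow> \<phi> j (t x) = s j x"
  using assms by (auto simp: jointly_embeds_def)

lemma jointly_embeds_eqI:
  assumes "jointly_embeds R X T t J A \<phi> s" "a \<in> carrier T" "b \<in> carrier T" "\<And>j. j \<in> J \<Longrightarrow> \<phi> j a = \<phi> j b"
  shows "a = b"
  using assms by (auto simp: jointly_embeds_def)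

text \<open>The axioms of an algebra homomorphism are equations between elements of
  \<open>T\<close>, hence can be tested under all \<open>\<phi> j\<close>. The function
  \<open>e\<close> gives the variable attached to an element of \<open>B\<close>, for instance
  \<open>Inl\<close>, \<open>Inr\<close> or \<open>Pair \<gamma>\<close>.\<close>

lemma alg_hom_reflect:
  assumes je: "jointly_embeds R X T t J A \<phi> s" and B: "algebra R B" and e: "\<And>b. b \<in> carrier B \<Longrightarrow> e b \<in> X"
    and s: "\<And>j. j \<in> J \<Longrightarrow> (\<lambda>b. s j (e b)) \<in> alg_hom R B (A j)"
  shows "(\<lambda>b. t (e b)) \<in> alg_hom R B T"
proof -
  interpret B: algebra R B by fact
  interpret T: algebra R T by (rule jointly_embedsD[OF je])
  note eqI = jointly_embeds_eqI[OF je]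
  note D = jointly_embedsD[OF je]
  have c: "t (e b) \<in> carrier T" if "b \<in> carrier B" for b using that e D(2) by blast
  have v: "\<phi> j (t (e b)) = s j (e b)" if "j \<in> J" "b \<in> carrier B" for j b using that e D(5) by blast
  show ?thesis
  proof (intro alg_homI ring_hom_memI)
    fix a b assume a: "a \<in> carrier B" and b: "b \<in> carrier B"
    show "t (e (a \<otimes>\<^bsub>B\<^esub> b)) = t (e a) \<otimes>\<^bsub>T\<^esub> t (e b)"
      by (rule eqI) (use a b c D(4) in \<open>auto simp: v alg_hom_mult[OF s] alg_hom_mult[OF D(4)]\<close>)
    show "t (e (a \<oplus>\<^bsub>B\<^esub> b)) = t (e a) \<oplus>\<^bsub>T\<^esub> t (e b)"
      by (rule eqI) (use a b c D(4) in \<open>auto simp: v alg_hom_add[OF s] alg_hom_add[OF D(4)]\<close>)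
  next
    fix k a assume k: "k \<in> carrier R" and a: "a \<in> carrier B"
    show "t (e (k \<odot>\<^bsub>B\<^esub> a)) = k \<odot>\<^bsub>T\<^esub> t (e a)"
      by (rule eqI) (use a k c D(4) in \<open>auto simp: v alg_hom_smult[OF s] alg_hom_smult[OF D(4)]\<close>)
  next
    show "t (e \<one>\<^bsub>B\<^esub>) = \<one>\<^bsub>T\<^esub>"
      by (rule eqI) (use c D(4) in \<open>auto simp: v alg_hom_one[OF s] alg_hom_one[OF D(4)]\<close>)
  qed (simp add: c)
qed

lemma algebra_quotient_poly:
  "cring R \<Longrightarrow> ideal I (poly_alg R X) \<Longrightarrow> algebra_quotient R (poly_alg R X) I"
  by (simp add: algebra_quotient_def algebra_poly)

text \<open>The point is that the intersection is not empty. The unit ideal takes part in it: its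
  quotient is the zero ring, for which even the empty family of homomorphisms is jointly
  injective.\<close>

lemma univ_ideal_ideal:
  assumes R: "cring R" and C: "univ_reflects R X C"
  shows "ideal (univ_ideal R X C) (poly_alg R X)"
proof -
  let ?P = "poly_alg R X"
  interpret P: algebra R ?P by (rule algebra_poly[OF R])
  have i: "ideal (carrier ?P) ?P" by (rule P.oneideal)
  interpret Q: algebra_quotient R ?P "carrier ?P" by (rule algebra_quotient_poly[OF R i])
  have "jointly_embeds R X Q.Q (\<lambda>x. Q.cls (pvar R x)) {} (\<lambda>_. Q.Q) (\<lambda>_ a. a) (\<lambda>_ _. {})"
  proof -
    have "a = b" if ab: "a \<in> carrier Q.Q" "b \<in> carrier Q.Q" for a b
    proof -
      obtain p q where pq: "p \<in> carrier ?P" "a = Q.cls p" "q \<in> carrier ?P" "b = Q.cls q"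
        using Q.carrier_cases ab by metis
      then show ?thesis using Q.cls_eq_iff[of p q] P.M.minus_closed[of p q] by simp
    qed
    then show ?thesis
      unfolding jointly_embeds_def using Q.algebra_Q Q.cls_closed pvar_closed[OF R, of _ X] by auto
  qed
  with C have "C Q.Q (\<lambda>x. Q.cls (pvar R x))"
    unfolding univ_reflects_def by blast
  with i show ?thesis unfolding univ_ideal_def
    by (intro P.i_Intersect) auto
qed

locale univ_algebra =
  fixes R :: "('k, 'm) ring_scheme" and X :: "'x set" and C
  assumes R: "cring R" and refl: "univ_reflects R X C"
begin

abbreviation "P \<equiv> poly_alg R X"
abbreviation "U \<equiv> univ_alg R X C"
abbreviation "gen \<equiv> univ_gen R X C"

sublocale Q: algebra_quotient R P "univ_ideal R X C"
  by (rule algebra_quotient_poly[OF R univ_ideal_ideal[OF R refl]])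

lemma univ_eq: "U = Q.Q"
  by (simp add: univ_alg_def)

lemma algebra_univ: "algebra R U"
  unfolding univ_eq by (rule Q.algebra_Q)

lemma gen_closed: "x \<in> X \<Longrightarrow> gen x \<in> carrier U"
  unfolding univ_eq univ_gen_def by (rule Q.cls_closed[OF pvar_closed[OF R]])

text \<open>\<open>U\<close> embeds into the product of all quotients that satisfy \<open>C\<close>,
  since its ideal is the intersection of theirs.\<close>

lemma gen_cond: "C U gen"
proof -
  let ?J = "{I. ideal I P \<and> C (alg_quot P I) (\<lambda>x. I +>\<^bsub>P\<^esub> pvar R x)}"
  let ?f = "\<lambda>I. quot_lift (\<lambda>p. I +>\<^bsub>P\<^esub> p)"
  have h: "algebra R (alg_quot P I)" "?f I \<in> alg_hom R U (alg_quot P I)"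
      "p \<in> carrier P \<Longrightarrow> ?f I (Q.cls p) = I +>\<^bsub>P\<^esub> p" if I: "I \<in> ?J" for I p
  proof -
    interpret I: algebra_quotient R P I using I by (auto intro: algebra_quotient_poly[OF R])
    have 0: "I +>\<^bsub>P\<^esub> p = \<zero>\<^bsub>I.Q\<^esub>" if p: "p \<in> univ_ideal R X C" for p
    proof -
      have pI: "p \<in> I" using p I by (auto simp: univ_ideal_def)
      then have "I.cls p = I.cls \<zero>\<^bsub>P\<^esub>"
        using I.cls_eq_iff[of p "\<zero>\<^bsub>P\<^esub>"] I.a_Hcarr[OF pI] by (simp add: a_minus_def)
      then show ?thesis using alg_hom_zero[OF I.cls_alg_hom Q.algebra_axioms I.algebra_Q] by simp
    qed
    show "algebra R (alg_quot P I)" by (rule I.algebra_Q)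
    show "?f I \<in> alg_hom R U (alg_quot P I)"
      unfolding univ_eq by (rule Q.quot_lift_alg_hom[OF I.cls_alg_hom I.algebra_Q 0])
    show "p \<in> carrier P \<Longrightarrow> ?f I (Q.cls p) = I +>\<^bsub>P\<^esub> p"
      by (rule Q.quot_lift_cls[OF I.cls_alg_hom I.algebra_Q 0])
  qed
  have eq: "a = b" if a: "a \<in> carrier U" and b: "b \<in> carrier U" and ab: "\<forall>I \<in> ?J. ?f I a = ?f I b" for a b
  proof -
    obtain p q where p: "p \<in> carrier P" "a = Q.cls p" and q: "q \<in> carrier P" "b = Q.cls q"
      using Q.carrier_cases a b unfolding univ_eq by metis
    have "p \<ominus>\<^bsub>P\<^esub> q \<in> I" if I: "I \<in> ?J" for I
    proof -
      interpret I: algebra_quotient R P I using I by (auto intro: algebra_quotient_poly[OF R])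
      have "I.cls p = I.cls q" using ab[rule_format, OF I] p q by (simp add: h(3)[OF I])
      then show ?thesis using I.cls_eq_iff[OF p(1) q(1)] by simp
    qed
    then have "p \<ominus>\<^bsub>P\<^esub> q \<in> univ_ideal R X C" by (simp add: univ_ideal_def)
    then show ?thesis using p q Q.cls_eq_iff by simp
  qed
  have "jointly_embeds R X U gen ?J (alg_quot P) ?f (\<lambda>I x. I +>\<^bsub>P\<^esub> pvar R x)"
    unfolding jointly_embeds_def
  proof (intro conjI ballI impI)
    fix I x assume I: "I \<in> ?J" and x: "x \<in> X"
    show "?f I (gen x) = I +>\<^bsub>P\<^esub> pvar R x"
      unfolding univ_gen_def by (rule h(3)[OF I pvar_closed[OF R x]])
  qed (use algebra_univ gen_closed h eq in blast)+
  moreover have "\<forall>I \<in> ?J. C (alg_quot P I) (\<lambda>x. I +>\<^bsub>P\<^esub> pvar R x)" by blast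
  ultimately show ?thesis using refl unfolding univ_reflects_def by blast
qed

lemma gen_induct [consumes 1, case_names const gen add mult]:
  assumes u: "u \<in> carrier U"
    and const: "\<And>k. k \<in> carrier R \<Longrightarrow> S (structure_map U k)"
    and gen: "\<And>x. x \<in> X \<Longrightarrow> S (gen x)"
    and add: "\<And>a b. a \<in> carrier U \<Longrightarrow> b \<in> carrier U \<Longrightarrow> S a \<Longrightarrow> S b \<Longrightarrow> S (a \<oplus>\<^bsub>U\<^esub> b)"
    and mult: "\<And>a b. a \<in> carrier U \<Longrightarrow> b \<in> carrier U \<Longrightarrow> S a \<Longrightarrow> S b \<Longrightarrow> S (a \<otimes>\<^bsub>U\<^esub> b)"
  shows "S u"
proof -
  have h: "Q.cls \<in> alg_hom R P U" unfolding univ_eq by (rule Q.cls_alg_hom)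
  have "S (Q.cls p)" if "p \<in> carrier P" for p
    using R that
  proof (induction p rule: poly_induct)
    case (const k)
    then show ?case using assms(2) alg_hom_structure_map[OF h Q.algebra_axioms] by simp
  next
    case (var x)
    then show ?case using gen by (simp add: univ_gen_def)
  next
    case (add p q)
    then show ?case using assms(4) by (simp add: alg_hom_add[OF h] alg_hom_closed[OF h])
  next
    case (mult p q)
    then show ?case using assms(5) by (simp add: alg_hom_mult[OF h] alg_hom_closed[OF h])
  qed
  with u show ?thesis unfolding univ_eq using Q.carrier_cases by metis
qed

lemma hom_eqI:
  assumes f: "f \<in> alg_hom R U A" and g: "g \<in> alg_hom R U A"
    and eq: "\<And>x. x \<in> X \<Longrightarrow> f (gen x) = g (gen x)" and u: "u \<in> carrier U"
  shows "f u = g u"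
  using u
proof (induction u rule: gen_induct)
  case (const k)
  then show ?case
    using alg_hom_structure_map[OF f algebra_univ] alg_hom_structure_map[OF g algebra_univ] by simp
qed (simp_all add: eq alg_hom_add[OF f] alg_hom_add[OF g] alg_hom_mult[OF f] alg_hom_mult[OF g])

text \<open>\<open>C\<close> is tied to one type of algebras and cannot be asserted of
  \<open>A\<close> itself. Hypothesis \<open>K\<close> says instead that \<open>C\<close> is
  reflected along an embedding into \<open>A\<close>. It is applied to the polynomial ring modulo
  the kernel of \<open>peval\<close>, which embeds into \<open>A\<close>; hence
  \<open>univ_ideal\<close> is contained in that kernel.\<close>

lemma
  assumes A: "algebra R A" and v: "\<And>x. x \<in> X \<Longrightarrow> v x \<in> carrier A"
    and K: "\<And>T t. jointly_embeds R X T t {()} (\<lambda>_. A) \<phi> (\<lambda>_. v) \<Longrightarrow> C T t"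
    and \<phi>: "\<phi> = (\<lambda>_. quot_lift (peval R A v))"
  shows lift_alg_hom: "univ_lift R A v \<in> alg_hom R U A"
    and lift_gen: "x \<in> X \<Longrightarrow> univ_lift R A v (gen x) = v x"
proof -
  let ?f = "peval R A v" 
  define K where "K = {p \<in> carrier P. ?f p = \<zero>\<^bsub>A\<^esub>}"
  have f0: "p \<in> K \<Longrightarrow> ?f p = \<zero>\<^bsub>A\<^esub>" for p by (auto simp: K_def)
  have f: "?f \<in> alg_hom R P A" by (rule peval_alg_hom[OF A v])
  have "ideal K P" unfolding K_def by (rule alg_hom_kernel_ideal[OF f algebra_poly[OF R] A])
  then interpret K: algebra_quotient R P K by (rule algebra_quotient_poly[OF R])
  have "jointly_embeds R X K.Q (\<lambda>x. K.cls (pvar R x)) {()} (\<lambda>_. A) \<phi> (\<lambda>_. v)"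
    unfolding jointly_embeds_def
  proof (intro conjI ballI impI)
    fix x assume x: "x \<in> X"
    show "\<phi> j (K.cls (pvar R x)) = v x" for j
      using K.quot_lift_cls[OF f A f0 pvar_closed[OF R x]] peval_pvar[OF A v x] by (simp add: \<phi>)
    show "K.cls (pvar R x) \<in> carrier K.Q"
      by (rule K.cls_closed[OF pvar_closed[OF R x]])
  next
    fix a b assume a: "a \<in> carrier K.Q" and b: "b \<in> carrier K.Q" and ab: "\<forall>j \<in> {()}. \<phi> j a = \<phi> j b"
    obtain p q where p: "p \<in> carrier P" "a = K.cls p" and q: "q \<in> carrier P" "b = K.cls q"
      using K.carrier_cases a b by metis
    have "?f p = ?f q" using ab p q by (simp add: \<phi> K.quot_lift_cls[OF f A f0])
    then have "?f (p \<ominus>\<^bsub>P\<^esub> q) = \<zero>\<^bsub>A\<^esub>"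
      using algebra_minus_eq_zero_iff[OF A alg_hom_closed[OF f p(1)] alg_hom_closed[OF f q(1)]]
        alg_hom_minus[OF f algebra_poly[OF R] A p(1) q(1)] by metis
    then have "p \<ominus>\<^bsub>P\<^esub> q \<in> K"
      unfolding K_def using algebra_minus_closed[OF algebra_poly[OF R] p(1) q(1)] by blast
    then show "a = b" using p(2) q(2) K.cls_eq_iff[OF p(1) q(1)] by blast
  qed (use A K.algebra_Q K.quot_lift_alg_hom[OF f A f0] in \<open>auto simp: \<phi>\<close>)
  then have "C K.Q (\<lambda>x. K.cls (pvar R x))" by (rule assms(3))
  then have sub: "univ_ideal R X C \<subseteq> K"
    unfolding univ_ideal_def using K.ideal_axioms by blast
  then have f1: "p \<in> univ_ideal R X C \<Longrightarrow> ?f p = \<zero>\<^bsub>A\<^esub>" for p using f0 by blast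
  show "univ_lift R A v \<in> alg_hom R U A"
    unfolding univ_lift_def univ_eq by (rule Q.quot_lift_alg_hom[OF f A f1])
  show "univ_lift R A v (gen x) = v x" if x: "x \<in> X"
    unfolding univ_lift_def univ_gen_def
    using Q.quot_lift_cls[OF f A f1 pvar_closed[OF R x]] peval_pvar[OF A v x] by simp
qed

end

section \<open>Tensor products\<close>

locale tensor_product =
  fixes R :: "('k, 'm) ring_scheme" and A :: "('k, 'a, 'r) module_scheme" and B :: "('k, 'b, 's) module_scheme"
  assumes A: "algebra R A" and B: "algebra R B"
begin

abbreviation "T \<equiv> tensor R A B"
abbreviation "inl \<equiv> tensor_inl R A B"
abbreviation "inr \<equiv> tensor_inr R A B"

text \<open>The condition on the targets is spelled out because \<open>tensor_cond\<close> is typed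
  for plain module records, while products of points are also taken with values in Hopf
  algebras.\<close>

lemma reflect:
  assumes je: "jointly_embeds R (carrier A <+> carrier B) T' t J C \<phi> s"
    and "\<And>j. j \<in> J \<Longrightarrow> (\<lambda>a. s j (Inl a)) \<in> alg_hom R A (C j)"
    and "\<And>j. j \<in> J \<Longrightarrow> (\<lambda>b. s j (Inr b)) \<in> alg_hom R B (C j)"
  shows "tensor_cond R A B T' t"
  using assms unfolding tensor_cond_def
  by (intro conjI alg_hom_reflect[OF je A, of Inl] alg_hom_reflect[OF je B, of Inr]) auto

sublocale univ: univ_algebra R "carrier A <+> carrier B" "tensor_cond R A B"
proof (rule univ_algebra.intro)
  show "cring R" by (rule algebra_base[OF A])
  show "univ_reflects R (carrier A <+> carrier B) (tensor_cond R A B)"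
    unfolding univ_reflects_def tensor_cond_def[of _ _ _ "_ _"] using reflect by blast
qed

lemma algebra_T: "algebra R T"
  unfolding tensor_def by (rule univ.algebra_univ)

lemma inl_hom: "inl \<in> alg_hom R A T" and inr_hom: "inr \<in> alg_hom R B T"
  using univ.gen_cond by (simp_all add: tensor_cond_def tensor_inl_def[abs_def] tensor_inr_def[abs_def] tensor_def)

lemma
  assumes C: "algebra R C" and x: "x \<in> alg_hom R A C" and y: "y \<in> alg_hom R B C"
  shows lift_hom: "tensor_lift R C x y \<in> alg_hom R T C"
    and lift_inl: "a \<in> carrier A \<Longrightarrow> tensor_lift R C x y (inl a) = x a"
    and lift_inr: "b \<in> carrier B \<Longrightarrow> tensor_lift R C x y (inr b) = y b"
proof -
  have v: "case_sum x y z \<in> carrier C" if "z \<in> carrier A <+> carrier B" for z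
    using that x y by (auto simp: alg_hom_closed)
  have tc: "(\<lambda>a. case_sum x y (Inl a)) \<in> alg_hom R A C" "(\<lambda>b. case_sum x y (Inr b)) \<in> alg_hom R B C"
    using x y by simp_all
  note l = univ.lift_alg_hom[OF C v reflect[OF _ tc] refl] univ.lift_gen[OF C v reflect[OF _ tc] refl]
  show "tensor_lift R C x y \<in> alg_hom R T C"
    unfolding tensor_lift_def tensor_def using l(1) .
  show "a \<in> carrier A \<Longrightarrow> tensor_lift R C x y (inl a) = x a"
    unfolding tensor_lift_def tensor_inl_def by (subst l(2)) auto
  show "b \<in> carrier B \<Longrightarrow> tensor_lift R C x y (inr b) = y b"
    unfolding tensor_lift_def tensor_inr_def by (subst l(2)) auto
qed

lemma hom_eqI:
  assumes f: "f \<in> alg_hom R T C" and g: "g \<in> alg_hom R T C"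
    and "\<And>a. a \<in> carrier A \<Longrightarrow> f (inl a) = g (inl a)"
    and "\<And>b. b \<in> carrier B \<Longrightarrow> f (inr b) = g (inr b)" and u: "u \<in> carrier T"
  shows "f u = g u"
  by (rule univ.hom_eqI[OF f[unfolded tensor_def] g[unfolded tensor_def] _ u[unfolded tensor_def]])
    (use assms in \<open>auto simp: tensor_inl_def tensor_inr_def\<close>)

lemma lift_natural:
  assumes C: "algebra R C" and x: "x \<in> alg_hom R A C" and y: "y \<in> alg_hom R B C"
    and E: "algebra R E" and g: "g \<in> alg_hom R C E" and u: "u \<in> carrier T"
    and x': "\<And>a. a \<in> carrier A \<Longrightarrow> x' a = g (x a)" and y': "\<And>b. b \<in> carrier B \<Longrightarrow> y' b = g (y b)"
  shows "g (tensor_lift R C x y u) = tensor_lift R E x' y' u"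
proof -
  have X: "x' \<in> alg_hom R A E" by (rule alg_hom_cong[OF alg_hom_compose[OF x g] A x'])
  have Y: "y' \<in> alg_hom R B E" by (rule alg_hom_cong[OF alg_hom_compose[OF y g] B y'])
  show ?thesis
    by (rule hom_eqI[OF alg_hom_compose[OF lift_hom[OF C x y] g] lift_hom[OF E X Y]])
      (simp_all add: u lift_inl[OF C x y] lift_inr[OF C x y] lift_inl[OF E X Y] lift_inr[OF E X Y] x' y')
qed

end

section \<open>Points of group schemes\<close>

locale group_scheme =
  fixes R :: "('k, 'm) ring_scheme" and G :: "('k, 'h, 's) hopf_scheme"
  assumes ags: "affine_group_scheme R G"
begin

lemma algebra_G: "algebra R G" and comult_hom: "comult G \<in> alg_hom R G (tensor R G G)"
  and counit_hom: "counit G \<in> alg_hom R G (base_alg R)" and antipode_hom: "antipode G \<in> alg_hom R G G"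
  using ags unfolding affine_group_scheme_def by blast+

lemma cring_R: "cring R"
  by (rule algebra_base[OF algebra_G])

sublocale GG: tensor_product R G G
  by (rule tensor_product.intro[OF algebra_G algebra_G])

abbreviation "pts A \<equiv> pt_group R G A"

lemma pts_carrier: "x \<in> carrier (pts A) \<longleftrightarrow> x \<in> alg_hom R G A \<and> x \<in> extensional (carrier G)"
  by (simp add: pt_group_def)

lemma pts_mult: "x \<otimes>\<^bsub>pts A\<^esub> y = pt_mult R G A x y" and pts_one: "\<one>\<^bsub>pts A\<^esub> = pt_one G A"
  by (simp_all add: pt_group_def)

lemma restrict_pts: "x \<in> alg_hom R G A \<Longrightarrow> (\<lambda>h \<in> carrier G. x h) \<in> carrier (pts A)"
  unfolding pts_carrier by (auto intro: alg_hom_cong[OF _ algebra_G])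

lemma pts_hom: "x \<in> carrier (pts A) \<Longrightarrow> x \<in> alg_hom R G A"
  by (simp add: pts_carrier)

lemma pts_eqI:
  assumes "x \<in> carrier (pts A)" "y \<in> carrier (pts A)" "\<And>h. h \<in> carrier G \<Longrightarrow> x h = y h"
  shows "x = y"
  using assms by (auto simp: pts_carrier intro: extensionalityI)

lemma pt_mult_closed:
  assumes A: "algebra R A" and x: "x \<in> alg_hom R G A" and y: "y \<in> alg_hom R G A"
  shows "pt_mult R G A x y \<in> carrier (pts A)"
  unfolding pt_mult_def
  by (rule restrict_pts) (rule alg_hom_compose[OF comult_hom GG.lift_hom[OF A x y]])

text \<open>Functoriality of the product of \<open>G(A)\<close> in \<open>A\<close>. The primed
  points are constrained on \<open>carrier G\<close> only, so that restricted and unrestricted forms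
  of a point can both be inserted.\<close>

lemma pt_mult_natural:
  assumes A: "algebra R A" and x: "x \<in> alg_hom R G A" and y: "y \<in> alg_hom R G A"
    and C: "algebra R C" and g: "g \<in> alg_hom R A C" and h: "h \<in> carrier G"
    and x': "\<And>h. h \<in> carrier G \<Longrightarrow> x' h = g (x h)" and y': "\<And>h. h \<in> carrier G \<Longrightarrow> y' h = g (y h)"
  shows "g (pt_mult R G A x y h) = pt_mult R G C x' y' h"
  unfolding pt_mult_def using h GG.lift_natural[OF A x y C g alg_hom_closed[OF comult_hom h] x' y'] by simp

lemma pt_mult_cong:
  assumes A: "algebra R A" and x: "x \<in> alg_hom R G A" and y: "y \<in> alg_hom R G A"
    and x': "\<And>h. h \<in> carrier G \<Longrightarrow> x' h = x h" and y': "\<And>h. h \<in> carrier G \<Longrightarrow> y' h = y h"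
  shows "pt_mult R G A x' y' = pt_mult R G A x y"
proof
  fix h show "pt_mult R G A x' y' h = pt_mult R G A x y h"
    using pt_mult_natural[OF A x y A alg_hom_id, of h x' y'] x' y' by (cases "h \<in> carrier G") (auto simp: pt_mult_def)
qed

lemma compose_pt_mult:
  assumes A: "algebra R A" and x: "x \<in> alg_hom R G A" and y: "y \<in> alg_hom R G A"
    and C: "algebra R C" and g: "g \<in> alg_hom R A C"
    and x': "\<And>h. h \<in> carrier G \<Longrightarrow> x' h = g (x h)" and y': "\<And>h. h \<in> carrier G \<Longrightarrow> y' h = g (y h)"
  shows "compose (carrier G) g (pt_mult R G A x y) = pt_mult R G C x' y'"
proof
  fix h show "compose (carrier G) g (pt_mult R G A x y) h = pt_mult R G C x' y' h"
    using pt_mult_natural[OF A x y C g _ x' y'] by (cases "h \<in> carrier G") (auto simp: compose_def pt_mult_def)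
qed

lemma pts_compose_closed:
  "x \<in> alg_hom R G A \<Longrightarrow> g \<in> alg_hom R A C \<Longrightarrow> compose (carrier G) g x \<in> carrier (pts C)"
  unfolding compose_def by (rule restrict_pts) (rule alg_hom_compose)

lemma pt_one_closed: assumes A: "algebra R A" shows "pt_one G A \<in> carrier (pts A)"
proof -
  interpret A: algebra R A by fact
  have c: "counit G h \<in> carrier R" if "h \<in> carrier G" for h
    using alg_hom_closed[OF counit_hom that] by (simp add: base_alg_def)
  have "(\<lambda>h. structure_map A (counit G h)) \<in> alg_hom R G A"
  proof (rule alg_hom_from_structure_map[OF algebra_G A])
    have "counit G \<in> ring_hom G R"
      using alg_hom_ring_hom[OF counit_hom] by (simp add: ring_hom_def base_alg_def)
    from ring_hom_trans[OF this structure_map_ring_hom[OF A]]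
    show "(\<lambda>h. structure_map A (counit G h)) \<in> ring_hom G A" by (simp add: comp_def)
  next
    fix k assume k: "k \<in> carrier R"
    have "counit G (structure_map G k) = structure_map (base_alg R) k"
      by (rule alg_hom_structure_map[OF counit_hom algebra_G k])
    also have "\<dots> = k" using k by (simp add: structure_map_def base_alg_def)
    finally show "structure_map A (counit G (structure_map G k)) = structure_map A k" by simp
  qed
  from restrict_pts[OF this] show ?thesis by (simp add: pt_one_def structure_map_def)
qed

lemma pt_inv_closed: "x \<in> alg_hom R G A \<Longrightarrow> pt_inv G x \<in> carrier (pts A)"
  unfolding pt_inv_def by (rule restrict_pts) (rule alg_hom_compose[OF antipode_hom])

text \<open>A Yoneda argument: the Hopf axiom is the case of the three universal points with values
  in \<open>(H \<otimes> H) \<otimes> H\<close>, and the homomorphism \<open>?f\<close> specialises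
  them to \<open>x\<close>, \<open>y\<close>, \<open>z\<close>.\<close>

lemma pt_mult_assoc:
  assumes A: "algebra R A" and x: "x \<in> alg_hom R G A" and y: "y \<in> alg_hom R G A" and z: "z \<in> alg_hom R G A"
  shows "pt_mult R G A (pt_mult R G A x y) z = pt_mult R G A x (pt_mult R G A y z)"
proof -
  interpret T: tensor_product R GG.T G
    by (rule tensor_product.intro[OF GG.algebra_T algebra_G])
  let ?T = "tensor R (tensor R G G) G"
  let ?x = "\<lambda>h. T.inl (GG.inl h)" and ?y = "\<lambda>h. T.inl (GG.inr h)" and ?z = "\<lambda>h. T.inr h"
  have hx: "?x \<in> alg_hom R G ?T" and hy: "?y \<in> alg_hom R G ?T" and hz: "?z \<in> alg_hom R G ?T"
    using T.inl_hom T.inr_hom GG.inl_hom GG.inr_hom by (auto intro: alg_hom_compose)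
  have ax: "pt_mult R G ?T (pt_mult R G ?T ?x ?y) ?z = pt_mult R G ?T ?x (pt_mult R G ?T ?y ?z)"
    using ags unfolding affine_group_scheme_def Let_def by blast
  let ?l = "tensor_lift R A x y"
  let ?f = "tensor_lift R A ?l z"
  have l: "?l \<in> alg_hom R GG.T A" by (rule GG.lift_hom[OF A x y])
  have f: "?f \<in> alg_hom R ?T A" by (rule T.lift_hom[OF A l z])
  have fx: "x h = ?f (?x h)" and fy: "y h = ?f (?y h)" and fz: "z h = ?f (?z h)" if "h \<in> carrier G" for h
    using that by (simp_all add: T.lift_inl[OF A l z] T.lift_inr[OF A l z] GG.lift_inl[OF A x y]
        GG.lift_inr[OF A x y] alg_hom_closed[OF GG.inl_hom] alg_hom_closed[OF GG.inr_hom])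
  note m = compose_pt_mult[OF T.algebra_T _ _ A f]
  have xy: "pt_mult R G ?T ?x ?y \<in> alg_hom R G ?T" and yz: "pt_mult R G ?T ?y ?z \<in> alg_hom R G ?T"
    using pt_mult_closed[OF T.algebra_T hx hy] pt_mult_closed[OF T.algebra_T hy hz] by (simp_all add: pts_carrier)
  have "pt_mult R G A x y h = ?f (pt_mult R G ?T ?x ?y h)" if "h \<in> carrier G" for h
    using pt_mult_natural[OF T.algebra_T hx hy A f that fx fy] by simp
  then have "compose (carrier G) ?f (pt_mult R G ?T (pt_mult R G ?T ?x ?y) ?z) = pt_mult R G A (pt_mult R G A x y) z"
    using fz by (intro m xy hz)
  moreover have "pt_mult R G A y z h = ?f (pt_mult R G ?T ?y ?z h)" if "h \<in> carrier G" for h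
    using pt_mult_natural[OF T.algebra_T hy hz A f that fy fz] by simp
  then have "compose (carrier G) ?f (pt_mult R G ?T ?x (pt_mult R G ?T ?y ?z)) = pt_mult R G A x (pt_mult R G A y z)"
    using fx by (intro m yz hx)
  ultimately show ?thesis using ax by simp
qed

text \<open>Any point \<open>x\<close> is the image of the universal point \<open>?i\<close> of
  \<open>G(O(G))\<close> under the homomorphism \<open>x\<close> itself, so the axioms for
  \<open>?i\<close> are pushed forward along \<open>x\<close>.\<close>

lemma
  assumes A: "algebra R A" and x: "x \<in> carrier (pts A)"
  shows pt_mult_one: "pt_mult R G A (pt_one G A) x = x"
    and pt_mult_inv: "pt_mult R G A (pt_inv G x) x = pt_one G A"
proof -
  let ?i = "\<lambda>h \<in> carrier G. h"
  have xh: "x \<in> alg_hom R G A" and xe: "x \<in> extensional (carrier G)" using x by (simp_all add: pts_carrier)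
  have ax: "pt_mult R G G (pt_one G G) ?i = ?i" "pt_mult R G G (pt_inv G ?i) ?i = pt_one G G"
    using ags unfolding affine_group_scheme_def Let_def by blast+
  have i: "?i \<in> alg_hom R G G" using restrict_pts[OF alg_hom_id] by (simp add: pts_carrier)
  have e: "pt_one G G \<in> alg_hom R G G" using pt_one_closed[OF algebra_G] by (simp add: pts_carrier)
  have j: "pt_inv G ?i \<in> alg_hom R G G" using pt_inv_closed[OF i] by (simp add: pts_carrier)
  have xe': "x (pt_one G G h) = pt_one G A h" if "h \<in> carrier G" for h
  proof -
    have "counit G h \<in> carrier R"
      using alg_hom_closed[OF counit_hom that] by (simp add: base_alg_def)
    moreover have "\<one>\<^bsub>G\<^esub> \<in> carrier G"
      using algebra_G by (simp add: algebra_ring ring.ring_simprules(6))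
    ultimately show ?thesis using that
      by (simp add: pt_one_def alg_hom_smult[OF xh] alg_hom_one[OF xh])
  qed
  have "compose (carrier G) x (pt_mult R G G (pt_one G G) ?i) = pt_mult R G A (pt_one G A) x"
    by (rule compose_pt_mult[OF algebra_G e i A xh]) (simp_all add: xe')
  moreover have "compose (carrier G) x ?i = x"
    using xe by (auto simp: compose_def extensional_def)
  ultimately show "pt_mult R G A (pt_one G A) x = x" by (simp add: ax)
  have "compose (carrier G) x (pt_mult R G G (pt_inv G ?i) ?i) = pt_mult R G A (pt_inv G x) x"
    by (rule compose_pt_mult[OF algebra_G j i A xh]) (simp_all add: pt_inv_def alg_hom_closed[OF antipode_hom])
  moreover have "compose (carrier G) x (pt_one G G) = pt_one G A"
    using xe' by (auto simp: compose_def pt_one_def)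
  ultimately show "pt_mult R G A (pt_inv G x) x = pt_one G A" by (simp add: ax)
qed

lemma pts_group: assumes A: "algebra R A" shows "group (pts A)"
proof (rule groupI)
  fix x assume x: "x \<in> carrier (pts A)"
  show "\<exists>y \<in> carrier (pts A). y \<otimes>\<^bsub>pts A\<^esub> x = \<one>\<^bsub>pts A\<^esub>"
    using pt_inv_closed[OF pts_hom[OF x]] pt_mult_inv[OF A x] by (auto simp: pts_mult pts_one)
qed (simp_all add: pts_mult pts_one pt_mult_closed[OF A] pt_one_closed[OF A] pt_mult_assoc[OF A] pts_hom pt_mult_one[OF A])

lemma pts_inv:
  assumes A: "algebra R A" and x: "x \<in> carrier (pts A)"
  shows "inv\<^bsub>pts A\<^esub> x = pt_inv G x"
  by (rule group.inv_equality[OF pts_group[OF A]])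
    (simp_all add: x pt_inv_closed pts_hom pts_mult pts_one pt_mult_inv[OF A])

lemma pt_conj_eq:
  assumes A: "algebra R A" and g: "g \<in> carrier (pts A)"
  shows "pt_conj R G A g x = g \<otimes>\<^bsub>pts A\<^esub> x \<otimes>\<^bsub>pts A\<^esub> inv\<^bsub>pts A\<^esub> g"
  by (simp add: pt_conj_def pts_inv[OF A g] pts_mult)

lemma pts_functor:
  assumes A: "algebra R A" and C: "algebra R C" and g: "g \<in> alg_hom R A C"
  shows "group_hom (pts A) (pts C) (compose (carrier G) g)"
proof (intro group_hom.intro pts_group A C group_hom_axioms.intro homI)
  fix x y assume "x \<in> carrier (pts A)" "y \<in> carrier (pts A)"
  then have x: "x \<in> alg_hom R G A" and y: "y \<in> alg_hom R G A" by (simp_all add: pts_carrier)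
  show "compose (carrier G) g (x \<otimes>\<^bsub>pts A\<^esub> y) = compose (carrier G) g x \<otimes>\<^bsub>pts C\<^esub> compose (carrier G) g y"
    unfolding pts_mult by (rule compose_pt_mult[OF A x y C g]) (simp_all add: compose_def)
qed (simp add: pts_compose_closed[OF _ g] pts_hom)

lemma pt_conj_closed:
  assumes A: "algebra R A" and g: "g \<in> carrier (pts A)" and x: "x \<in> carrier (pts A)"
  shows "pt_conj R G A g x \<in> carrier (pts A)"
proof -
  interpret group "pts A" by (rule pts_group[OF A])
  show ?thesis using g x by (simp add: pt_conj_eq[OF A])
qed

lemma pt_conj_natural:
  assumes A: "algebra R A" and C: "algebra R C" and f: "f \<in> alg_hom R A C"
    and g: "g \<in> carrier (pts A)" and x: "x \<in> carrier (pts A)"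
  shows "compose (carrier G) f (pt_conj R G A g x)
    = pt_conj R G C (compose (carrier G) f g) (compose (carrier G) f x)"
proof -
  interpret group_hom "pts A" "pts C" "compose (carrier G) f" by (rule pts_functor[OF A C f])
  show ?thesis using g x by (simp add: pt_conj_eq[OF A] pt_conj_eq[OF C])
qed

lemma pt_conj_mult:
  assumes A: "algebra R A" and g: "g \<in> carrier (pts A)" and x: "x \<in> carrier (pts A)" and y: "y \<in> carrier (pts A)"
  shows "pt_conj R G A g (pt_mult R G A x y) = pt_mult R G A (pt_conj R G A g x) (pt_conj R G A g y)"
proof -
  interpret group "pts A" by (rule pts_group[OF A])
  have "inv\<^bsub>pts A\<^esub> g \<otimes>\<^bsub>pts A\<^esub> (g \<otimes>\<^bsub>pts A\<^esub> z) = z" if "z \<in> carrier (pts A)" for z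
    using g that by (simp add: m_assoc[symmetric])
  then show ?thesis using g x y by (simp add: pt_conj_eq[OF A] pts_mult[symmetric] m_assoc)
qed

lemma pt_conj_conj:
  assumes A: "algebra R A" and g: "g \<in> carrier (pts A)" and g': "g' \<in> carrier (pts A)" and x: "x \<in> carrier (pts A)"
  shows "pt_conj R G A (pt_mult R G A g g') x = pt_conj R G A g (pt_conj R G A g' x)"
proof -
  interpret group "pts A" by (rule pts_group[OF A])
  have "pt_mult R G A g g' \<in> carrier (pts A)" using g g' by (simp add: pts_mult[symmetric])
  then show ?thesis using g g' x
    by (simp add: pt_conj_eq[OF A]) (simp add: pts_mult[symmetric] m_assoc inv_mult_group)
qed

end

section \<open>Powers of a group scheme\<close>

locale group_scheme_power = group_scheme R G
  for R :: "('k, 'm) ring_scheme" and G :: "('k, 'h, 's) hopf_scheme" + fixes I :: "'i set"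
begin

abbreviation "OG \<equiv> gpow R G I"
abbreviation "pr \<equiv> gpow_pt R G I"

lemma reflect:
  assumes je: "jointly_embeds R (I \<times> carrier G) T t J C \<phi> s" and "\<And>j. j \<in> J \<Longrightarrow> gpow_cond R G I (C j) (s j)"
  shows "gpow_cond R G I T t"
  using assms(2) unfolding gpow_cond_def
  by (auto intro: alg_hom_reflect[OF je algebra_G, of "Pair _"])

sublocale univ: univ_algebra R "I \<times> carrier G" "gpow_cond R G I"
proof (rule univ_algebra.intro)
  show "univ_reflects R (I \<times> carrier G) (gpow_cond R G I)"
    unfolding univ_reflects_def using reflect by blast
qed (rule cring_R)

lemma algebra_OG: "algebra R OG"
  unfolding gpow_def by (rule univ.algebra_univ)

lemma pr_closed: "i \<in> I \<Longrightarrow> pr i \<in> carrier (pts OG)"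
  using univ.gen_cond unfolding gpow_pt_def gpow_cond_def gpow_def by (auto intro: restrict_pts)

lemma
  assumes C: "algebra R C" and x: "\<And>i. i \<in> I \<Longrightarrow> x i \<in> alg_hom R G C"
  shows eval_hom: "gpow_eval R C x \<in> alg_hom R OG C"
    and eval_pr: "i \<in> I \<Longrightarrow> h \<in> carrier G \<Longrightarrow> gpow_eval R C x (pr i h) = x i h"
proof -
  have v: "(\<lambda>(i, h). x i h) z \<in> carrier C" if "z \<in> I \<times> carrier G" for z
    using that x by (auto intro: alg_hom_closed[OF x])
  have c: "(\<lambda>h. (\<lambda>(i, h). x i h) (i, h)) \<in> alg_hom R G C" if "i \<in> I" for i using x[OF that] by simp
  have r: "gpow_cond R G I T t" if "jointly_embeds R (I \<times> carrier G) T t {()} (\<lambda>_. C) \<phi> (\<lambda>_ (i, h). x i h)" for T t \<phi>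
    unfolding gpow_cond_def using c by (auto intro: alg_hom_reflect[OF that algebra_G, of "Pair _"])
  note l = univ.lift_alg_hom[OF C v r refl] univ.lift_gen[OF C v r refl]
  show "gpow_eval R C x \<in> alg_hom R OG C"
    unfolding gpow_eval_def gpow_def using l(1) .
  show "i \<in> I \<Longrightarrow> h \<in> carrier G \<Longrightarrow> gpow_eval R C x (pr i h) = x i h"
    unfolding gpow_eval_def gpow_pt_def by (simp add: l(2))
qed

lemma hom_eqI:
  assumes f: "f \<in> alg_hom R OG C" and g: "g \<in> alg_hom R OG C"
    and "\<And>i h. i \<in> I \<Longrightarrow> h \<in> carrier G \<Longrightarrow> f (pr i h) = g (pr i h)" and u: "u \<in> carrier OG"
  shows "f u = g u"
  by (rule univ.hom_eqI[OF f[unfolded gpow_def] g[unfolded gpow_def] _ u[unfolded gpow_def]])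
    (use assms in \<open>auto simp: gpow_pt_def\<close>)

lemma eval_natural:
  assumes C: "algebra R C" and x: "\<And>i. i \<in> I \<Longrightarrow> x i \<in> alg_hom R G C"
    and E: "algebra R E" and g: "g \<in> alg_hom R C E" and u: "u \<in> carrier OG"
    and x': "\<And>i h. i \<in> I \<Longrightarrow> h \<in> carrier G \<Longrightarrow> x' i h = g (x i h)"
  shows "g (gpow_eval R C x u) = gpow_eval R E x' u"
proof -
  have X: "x' i \<in> alg_hom R G E" if "i \<in> I" for i
    by (rule alg_hom_cong[OF alg_hom_compose[OF x[OF that] g] algebra_G x'[OF that]])
  show ?thesis
    by (rule hom_eqI[OF alg_hom_compose[OF eval_hom[OF C x] g] eval_hom[OF E X]])
      (simp_all add: u eval_pr[OF C x] eval_pr[OF E X] x')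
qed

end

section \<open>Conjugation by a diagonalisable group\<close>

text \<open>These are the points with values in \<open>A\<close> of the diagonalisable scheme with
  coordinate ring \<open>R[M]\<close>.\<close>

definition is_char where
  "is_char M A \<mu> \<longleftrightarrow> (\<forall>m \<in> carrier M. \<mu> m \<in> carrier A) \<and> \<mu> \<one>\<^bsub>M\<^esub> = \<one>\<^bsub>A\<^esub> \<and>
    (\<forall>m \<in> carrier M. \<forall>n \<in> carrier M. \<mu> (m \<otimes>\<^bsub>M\<^esub> n) = \<mu> m \<otimes>\<^bsub>A\<^esub> \<mu> n)"

lemma is_char_compose:
  "is_char M A \<mu> \<Longrightarrow> f \<in> alg_hom R A C \<Longrightarrow> is_char M C (\<lambda>m. f (\<mu> m))"
  by (auto simp: is_char_def alg_hom_closed alg_hom_one alg_hom_mult)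

lemma is_char_mult:
  assumes "cring A" "is_char M A \<mu>" "is_char M A \<nu>"
  shows "is_char M A (\<lambda>m. \<mu> m \<otimes>\<^bsub>A\<^esub> \<nu> m)"
proof -
  interpret cring A by fact
  show ?thesis using assms(2,3) by (auto simp: is_char_def m_ac)
qed

lemma monoid_algebra_evalI:
  assumes "cring R" "comm_monoid M" "cring C" "\<sigma> \<in> ring_hom R C" "is_char M C \<mu>"
  shows "monoid_algebra_eval R M C \<sigma> \<mu>"
  using assms by (auto simp: monoid_algebra_eval_def monoid_algebra_def monoid_algebra_eval_axioms_def is_char_def)

lemma algebra_trivial:
  assumes A: "algebra R A" and "\<one>\<^bsub>R\<^esub> = \<zero>\<^bsub>R\<^esub>" "a \<in> carrier A" "b \<in> carrier A"
  shows "a = b"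
proof -
  interpret algebra R A by fact
  have "x = \<zero>\<^bsub>A\<^esub>" if "x \<in> carrier A" for x
    using smult_one[OF that] smult_l_null[OF that] assms(2) by simp
  then show ?thesis using assms by metis
qed

lemma alg_hom_inv_into:
  assumes A: "algebra R A" and f: "f \<in> alg_hom R A B" and b: "bij_betw f (carrier A) (carrier B)"
  shows "inv_into (carrier A) f \<in> alg_hom R B A"
proof -
  interpret A: algebra R A by fact
  let ?g = "inv_into (carrier A) f"
  have c: "?g y \<in> carrier A" "f (?g y) = y" if "y \<in> carrier B" for y
    using that b by (auto simp: bij_betw_def inv_into_into f_inv_into_f)
  have u: "?g y = x" if "x \<in> carrier A" "f x = y" for x y
    using that b by (auto simp: bij_betw_def inv_into_f_f)
  show ?thesis
    by (intro alg_homI ring_hom_memI c(1) u)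
      (auto simp: c alg_hom_mult[OF f] alg_hom_add[OF f] alg_hom_one[OF f] alg_hom_smult[OF f])
qed

context algebra_monoid
begin

lemma monom_char: "is_char M AM (monom_at A)"
  by (simp add: is_char_def monom_closed monom_one monom_mult)

lemma
  assumes C: "algebra R C" and s: "\<sigma> \<in> alg_hom R A C" and m: "is_char M C \<mu>"
  shows meval_alg_hom: "meval A C \<sigma> \<mu> \<in> alg_hom R AM C"
    and meval_mconst: "a \<in> carrier A \<Longrightarrow> meval A C \<sigma> \<mu> (mconst A M a) = \<sigma> a"
    and meval_monom: "m \<in> carrier M \<Longrightarrow> meval A C \<sigma> \<mu> (monom_at A m) = \<mu> m"
    and meval_term: "a \<in> carrier A \<Longrightarrow> m \<in> carrier M \<Longrightarrow> meval A C \<sigma> \<mu> (term_at a m) = \<sigma> a \<otimes>\<^bsub>C\<^esub> \<mu> m"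
proof -
  interpret e: monoid_algebra_eval A M C \<sigma> \<mu>
    by (rule monoid_algebra_evalI[OF is_cring M.comm_monoid_axioms algebra_cring[OF C] alg_hom_ring_hom[OF s] m])
  show tm: "meval A C \<sigma> \<mu> (term_at a m) = \<sigma> a \<otimes>\<^bsub>C\<^esub> \<mu> m" if "a \<in> carrier A" "m \<in> carrier M" for a m
    using that by (rule e.eval_term)
  show const: "meval A C \<sigma> \<mu> (mconst A M a) = \<sigma> a" if "a \<in> carrier A" for a
    using tm[OF that M.one_closed] e.\<sigma>_closed[OF that] by (simp add: mconst_eq e.\<mu>_one)
  show "meval A C \<sigma> \<mu> (monom_at A m) = \<mu> m" if "m \<in> carrier M" for m
    using tm[OF one_closed that] e.\<mu>_closed[OF that] alg_hom_one[OF s] by (simp add: monom_eq)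
  show "meval A C \<sigma> \<mu> \<in> alg_hom R AM C"
  proof (rule alg_hom_from_structure_map[OF algebra_AM C])
    show "meval A C \<sigma> \<mu> \<in> ring_hom AM C" using e.eval_ring_hom by (simp add: AM_ring_hom)
    fix k assume k: "k \<in> carrier R"
    show "meval A C \<sigma> \<mu> (structure_map AM k) = structure_map C k"
      using alg_hom_structure_map[OF mconst_alg_hom algebra_axioms k]
        alg_hom_structure_map[OF s algebra_axioms k] const structure_map_closed[OF algebra_axioms k] by metis
  qed
qed

text \<open>Additivity reduces the claim to monomials. The coefficient algebra \<open>E\<close> of
  the target is left general: it is \<open>C\<close> in \<open>reynolds_natural\<close> and
  \<open>B[M]\<close> in \<open>reynolds_gpow\<close>.\<close>

lemma coeff_one_hom:
  assumes E: "algebra R E" and F: "F \<in> alg_hom R AM (alg_monoid E M)" and k: "\<kappa> \<in> alg_hom R A E"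
    and t: "\<And>a m. a \<in> carrier A \<Longrightarrow> m \<in> carrier M \<Longrightarrow>
      F (term_at a m) \<one>\<^bsub>M\<^esub> = (if m = \<one>\<^bsub>M\<^esub> then \<kappa> a else \<zero>\<^bsub>E\<^esub>)"
    and p: "p \<in> carrier AM"
  shows "F p \<one>\<^bsub>M\<^esub> = \<kappa> (p \<one>\<^bsub>M\<^esub>)"
proof -
  interpret E: algebra R E by fact
  interpret EM: algebra_monoid R E M
    by (intro algebra_monoid.intro E monoid_algebra.intro algebra_cring[OF E] M.comm_monoid_axioms)
  have k0: "\<kappa> \<zero>\<^bsub>A\<^esub> = \<zero>\<^bsub>E\<^esub>" by (rule alg_hom_zero[OF k algebra_axioms E])
  from p have "p \<in> carrier P" by (simp add: AM_simps)
  then show ?thesis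
  proof (induction p rule: term_induct)
    case zero
    have "F \<zero>\<^bsub>P\<^esub> = \<zero>\<^bsub>EM.P\<^esub>"
      using alg_hom_zero[OF F algebra_AM EM.algebra_AM] by (simp add: AM_simps EM.AM_simps)
    then show ?case by (simp add: zero_eq EM.zero_eq k0)
  next
    case (add p c m)
    have "F (p \<oplus>\<^bsub>P\<^esub> term_at c m) = F p \<oplus>\<^bsub>EM.P\<^esub> F (term_at c m)"
      using alg_hom_add[OF F, of p "term_at c m"] add by (simp add: AM_simps EM.AM_simps)
    then have "F (p \<oplus>\<^bsub>P\<^esub> term_at c m) \<one>\<^bsub>M\<^esub> = \<kappa> (p \<one>\<^bsub>M\<^esub>) \<oplus>\<^bsub>E\<^esub> (if m = \<one>\<^bsub>M\<^esub> then \<kappa> c else \<zero>\<^bsub>E\<^esub>)"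
      using add by (simp add: EM.add_eq t)
    moreover have "\<kappa> (p \<one>\<^bsub>M\<^esub>) \<in> carrier E" using alg_hom_closed[OF k] add by simp
    ultimately show ?case using add
      by (auto simp: add_eq term_at_def alg_hom_add[OF k] k0)
  qed
qed

end

text \<open>The torus enters through an isomorphism \<open>\<phi>\<close> of its coordinate ring
  with \<open>R[M]\<close>; for a split torus \<open>M\<close> is the free abelian group of
  characters.\<close>

locale torus_conjugation = group_scheme R G + T: group_scheme R G0 + M: comm_monoid M
  for R :: "('k, 'm) ring_scheme" and G :: "('k, 'h, 's) hopf_scheme"
    and G0 :: "('k, 'h0, 't) hopf_scheme" and M :: "('n, 'u) monoid_scheme" +
  fixes \<iota> :: "'h \<Rightarrow> 'h0" and \<phi> :: "('n \<Rightarrow> 'k) \<Rightarrow> 'h0"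
  assumes \<iota>: "\<iota> \<in> hopf_hom R G G0" and \<phi>: "\<phi> \<in> hopf_iso R (diagonalisable R M) G0"
begin

lemma \<iota>_hom: "\<iota> \<in> alg_hom R G G0"
  using \<iota> by (simp add: hopf_hom_def)

lemma monoid_algebra_RM: "monoid_algebra R M"
  by (intro monoid_algebra.intro cring_R M.comm_monoid_axioms)

lemma algebra_monoidI: "algebra R B \<Longrightarrow> algebra_monoid R B M"
  by (intro algebra_monoid.intro monoid_algebra.intro algebra_cring M.comm_monoid_axioms)

lemma algebra_RM: "algebra R (monoid_alg R M)"
  by (rule monoid_algebra.algebra_P[OF monoid_algebra_RM])

lemma \<phi>_hom: "\<phi> \<in> alg_hom R (monoid_alg R M) G0"
  and \<phi>_bij: "bij_betw \<phi> (carrier (monoid_alg R M)) (carrier G0)"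
  using \<phi> by (auto simp: hopf_iso_def hopf_hom_def alg_hom_def ring_hom_def diagonalisable_def Let_def)

definition "\<psi> = inv_into (carrier (monoid_alg R M)) \<phi>"

lemma \<psi>_hom: "\<psi> \<in> alg_hom R G0 (monoid_alg R M)"
  unfolding \<psi>_def by (rule alg_hom_inv_into[OF algebra_RM \<phi>_hom \<phi>_bij])

lemma \<psi>_\<phi>: "p \<in> carrier (monoid_alg R M) \<Longrightarrow> \<psi> (\<phi> p) = p"
  unfolding \<psi>_def using \<phi>_bij by (simp add: bij_betw_def inv_into_f_f)

lemma \<phi>_\<psi>: "c \<in> carrier G0 \<Longrightarrow> \<phi> (\<psi> c) = c"
  unfolding \<psi>_def using \<phi>_bij by (simp add: bij_betw_def f_inv_into_f)

definition "\<chi> m = \<phi> (monom_at R m)"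

lemma monom_RM: "m \<in> carrier M \<Longrightarrow> monom_at R m \<in> carrier (monoid_alg R M)"
proof -
  interpret monoid_algebra R M by (rule monoid_algebra_RM)
  show "m \<in> carrier M \<Longrightarrow> monom_at R m \<in> carrier P"
    using term_closed[of "\<one>\<^bsub>R\<^esub>" m] by (simp add: monom_at_def term_at_def)
qed

lemma \<chi>_closed: "m \<in> carrier M \<Longrightarrow> \<chi> m \<in> carrier G0"
  unfolding \<chi>_def by (rule alg_hom_closed[OF \<phi>_hom monom_RM])

lemma \<chi>_char: "is_char M G0 \<chi>"
proof -
  interpret monoid_algebra R M by (rule monoid_algebra_RM)
  have e: "monom_at R m = term_at \<one>\<^bsub>R\<^esub> m" for m by (simp add: monom_at_def term_at_def)
  have "monom_at R (m \<otimes>\<^bsub>M\<^esub> n) = monom_at R m \<otimes>\<^bsub>P\<^esub> monom_at R n" if "m \<in> carrier M" "n \<in> carrier M" for m n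
    using that by (simp add: e term_mult)
  moreover have "monom_at R \<one>\<^bsub>M\<^esub> = \<one>\<^bsub>P\<^esub>" by (simp add: e one_eq)
  ultimately show ?thesis
    unfolding is_char_def using \<chi>_closed
    by (auto simp: \<chi>_def alg_hom_one[OF \<phi>_hom] alg_hom_mult[OF \<phi>_hom monom_RM monom_RM])
qed

text \<open>The characters \<open>\<chi> m\<close> span \<open>O(G0)\<close> as a module, being the
  images of the monomials of \<open>R[M]\<close>.\<close>

lemma G0_hom_eqI:
  assumes f: "f \<in> alg_hom R G0 A" and g: "g \<in> alg_hom R G0 A" and A: "algebra R A"
    and eq: "\<And>m. m \<in> carrier M \<Longrightarrow> f (\<chi> m) = g (\<chi> m)" and c: "c \<in> carrier G0"
  shows "f c = g c"
proof -
  interpret monoid_algebra R M by (rule monoid_algebra_RM)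
  have F: "(\<lambda>p. f (\<phi> p)) \<in> alg_hom R P A" and G: "(\<lambda>p. g (\<phi> p)) \<in> alg_hom R P A"
    by (auto intro: alg_hom_compose[OF \<phi>_hom] f g)
  have t: "f (\<phi> (term_at k m)) = g (\<phi> (term_at k m))" if "k \<in> carrier R" "m \<in> carrier M" for k m
  proof -
    have "term_at k m = k \<odot>\<^bsub>P\<^esub> monom_at R m"
      using that by (auto simp: term_at_def monom_at_def monoid_alg_def)
    then show ?thesis using that eq[OF that(2)] monom_RM[OF that(2)]
      by (simp add: alg_hom_smult[OF F] alg_hom_smult[OF G] \<chi>_def)
  qed
  have "f (\<phi> p) = g (\<phi> p)" if "p \<in> carrier P" for p
    using that
  proof (induction p rule: term_induct)
    case zero
    then show ?case using alg_hom_zero[OF F algebra_P A] alg_hom_zero[OF G algebra_P A] by simp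
  next
    case (add p k m)
    then show ?case by (simp add: alg_hom_add[OF F] alg_hom_add[OF G] t)
  qed
  from this[OF alg_hom_closed[OF \<psi>_hom c]] show ?thesis by (simp add: \<phi>_\<psi>[OF c])
qed

lemma comult_\<chi>:
  assumes m: "m \<in> carrier M"
  shows "comult G0 (\<chi> m) = T.GG.inl (\<chi> m) \<otimes>\<^bsub>T.GG.T\<^esub> T.GG.inr (\<chi> m)"
proof (cases "\<one>\<^bsub>R\<^esub> = \<zero>\<^bsub>R\<^esub>")
  \<comment> \<open>The comultiplication of \<open>diagonalisable\<close> is a sum over the support,
    and the support of the monomial at \<open>m\<close> is \<open>{m}\<close> only if
    \<open>R\<close> is not the zero ring. Over the zero ring any two elements of an algebra
    agree.\<close>
  case True
  interpret TT: algebra R T.GG.T by (rule T.GG.algebra_T)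
  show ?thesis
    by (rule algebra_trivial[OF T.GG.algebra_T True])
      (simp_all add: alg_hom_closed[OF T.comult_hom] alg_hom_closed[OF T.GG.inl_hom] alg_hom_closed[OF T.GG.inr_hom]
        \<chi>_closed m)
next
  case False
  let ?B = "monoid_alg R M"
  interpret P: tensor_product R ?B ?B by (rule tensor_product.intro[OF algebra_RM algebra_RM])
  interpret PT: algebra R P.T by (rule P.algebra_T)
  let ?x = "\<lambda>a. T.GG.inl (\<phi> a)" and ?y = "\<lambda>a. T.GG.inr (\<phi> a)"
  let ?l = "tensor_lift R T.GG.T ?x ?y" and ?m = "monom_at R m"
  have x: "?x \<in> alg_hom R ?B T.GG.T" and y: "?y \<in> alg_hom R ?B T.GG.T"
    using T.GG.inl_hom T.GG.inr_hom \<phi>_hom by (auto intro: alg_hom_compose)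
  have l: "?l \<in> alg_hom R P.T T.GG.T" by (rule P.lift_hom[OF T.GG.algebra_T x y])
  have ix: "P.inl ?m \<in> carrier P.T" "P.inr ?m \<in> carrier P.T"
    using monom_RM[OF m] by (auto intro: alg_hom_closed[OF P.inl_hom] alg_hom_closed[OF P.inr_hom])
  have "comult (diagonalisable R M) ?m = P.inl ?m \<otimes>\<^bsub>P.T\<^esub> P.inr ?m"
  proof -
    have s: "{m'. ?m m' \<noteq> \<zero>\<^bsub>R\<^esub>} = {m}" using False by (auto simp: monom_at_def)
    have "?m m = \<one>\<^bsub>R\<^esub>" by (simp add: monom_at_def)
    then show ?thesis
      using ix by (simp add: diagonalisable_def Let_def s)
  qed
  moreover have "comult G0 (\<chi> m) = ?l (comult (diagonalisable R M) ?m)"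
    using \<phi> monom_RM[OF m] unfolding \<chi>_def by (simp add: hopf_iso_def hopf_hom_def diagonalisable_def Let_def)
  moreover have "?l (P.inl ?m \<otimes>\<^bsub>P.T\<^esub> P.inr ?m) = T.GG.inl (\<chi> m) \<otimes>\<^bsub>T.GG.T\<^esub> T.GG.inr (\<chi> m)"
    using monom_RM[OF m] by (simp add: alg_hom_mult[OF l ix] \<chi>_def
      P.lift_inl[OF T.GG.algebra_T x y] P.lift_inr[OF T.GG.algebra_T x y])
  ultimately show ?thesis by simp
qed

text \<open>The point of \<open>G0(A)\<close> given by a character \<open>M \<longrightarrow> A\<^sup>\<times>\<close>, and its image in \<open>G(A)\<close>.\<close>

definition "tpt A \<mu> c = meval R A (structure_map A) \<mu> (\<psi> c)"

definition "gpt A \<mu> = (\<lambda>h \<in> carrier G. tpt A \<mu> (\<iota> h))"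

lemma
  assumes A: "algebra R A" and \<mu>: "is_char M A \<mu>"
  shows tpt_hom: "tpt A \<mu> \<in> alg_hom R G0 A"
    and tpt_\<chi>: "m \<in> carrier M \<Longrightarrow> tpt A \<mu> (\<chi> m) = \<mu> m"
proof -
  interpret e: monoid_algebra_eval R M A "structure_map A" \<mu>
    by (rule monoid_algebra_evalI[OF cring_R M.comm_monoid_axioms algebra_cring[OF A] structure_map_ring_hom[OF A] \<mu>])
  interpret A: cring A by (rule algebra_cring[OF A])
  have "meval R A (structure_map A) \<mu> \<in> alg_hom R e.P A"
  proof (rule alg_hom_from_structure_map[OF algebra_RM A e.eval_ring_hom])
    fix k assume "k \<in> carrier R"
    then show "e.ev (structure_map e.P k) = structure_map A k"
      by (simp add: e.structure_map_P e.eval_term e.\<mu>_one structure_map_closed[OF A])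
  qed
  from alg_hom_compose[OF \<psi>_hom this] show "tpt A \<mu> \<in> alg_hom R G0 A"
    by (simp add: tpt_def[abs_def])
  assume m: "m \<in> carrier M"
  have "\<psi> (\<chi> m) = e.term_at \<one>\<^bsub>R\<^esub> m"
    unfolding \<chi>_def \<psi>_\<phi>[OF monom_RM[OF m]] by (simp add: monom_at_def e.term_at_def)
  then show "tpt A \<mu> (\<chi> m) = \<mu> m"
    using e.eval_term[OF ring.ring_simprules(6)[OF cring.axioms(1)[OF cring_R]] m] e.\<mu>_closed[OF m]
    by (simp add: tpt_def ring_hom_one[OF structure_map_ring_hom[OF A]])
qed

lemma tpt_natural:
  assumes A: "algebra R A" and \<mu>: "is_char M A \<mu>" and C: "algebra R C" and f: "f \<in> alg_hom R A C" and c: "c \<in> carrier G0"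
    and \<nu>: "\<And>m. m \<in> carrier M \<Longrightarrow> \<nu> m = f (\<mu> m)"
  shows "f (tpt A \<mu> c) = tpt C \<nu> c"
proof -
  have n: "is_char M C \<nu>"
    using is_char_compose[OF \<mu> f] \<nu> by (auto simp: is_char_def)
  show ?thesis
    by (rule G0_hom_eqI[OF alg_hom_compose[OF tpt_hom[OF A \<mu>] f] tpt_hom[OF C n] C _ c])
      (simp add: tpt_\<chi>[OF A \<mu>] tpt_\<chi>[OF C n] \<nu>)
qed

lemma gpt_closed: "algebra R A \<Longrightarrow> is_char M A \<mu> \<Longrightarrow> gpt A \<mu> \<in> carrier (pts A)"
  unfolding gpt_def by (rule restrict_pts) (rule alg_hom_compose[OF \<iota>_hom tpt_hom])

lemma gpt_natural:
  assumes A: "algebra R A" and \<mu>: "is_char M A \<mu>" and C: "algebra R C" and f: "f \<in> alg_hom R A C"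
    and \<nu>: "\<And>m. m \<in> carrier M \<Longrightarrow> \<nu> m = f (\<mu> m)"
  shows "compose (carrier G) f (gpt A \<mu>) = gpt C \<nu>"
  using tpt_natural[OF A \<mu> C f alg_hom_closed[OF \<iota>_hom] \<nu>] by (auto simp: compose_def gpt_def)

text \<open>Points of \<open>G0\<close> given by characters multiply like the characters because
  each \<open>\<chi> m\<close> is group-like; the product is carried over to \<open>G\<close>
  because \<open>\<iota>\<close> respects comultiplication.\<close>

lemma gpt_mult:
  assumes A: "algebra R A" and \<mu>: "is_char M A \<mu>" and \<nu>: "is_char M A \<nu>"
  shows "pt_mult R G A (gpt A \<mu>) (gpt A \<nu>) = gpt A (\<lambda>m. \<mu> m \<otimes>\<^bsub>A\<^esub> \<nu> m)"
proof -
  let ?x = "tpt A \<mu>" and ?y = "tpt A \<nu>"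
  note x = tpt_hom[OF A \<mu>] and y = tpt_hom[OF A \<nu>]
  have \<mu>\<nu>: "is_char M A (\<lambda>m. \<mu> m \<otimes>\<^bsub>A\<^esub> \<nu> m)" by (rule is_char_mult[OF algebra_cring[OF A] \<mu> \<nu>])
  have "pt_mult R G0 A ?x ?y c = tpt A (\<lambda>m. \<mu> m \<otimes>\<^bsub>A\<^esub> \<nu> m) c" if c: "c \<in> carrier G0" for c
  proof (rule G0_hom_eqI[OF T.pts_hom[OF T.pt_mult_closed[OF A x y]] tpt_hom[OF A \<mu>\<nu>] A _ c])
    fix m assume m: "m \<in> carrier M"
    note l = T.GG.lift_hom[OF A x y]
    show "pt_mult R G0 A ?x ?y (\<chi> m) = tpt A (\<lambda>m. \<mu> m \<otimes>\<^bsub>A\<^esub> \<nu> m) (\<chi> m)"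
      using \<chi>_closed[OF m] by (simp add: pt_mult_def comult_\<chi>[OF m] tpt_\<chi>[OF A \<mu>\<nu> m] alg_hom_mult[OF l]
        alg_hom_closed[OF T.GG.inl_hom] alg_hom_closed[OF T.GG.inr_hom]
        T.GG.lift_inl[OF A x y] T.GG.lift_inr[OF A x y] tpt_\<chi>[OF A \<mu> m] tpt_\<chi>[OF A \<nu> m])
  qed
  moreover have "pt_mult R G A (gpt A \<mu>) (gpt A \<nu>) h = pt_mult R G0 A ?x ?y (\<iota> h)" if h: "h \<in> carrier G" for h
  proof -
    have il: "(\<lambda>a. T.GG.inl (\<iota> a)) \<in> alg_hom R G T.GG.T" and ir: "(\<lambda>a. T.GG.inr (\<iota> a)) \<in> alg_hom R G T.GG.T"
      using T.GG.inl_hom T.GG.inr_hom \<iota>_hom by (auto intro: alg_hom_compose)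
    have "comult G0 (\<iota> h) = tensor_lift R T.GG.T (\<lambda>a. T.GG.inl (\<iota> a)) (\<lambda>a. T.GG.inr (\<iota> a)) (comult G h)"
      using \<iota> h by (simp add: hopf_hom_def)
    then have "pt_mult R G0 A ?x ?y (\<iota> h)
        = tensor_lift R A ?x ?y (tensor_lift R T.GG.T (\<lambda>a. T.GG.inl (\<iota> a)) (\<lambda>a. T.GG.inr (\<iota> a)) (comult G h))"
      using alg_hom_closed[OF \<iota>_hom h] by (simp add: pt_mult_def)
    also have "\<dots> = tensor_lift R A (gpt A \<mu>) (gpt A \<nu>) (comult G h)"
      by (rule GG.lift_natural[OF T.GG.algebra_T il ir A T.GG.lift_hom[OF A x y] alg_hom_closed[OF comult_hom h]])
        (simp_all add: gpt_def T.GG.lift_inl[OF A x y] T.GG.lift_inr[OF A x y] alg_hom_closed[OF \<iota>_hom])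
    finally show ?thesis using h by (simp add: pt_mult_def)
  qed
  ultimately show ?thesis
    using alg_hom_closed[OF \<iota>_hom]
    by (intro pts_eqI[OF pt_mult_closed[OF A pts_hom[OF gpt_closed[OF A \<mu>]] pts_hom[OF gpt_closed[OF A \<nu>]]]
          gpt_closed[OF A \<mu>\<nu>]]) (simp add: gpt_def)
qed

end

section \<open>The Reynolds operator\<close>

context torus_conjugation
begin

text \<open>The isomorphism \<open>B \<otimes> \<O>(G0) \<longrightarrow> B[M]\<close>; it turns a coaction into a decomposition into weight
  vectors, of which the Reynolds operator picks the one of weight zero.\<close>

definition "weights B = tensor_lift R (alg_monoid B M) (mconst B M) (tpt (alg_monoid B M) (monom_at B))"

definition "reynolds B \<delta> b = weights B (\<delta> b) \<one>\<^bsub>M\<^esub>"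

lemma tensor_productI: "algebra R B \<Longrightarrow> tensor_product R B G0"
  by (rule tensor_product.intro[OF _ T.algebra_G])

lemma
  assumes B: "algebra R B"
  shows weights_hom: "weights B \<in> alg_hom R (tensor R B G0) (alg_monoid B M)"
    and weights_inl: "b \<in> carrier B \<Longrightarrow> weights B (tensor_inl R B G0 b) = mconst B M b"
    and weights_inr: "c \<in> carrier G0 \<Longrightarrow> weights B (tensor_inr R B G0 c) = tpt (alg_monoid B M) (monom_at B) c"
proof -
  interpret BM: algebra_monoid R B M by (rule algebra_monoidI[OF B])
  interpret BT: tensor_product R B G0 by (rule tensor_productI[OF B])
  note l = BM.algebra_AM BM.mconst_alg_hom tpt_hom[OF BM.algebra_AM BM.monom_char]
  show "weights B \<in> alg_hom R (tensor R B G0) (alg_monoid B M)"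
    unfolding weights_def by (rule BT.lift_hom[OF l])
  show "b \<in> carrier B \<Longrightarrow> weights B (tensor_inl R B G0 b) = mconst B M b"
    unfolding weights_def by (rule BT.lift_inl[OF l])
  show "c \<in> carrier G0 \<Longrightarrow> weights B (tensor_inr R B G0 c) = tpt (alg_monoid B M) (monom_at B) c"
    unfolding weights_def by (rule BT.lift_inr[OF l])
qed

text \<open>The map \<open>?\<Phi>\<close>, sending \<open>b\<close> to \<open>b \<otimes> 1\<close>
  and the monomial at \<open>m\<close> to \<open>1 \<otimes> \<chi> m\<close>, is a left inverse of
  \<open>weights B\<close>.\<close>

lemma weights_inj:
  assumes B: "algebra R B" and u: "u \<in> carrier (tensor R B G0)" and v: "v \<in> carrier (tensor R B G0)"
    and eq: "weights B u = weights B v"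
  shows "u = v"
proof -
  interpret BM: algebra_monoid R B M by (rule algebra_monoidI[OF B])
  interpret BT: tensor_product R B G0 by (rule tensor_productI[OF B])
  let ?\<Phi> = "meval B BT.T BT.inl (\<lambda>m. BT.inr (\<chi> m))"
  have ch: "is_char M BT.T (\<lambda>m. BT.inr (\<chi> m))"
    by (rule is_char_compose[OF \<chi>_char BT.inr_hom])
  note \<Phi> = BM.meval_alg_hom[OF BT.algebra_T BT.inl_hom ch]
  have r: "?\<Phi> (tpt BM.AM (monom_at B) c) = BT.inr c" if c: "c \<in> carrier G0" for c
    by (rule G0_hom_eqI[OF alg_hom_compose[OF tpt_hom[OF BM.algebra_AM BM.monom_char] \<Phi>] BT.inr_hom BT.algebra_T _ c])
      (simp add: tpt_\<chi>[OF BM.algebra_AM BM.monom_char] BM.meval_monom[OF BT.algebra_T BT.inl_hom ch])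
  have "?\<Phi> (weights B w) = w" if w: "w \<in> carrier BT.T" for w
    by (rule BT.hom_eqI[OF alg_hom_compose[OF weights_hom[OF B] \<Phi>] alg_hom_id _ _ w])
      (simp_all only: weights_inl[OF B] weights_inr[OF B] r BM.meval_mconst[OF BT.algebra_T BT.inl_hom ch])
  from this[OF u] this[OF v] eq show ?thesis by metis
qed

lemma reynolds_closed:
  assumes B: "algebra R B" and d: "\<delta> b \<in> carrier (tensor R B G0)"
  shows "reynolds B \<delta> b \<in> carrier B"
proof -
  interpret BM: algebra_monoid R B M by (rule algebra_monoidI[OF B])
  show ?thesis
    unfolding reynolds_def using alg_hom_closed[OF weights_hom[OF B] d] by (simp add: BM.AM_simps)
qed

text \<open>The element \<open>b \<otimes> 1\<close> corresponds to a constant of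
  \<open>B[M]\<close>: an invariant has weight zero only.\<close>

lemma reynolds_coinvariant:
  assumes B: "algebra R B" and b: "b \<in> carrier B" and d: "\<delta> b = tensor_inl R B G0 b"
  shows "reynolds B \<delta> b = b"
  by (simp add: reynolds_def d weights_inl[OF B b]) (simp add: mconst_def)

lemma reynolds_add:
  assumes B: "algebra R B" and d: "\<delta> \<in> alg_hom R B (tensor R B G0)" and a: "a \<in> carrier B" and b: "b \<in> carrier B"
  shows "reynolds B \<delta> (a \<oplus>\<^bsub>B\<^esub> b) = reynolds B \<delta> a \<oplus>\<^bsub>B\<^esub> reynolds B \<delta> b"
proof -
  interpret BM: algebra_monoid R B M by (rule algebra_monoidI[OF B])
  show ?thesis
    using a b alg_hom_closed[OF d a] alg_hom_closed[OF d b]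
    by (simp add: reynolds_def alg_hom_add[OF d] alg_hom_add[OF weights_hom[OF B]] BM.AM_simps BM.add_eq)
qed

text \<open>In terms of weights, \<open>f \<otimes> id\<close> becomes \<open>?F\<close>, which
  applies \<open>f\<close> to each coefficient and so preserves the coefficient of weight zero.
  Compatibility of the coactions is required at the element \<open>b\<close> only.\<close>

lemma reynolds_natural:
  assumes B: "algebra R B" and C: "algebra R C" and f: "f \<in> alg_hom R B C"
    and d: "\<delta> b \<in> carrier (tensor R B G0)"
    and eq: "\<delta>' (f b) = tensor_lift R (tensor R C G0) (\<lambda>b. tensor_inl R C G0 (f b)) (tensor_inr R C G0) (\<delta> b)"
  shows "reynolds C \<delta>' (f b) = f (reynolds B \<delta> b)"
proof -
  interpret BM: algebra_monoid R B M by (rule algebra_monoidI[OF B])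
  interpret BT: tensor_product R B G0 by (rule tensor_productI[OF B])
  interpret CM: algebra_monoid R C M by (rule algebra_monoidI[OF C])
  interpret CT: tensor_product R C G0 by (rule tensor_productI[OF C])
  let ?F = "meval B CM.AM (\<lambda>b. mconst C M (f b)) (monom_at C)"
  have s: "(\<lambda>b. mconst C M (f b)) \<in> alg_hom R B CM.AM"
    by (rule alg_hom_compose[OF f CM.mconst_alg_hom])
  note F = BM.meval_alg_hom[OF CM.algebra_AM s CM.monom_char]
  have x: "(\<lambda>b. CT.inl (f b)) \<in> alg_hom R B CT.T" by (rule alg_hom_compose[OF f CT.inl_hom])
  note l = CT.algebra_T x CT.inr_hom
  have "weights C (tensor_lift R CT.T (\<lambda>b. CT.inl (f b)) CT.inr u) = ?F (weights B u)"
    if u: "u \<in> carrier BT.T" for u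
  proof (rule BT.hom_eqI[OF alg_hom_compose[OF BT.lift_hom[OF l] weights_hom[OF C]]
        alg_hom_compose[OF weights_hom[OF B] F] _ _ u])
    fix b assume "b \<in> carrier B"
    then show "weights C (tensor_lift R CT.T (\<lambda>b. CT.inl (f b)) CT.inr (BT.inl b)) = ?F (weights B (BT.inl b))"
      by (simp add: BT.lift_inl[OF l] weights_inl[OF B] weights_inl[OF C] alg_hom_closed[OF f]
          BM.meval_mconst[OF CM.algebra_AM s CM.monom_char])
  next
    fix c assume c: "c \<in> carrier G0"
    have "?F (tpt BM.AM (monom_at B) c) = tpt CM.AM (monom_at C) c"
      by (rule tpt_natural[OF BM.algebra_AM BM.monom_char CM.algebra_AM F c])
        (simp add: BM.meval_monom[OF CM.algebra_AM s CM.monom_char])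
    with c show "weights C (tensor_lift R CT.T (\<lambda>b. CT.inl (f b)) CT.inr (BT.inr c)) = ?F (weights B (BT.inr c))"
      by (simp add: BT.lift_inr[OF l] weights_inr[OF B] weights_inr[OF C])
  qed
  with d have "weights C (\<delta>' (f b)) = ?F (weights B (\<delta> b))" by (simp add: eq)
  moreover have "?F (weights B (\<delta> b)) \<one>\<^bsub>M\<^esub> = f (weights B (\<delta> b) \<one>\<^bsub>M\<^esub>)"
  proof (rule BM.coeff_one_hom[OF C F f _ alg_hom_closed[OF weights_hom[OF B] d]])
    fix a m assume am: "a \<in> carrier B" "m \<in> carrier M"
    have "?F (BM.term_at a m) = CM.term_at (f a) m"
      using am by (simp add: BM.meval_term[OF CM.algebra_AM s CM.monom_char] CM.mconst_monom alg_hom_closed[OF f])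
    then show "?F (BM.term_at a m) \<one>\<^bsub>M\<^esub> = (if m = \<one>\<^bsub>M\<^esub> then f a else \<zero>\<^bsub>C\<^esub>)"
      by (simp add: CM.term_at_def)
  qed
  ultimately show ?thesis by (simp add: reynolds_def)
qed

lemma
  assumes B: "algebra R B"
  shows univ_pt_closed: "(\<lambda>h \<in> carrier G. tensor_inr R B G0 (\<iota> h)) \<in> carrier (pts (tensor R B G0))"
    and inl_pt_closed: "x \<in> carrier (pts B) \<Longrightarrow> (\<lambda>h \<in> carrier G. tensor_inl R B G0 (x h)) \<in> carrier (pts (tensor R B G0))"
proof -
  interpret BT: tensor_product R B G0 by (rule tensor_productI[OF B])
  show "(\<lambda>h \<in> carrier G. tensor_inr R B G0 (\<iota> h)) \<in> carrier (pts (tensor R B G0))"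
    by (rule restrict_pts[OF alg_hom_compose[OF \<iota>_hom BT.inr_hom]])
  show "x \<in> carrier (pts B) \<Longrightarrow> (\<lambda>h \<in> carrier G. tensor_inl R B G0 (x h)) \<in> carrier (pts (tensor R B G0))"
    by (rule restrict_pts[OF alg_hom_compose[OF pts_hom BT.inl_hom]])
qed

lemma univ_conj_closed:
  assumes B: "algebra R B" and x: "x \<in> carrier (pts B)"
  shows "univ_conj R G G0 \<iota> B x \<in> carrier (pts (tensor R B G0))"
  unfolding univ_conj_def
  by (rule pt_conj_closed[OF tensor_product.algebra_T[OF tensor_productI[OF B]] univ_pt_closed[OF B] inl_pt_closed[OF B x]])

lemma univ_conj_mult:
  assumes B: "algebra R B" and x: "x \<in> carrier (pts B)" and y: "y \<in> carrier (pts B)"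
  shows "univ_conj R G G0 \<iota> B (pt_mult R G B x y)
    = pt_mult R G (tensor R B G0) (univ_conj R G G0 \<iota> B x) (univ_conj R G G0 \<iota> B y)"
proof -
  interpret BT: tensor_product R B G0 by (rule tensor_productI[OF B])
  have "(\<lambda>h \<in> carrier G. BT.inl (pt_mult R G B x y h))
    = pt_mult R G BT.T (\<lambda>h \<in> carrier G. BT.inl (x h)) (\<lambda>h \<in> carrier G. BT.inl (y h))"
    unfolding compose_def[symmetric]
    by (rule compose_pt_mult[OF B pts_hom[OF x] pts_hom[OF y] BT.algebra_T BT.inl_hom]) (simp_all add: compose_def)
  then show ?thesis
    unfolding univ_conj_def
    using pt_conj_mult[OF BT.algebra_T univ_pt_closed[OF B] inl_pt_closed[OF B x] inl_pt_closed[OF B y]] by simp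
qed

text \<open>The map on tensor products is \<open>f \<otimes> id\<close>. It fixes the universal
  point of \<open>G0\<close>, so conjugation by that point commutes with base change along
  \<open>f\<close>.\<close>

lemma univ_conj_natural:
  assumes B: "algebra R B" and C: "algebra R C" and f: "f \<in> alg_hom R B C" and x: "x \<in> carrier (pts B)"
    and y: "\<And>h. h \<in> carrier G \<Longrightarrow> y h = f (x h)" and h: "h \<in> carrier G"
  shows "tensor_lift R (tensor R C G0) (\<lambda>b. tensor_inl R C G0 (f b)) (tensor_inr R C G0) (univ_conj R G G0 \<iota> B x h)
    = univ_conj R G G0 \<iota> C y h"
proof -
  interpret BT: tensor_product R B G0 by (rule tensor_productI[OF B])
  interpret CT: tensor_product R C G0 by (rule tensor_productI[OF C])
  have xl: "(\<lambda>b. CT.inl (f b)) \<in> alg_hom R B CT.T" by (rule alg_hom_compose[OF f CT.inl_hom])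
  note l = CT.algebra_T xl CT.inr_hom
  let ?l = "tensor_lift R CT.T (\<lambda>b. CT.inl (f b)) CT.inr"
  have "compose (carrier G) ?l (univ_conj R G G0 \<iota> B x)
    = pt_conj R G CT.T (compose (carrier G) ?l (\<lambda>h \<in> carrier G. BT.inr (\<iota> h)))
        (compose (carrier G) ?l (\<lambda>h \<in> carrier G. BT.inl (x h)))"
    unfolding univ_conj_def
    by (rule pt_conj_natural[OF BT.algebra_T CT.algebra_T BT.lift_hom[OF l] univ_pt_closed[OF B] inl_pt_closed[OF B x]])
  also have "compose (carrier G) ?l (\<lambda>h \<in> carrier G. BT.inr (\<iota> h)) = (\<lambda>h \<in> carrier G. CT.inr (\<iota> h))"
    unfolding compose_def by (rule restrict_ext) (simp add: BT.lift_inr[OF l] alg_hom_closed[OF \<iota>_hom])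
  also have "compose (carrier G) ?l (\<lambda>h \<in> carrier G. BT.inl (x h)) = (\<lambda>h \<in> carrier G. CT.inl (y h))"
    unfolding compose_def by (rule restrict_ext) (simp add: BT.lift_inl[OF l] alg_hom_closed[OF pts_hom[OF x]] y)
  finally have "compose (carrier G) ?l (univ_conj R G G0 \<iota> B x) = univ_conj R G G0 \<iota> C y"
    unfolding univ_conj_def .
  from fun_cong[OF this, of h] h show ?thesis by (simp add: compose_def)
qed

text \<open>Under the passage from \<open>B \<otimes> O(G0)\<close> to \<open>B[M]\<close> the
  universal point of \<open>G0\<close> becomes the tautological character of \<open>M\<close> in
  \<open>B[M]\<close>.\<close>

lemma weights_conj:
  assumes B: "algebra R B" and x: "x \<in> carrier (pts B)"
  shows "compose (carrier G) (weights B) (univ_conj R G G0 \<iota> B x)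
    = pt_conj R G (alg_monoid B M) (gpt (alg_monoid B M) (monom_at B)) (compose (carrier G) (mconst B M) x)"
proof -
  interpret BM: algebra_monoid R B M by (rule algebra_monoidI[OF B])
  interpret BT: tensor_product R B G0 by (rule tensor_productI[OF B])
  have "compose (carrier G) (weights B) (univ_conj R G G0 \<iota> B x)
    = pt_conj R G BM.AM (compose (carrier G) (weights B) (\<lambda>h \<in> carrier G. BT.inr (\<iota> h)))
        (compose (carrier G) (weights B) (\<lambda>h \<in> carrier G. BT.inl (x h)))"
    unfolding univ_conj_def
    by (rule pt_conj_natural[OF BT.algebra_T BM.algebra_AM weights_hom[OF B] univ_pt_closed[OF B] inl_pt_closed[OF B x]])
  also have "compose (carrier G) (weights B) (\<lambda>h \<in> carrier G. BT.inr (\<iota> h)) = gpt BM.AM (monom_at B)"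
    unfolding compose_def gpt_def by (rule restrict_ext) (simp add: weights_inr[OF B] alg_hom_closed[OF \<iota>_hom])
  also have "compose (carrier G) (weights B) (\<lambda>h \<in> carrier G. BT.inl (x h)) = compose (carrier G) (mconst B M) x"
    unfolding compose_def by (rule restrict_ext) (simp add: weights_inl[OF B] alg_hom_closed[OF pts_hom[OF x]])
  finally show ?thesis .
qed

text \<open>Conjugation is an action. Expanding \<open>(t s) x (t s)\<^sup>-\<^sup>1 = t (s x s\<^sup>-\<^sup>1) t\<^sup>-\<^sup>1\<close> in powers of \<open>t\<close> for two
  independent universal points \<open>s\<close>, \<open>t\<close>, i.e. in \<open>B[M][M]\<close>, and comparing the coefficients of \<open>t\<^sup>0\<close> shows
  that the weight zero component is invariant under \<open>s\<close>.\<close>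

lemma reynolds_gpow:
  fixes I :: "'i set"
  defines "B \<equiv> gpow R G I"
  defines "\<delta> \<equiv> gpow_eval R (tensor R B G0) (\<lambda>i. univ_conj R G G0 \<iota> B (gpow_pt R G I i))"
  assumes b: "b \<in> carrier B"
  shows "\<delta> (reynolds B \<delta> b) = tensor_inl R B G0 (reynolds B \<delta> b)"
proof -
  interpret pow: group_scheme_power R G I by unfold_locales
  have B: "algebra R B" unfolding B_def by (rule pow.algebra_OG)
  interpret BM: algebra_monoid R B M by (rule algebra_monoidI[OF B])
  interpret BMM: algebra_monoid R BM.AM M by (rule algebra_monoidI[OF BM.algebra_AM])
  interpret BT: tensor_product R B G0 by (rule tensor_productI[OF B])
  have pr: "gpow_pt R G I i \<in> carrier (pts B)" if "i \<in> I" for i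
    unfolding B_def by (rule pow.pr_closed[OF that])
  note cj = univ_conj_closed[OF B pr]
  have \<delta>: "\<delta> \<in> alg_hom R B BT.T"
    using pow.eval_hom[OF BT.algebra_T pts_hom[OF cj]] unfolding \<delta>_def B_def .
  have \<delta>_pr: "\<delta> (gpow_pt R G I i h) = univ_conj R G G0 \<iota> B (gpow_pt R G I i) h" if "i \<in> I" "h \<in> carrier G" for i h
    unfolding \<delta>_def B_def
    by (rule pow.eval_pr[OF BT.algebra_T[unfolded B_def] _ that]) (rule pts_hom[OF cj[unfolded B_def]])
  \<comment> \<open>\<open>D\<close> expands the coaction in powers of the universal torus
    point.\<close>
  define D where "D = (\<lambda>b. weights B (\<delta> b))"
  have D: "D \<in> alg_hom R B BM.AM" unfolding D_def by (rule alg_hom_compose[OF \<delta> weights_hom[OF B]])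
  \<comment> \<open>In \<open>B[M][M]\<close> the outer monomials are powers of \<open>t\<close>,
    the inner ones powers of \<open>s\<close>. If \<open>D b\<close> is the sum of the terms
    \<open>b_m t^m\<close>, then \<open>?\<alpha>\<close> turns it into the sum of
    \<open>D(b_m) t^m\<close> with \<open>D\<close> expanded in \<open>s\<close>, and
    \<open>?\<beta>\<close> into the sum of \<open>b_m s^m t^m\<close>.\<close>
  let ?\<sigma>\<alpha> = "\<lambda>b. mconst BM.AM M (D b)" and ?\<mu>\<alpha> = "monom_at BM.AM"
  let ?\<sigma>\<beta> = "\<lambda>b. mconst BM.AM M (mconst B M b)"
  let ?s = "\<lambda>m. mconst BM.AM M (monom_at B m)"
  let ?\<mu>\<beta> = "\<lambda>m. ?\<mu>\<alpha> m \<otimes>\<^bsub>BMM.AM\<^esub> ?s m"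
  let ?\<alpha> = "meval B BMM.AM ?\<sigma>\<alpha> ?\<mu>\<alpha>" and ?\<beta> = "meval B BMM.AM ?\<sigma>\<beta> ?\<mu>\<beta>"
  have \<sigma>\<alpha>: "?\<sigma>\<alpha> \<in> alg_hom R B BMM.AM" by (rule alg_hom_compose[OF D BMM.mconst_alg_hom])
  have \<sigma>\<beta>: "?\<sigma>\<beta> \<in> alg_hom R B BMM.AM" by (rule alg_hom_compose[OF BM.mconst_alg_hom BMM.mconst_alg_hom])
  have s: "is_char M BMM.AM ?s" by (rule is_char_compose[OF BM.monom_char BMM.mconst_alg_hom])
  have \<mu>\<beta>: "is_char M BMM.AM ?\<mu>\<beta>" by (rule is_char_mult[OF BMM.AM_cring BMM.monom_char s])
  note \<alpha>s = BMM.algebra_AM \<sigma>\<alpha> BMM.monom_char and \<beta>s = BMM.algebra_AM \<sigma>\<beta> \<mu>\<beta>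
  note \<alpha> = BM.meval_alg_hom[OF \<alpha>s] and \<beta> = BM.meval_alg_hom[OF \<beta>s]
  have "?\<alpha> (D b) = ?\<beta> (D b)"
  proof (rule pow.hom_eqI[folded B_def, OF alg_hom_compose[OF D \<alpha>] alg_hom_compose[OF D \<beta>] _ b])
    \<comment> \<open>On the coordinates of the \<open>i\<close>-th projection \<open>x\<close>,
      both sides compute a conjugate of \<open>x\<close>: by \<open>s\<close> and then by
      \<open>t\<close> for \<open>?\<alpha>\<close>, by the product of \<open>t\<close> and
      \<open>s\<close> for \<open>?\<beta>\<close>.\<close>
    fix i h assume i: "i \<in> I" and h: "h \<in> carrier G"
    let ?x = "gpow_pt R G I i" and ?t = "gpt BM.AM (monom_at B)" and ?c = "compose (carrier G)"
    have x: "?x \<in> carrier (pts B)" by (rule pr[OF i])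
    have cx: "?c (mconst B M) ?x \<in> carrier (pts BM.AM)"
      by (rule pts_compose_closed[OF pts_hom[OF x] BM.mconst_alg_hom])
    have t: "?t \<in> carrier (pts BM.AM)" by (rule gpt_closed[OF BM.algebra_AM BM.monom_char])
    have Dx: "?c D ?x = pt_conj R G BM.AM ?t (?c (mconst B M) ?x)"
      unfolding weights_conj[OF B x, symmetric] unfolding compose_def by (rule restrict_ext) (simp add: D_def \<delta>_pr[OF i])
    have z: "?c ?\<sigma>\<beta> ?x \<in> carrier (pts BMM.AM)"
      by (rule pts_compose_closed[OF pts_hom[OF x] \<sigma>\<beta>])
    have "?c ?\<alpha> (?c D ?x) = pt_conj R G BMM.AM (?c ?\<alpha> ?t) (?c ?\<alpha> (?c (mconst B M) ?x))"
      unfolding Dx by (rule pt_conj_natural[OF BM.algebra_AM BMM.algebra_AM \<alpha> t cx])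
    also have "?c ?\<alpha> ?t = gpt BMM.AM ?\<mu>\<alpha>"
      by (rule gpt_natural[OF BM.algebra_AM BM.monom_char BMM.algebra_AM \<alpha>]) (simp add: BM.meval_monom[OF \<alpha>s])
    also have "?c ?\<alpha> (?c (mconst B M) ?x) = ?c (mconst BM.AM M) (?c D ?x)"
      unfolding compose_def by (rule restrict_ext) (simp add: BM.meval_mconst[OF \<alpha>s] alg_hom_closed[OF pts_hom[OF x]])
    also have "\<dots> = pt_conj R G BMM.AM (?c (mconst BM.AM M) ?t) (?c (mconst BM.AM M) (?c (mconst B M) ?x))"
      unfolding Dx by (rule pt_conj_natural[OF BM.algebra_AM BMM.algebra_AM BMM.mconst_alg_hom t cx])
    also have "?c (mconst BM.AM M) ?t = gpt BMM.AM ?s"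
      by (rule gpt_natural[OF BM.algebra_AM BM.monom_char BMM.algebra_AM BMM.mconst_alg_hom]) simp
    also have "?c (mconst BM.AM M) (?c (mconst B M) ?x) = ?c ?\<sigma>\<beta> ?x"
      unfolding compose_def by (rule restrict_ext) simp
    also have "pt_conj R G BMM.AM (gpt BMM.AM ?\<mu>\<alpha>) (pt_conj R G BMM.AM (gpt BMM.AM ?s) (?c ?\<sigma>\<beta> ?x))
        = pt_conj R G BMM.AM (gpt BMM.AM ?\<mu>\<beta>) (?c ?\<sigma>\<beta> ?x)"
      unfolding gpt_mult[OF BMM.algebra_AM BMM.monom_char s, symmetric]
      by (rule pt_conj_conj[OF BMM.algebra_AM gpt_closed[OF BMM.algebra_AM BMM.monom_char] gpt_closed[OF BMM.algebra_AM s] z, symmetric])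
    also have "gpt BMM.AM ?\<mu>\<beta> = ?c ?\<beta> ?t"
      by (rule gpt_natural[OF BM.algebra_AM BM.monom_char BMM.algebra_AM \<beta>, symmetric]) (simp add: BM.meval_monom[OF \<beta>s])
    also have "?c ?\<sigma>\<beta> ?x = ?c ?\<beta> (?c (mconst B M) ?x)"
      unfolding compose_def by (rule restrict_ext) (simp add: BM.meval_mconst[OF \<beta>s] alg_hom_closed[OF pts_hom[OF x]])
    also have "pt_conj R G BMM.AM (?c ?\<beta> ?t) (?c ?\<beta> (?c (mconst B M) ?x)) = ?c ?\<beta> (?c D ?x)"
      unfolding Dx by (rule pt_conj_natural[OF BM.algebra_AM BMM.algebra_AM \<beta> t cx, symmetric])
    finally have "?c ?\<alpha> (?c D ?x) h = ?c ?\<beta> (?c D ?x) h" by simp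
    with h show "?\<alpha> (D (?x h)) = ?\<beta> (D (?x h))" by (simp add: compose_def)
  qed
  moreover have "?\<alpha> (D b) \<one>\<^bsub>M\<^esub> = D (D b \<one>\<^bsub>M\<^esub>)"
  proof (rule BM.coeff_one_hom[OF BM.algebra_AM \<alpha> D _ alg_hom_closed[OF D b]])
    fix a m assume am: "a \<in> carrier B" "m \<in> carrier M"
    have "?\<alpha> (BM.term_at a m) = BMM.term_at (D a) m"
      using am by (simp add: BM.meval_term[OF \<alpha>s] BMM.mconst_monom alg_hom_closed[OF D])
    then show "?\<alpha> (BM.term_at a m) \<one>\<^bsub>M\<^esub> = (if m = \<one>\<^bsub>M\<^esub> then D a else \<zero>\<^bsub>BM.AM\<^esub>)"
      by (simp add: BMM.term_at_def)
  qed
  moreover have "?\<beta> (D b) \<one>\<^bsub>M\<^esub> = mconst B M (D b \<one>\<^bsub>M\<^esub>)"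
  proof (rule BM.coeff_one_hom[OF BM.algebra_AM \<beta> BM.mconst_alg_hom _ alg_hom_closed[OF D b]])
    fix a m assume am: "a \<in> carrier B" "m \<in> carrier M"
    interpret BMMr: cring BMM.AM by (rule BMM.AM_cring)
    have cl: "mconst B M a \<in> carrier BM.AM" "monom_at B m \<in> carrier BM.AM"
      using am by (auto simp: BM.monom_closed intro: alg_hom_closed[OF BM.mconst_alg_hom])
    have cl': "?\<sigma>\<beta> a \<in> carrier BMM.AM" "?s m \<in> carrier BMM.AM" "?\<mu>\<alpha> m \<in> carrier BMM.AM"
      using am cl by (auto simp: BMM.monom_closed intro: alg_hom_closed[OF BMM.mconst_alg_hom])
    have "?\<beta> (BM.term_at a m) = ?\<sigma>\<beta> a \<otimes>\<^bsub>BMM.AM\<^esub> (?\<mu>\<alpha> m \<otimes>\<^bsub>BMM.AM\<^esub> ?s m)"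
      using am by (simp add: BM.meval_term[OF \<beta>s])
    also have "\<dots> = (?\<sigma>\<beta> a \<otimes>\<^bsub>BMM.AM\<^esub> ?s m) \<otimes>\<^bsub>BMM.AM\<^esub> ?\<mu>\<alpha> m"
      using cl' by (simp add: BMMr.m_assoc BMMr.m_comm[of "?s m"])
    also have "?\<sigma>\<beta> a \<otimes>\<^bsub>BMM.AM\<^esub> ?s m = mconst BM.AM M (BM.term_at a m)"
      using cl am alg_hom_mult[OF BMM.mconst_alg_hom cl] by (simp add: BM.mconst_monom)
    also have "mconst BM.AM M (BM.term_at a m) \<otimes>\<^bsub>BMM.AM\<^esub> ?\<mu>\<alpha> m = BMM.term_at (BM.term_at a m) m"
      using am by (intro BMM.mconst_monom) (simp_all add: BM.AM_simps)
    finally show "?\<beta> (BM.term_at a m) \<one>\<^bsub>M\<^esub> = (if m = \<one>\<^bsub>M\<^esub> then mconst B M a else \<zero>\<^bsub>BM.AM\<^esub>)"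
      by (simp add: BMM.term_at_def BM.mconst_eq)
  qed
  \<comment> \<open>The coefficients of \<open>t^0\<close> agree; since \<open>weights B\<close> is
    injective, this is coinvariance.\<close>
  ultimately have "weights B (\<delta> (reynolds B \<delta> b)) = mconst B M (reynolds B \<delta> b)"
    by (simp add: reynolds_def D_def)
  moreover have "reynolds B \<delta> b \<in> carrier B"
    by (rule reynolds_closed[where \<delta> = \<delta>, OF B alg_hom_closed[OF \<delta> b]])
  ultimately show ?thesis
    using weights_inj[OF B alg_hom_closed[OF \<delta>] alg_hom_closed[OF BT.inl_hom]] weights_inl[OF B] by simp
qed

end

section \<open>The representation scheme\<close>

locale representation_scheme = group_scheme R G + \<Gamma>: group \<Gamma>
  for R :: "('k, 'm) ring_scheme" and G :: "('k, 'h, 's) hopf_scheme" and \<Gamma> :: "('g, 'u) monoid_scheme"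
begin

abbreviation "Rep \<equiv> rep_alg R G \<Gamma>"
abbreviation "\<rho> \<equiv> univ_rep R G \<Gamma>"

text \<open>Removes the restriction of points to \<open>carrier G\<close>. What remains are
  homomorphism conditions and equations between elements of \<open>T\<close>, the form in which
  reflection can be tested.\<close>

lemma rep_cond_iff:
  assumes T: "algebra R T"
  shows "rep_cond R G \<Gamma> T t \<longleftrightarrow>
    (\<forall>\<gamma> \<in> carrier \<Gamma>. (\<lambda>h. t (\<gamma>, h)) \<in> alg_hom R G T) \<and>
    (\<forall>\<gamma> \<in> carrier \<Gamma>. \<forall>\<gamma>' \<in> carrier \<Gamma>. \<forall>h \<in> carrier G.
      t (\<gamma> \<otimes>\<^bsub>\<Gamma>\<^esub> \<gamma>', h) = pt_mult R G T (\<lambda>h. t (\<gamma>, h)) (\<lambda>h. t (\<gamma>', h)) h)"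
proof -
  have 1: "(\<lambda>h \<in> carrier G. t (\<gamma>, h)) \<in> carrier (pts T) \<longleftrightarrow> (\<lambda>h. t (\<gamma>, h)) \<in> alg_hom R G T" for \<gamma>
  proof
    assume "(\<lambda>h \<in> carrier G. t (\<gamma>, h)) \<in> carrier (pts T)"
    from pts_hom[OF this] show "(\<lambda>h. t (\<gamma>, h)) \<in> alg_hom R G T"
      by (rule alg_hom_cong[OF _ algebra_G]) simp
  qed (rule restrict_pts)
  have 2: "(\<lambda>h \<in> carrier G. t (\<gamma>'', h)) = pt_mult R G T (\<lambda>h \<in> carrier G. t (\<gamma>, h)) (\<lambda>h \<in> carrier G. t (\<gamma>', h)) \<longleftrightarrow>
      (\<forall>h \<in> carrier G. t (\<gamma>'', h) = pt_mult R G T (\<lambda>h. t (\<gamma>, h)) (\<lambda>h. t (\<gamma>', h)) h)"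
    if h: "(\<lambda>h. t (\<gamma>, h)) \<in> alg_hom R G T" "(\<lambda>h. t (\<gamma>', h)) \<in> alg_hom R G T" for \<gamma> \<gamma>' \<gamma>''
  proof -
    have e: "pt_mult R G T (\<lambda>h \<in> carrier G. t (\<gamma>, h)) (\<lambda>h \<in> carrier G. t (\<gamma>', h))
        = pt_mult R G T (\<lambda>h. t (\<gamma>, h)) (\<lambda>h. t (\<gamma>', h))"
      by (rule pt_mult_cong[OF T h]) simp_all
    show ?thesis unfolding e by (auto simp: fun_eq_iff pt_mult_def restrict_def)
  qed
  show ?thesis
    unfolding rep_cond_def hom_def Pi_def mem_Collect_eq 1 pts_mult
    using 2 by meson
qed

lemma reflect:
  assumes je: "jointly_embeds R (carrier \<Gamma> \<times> carrier G) T t J C \<phi> s" and c: "\<And>j. j \<in> J \<Longrightarrow> rep_cond R G \<Gamma> (C j) (s j)"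
  shows "rep_cond R G \<Gamma> T t"
proof -
  note D = jointly_embedsD[OF je]
  have s: "(\<lambda>h. s j (\<gamma>, h)) \<in> alg_hom R G (C j)" if "j \<in> J" "\<gamma> \<in> carrier \<Gamma>" for j \<gamma>
    using c[OF that(1)] that(2) unfolding rep_cond_iff[OF D(3)[OF that(1)]] by blast
  have t: "(\<lambda>h. t (\<gamma>, h)) \<in> alg_hom R G T" if "\<gamma> \<in> carrier \<Gamma>" for \<gamma>
    using that by (intro alg_hom_reflect[OF je algebra_G, of "Pair \<gamma>"] s) simp_all
  have "t (\<gamma> \<otimes>\<^bsub>\<Gamma>\<^esub> \<gamma>', h) = pt_mult R G T (\<lambda>h. t (\<gamma>, h)) (\<lambda>h. t (\<gamma>', h)) h"
    if g: "\<gamma> \<in> carrier \<Gamma>" "\<gamma>' \<in> carrier \<Gamma>" and h: "h \<in> carrier G" for \<gamma> \<gamma>' h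
  proof (rule jointly_embeds_eqI[OF je])
    show "t (\<gamma> \<otimes>\<^bsub>\<Gamma>\<^esub> \<gamma>', h) \<in> carrier T" using g h by (intro D(2)) simp
    show "pt_mult R G T (\<lambda>h. t (\<gamma>, h)) (\<lambda>h. t (\<gamma>', h)) h \<in> carrier T"
      by (rule alg_hom_closed[OF pts_hom[OF pt_mult_closed[OF D(1) t[OF g(1)] t[OF g(2)]]] h])
    fix j assume j: "j \<in> J"
    have "\<phi> j (pt_mult R G T (\<lambda>h. t (\<gamma>, h)) (\<lambda>h. t (\<gamma>', h)) h)
        = pt_mult R G (C j) (\<lambda>h. s j (\<gamma>, h)) (\<lambda>h. s j (\<gamma>', h)) h"
      by (rule pt_mult_natural[OF D(1) t[OF g(1)] t[OF g(2)] D(3)[OF j] D(4)[OF j] h])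
        (simp_all add: D(5)[OF j] g)
    also have "\<dots> = s j (\<gamma> \<otimes>\<^bsub>\<Gamma>\<^esub> \<gamma>', h)"
      using c[OF j] g h unfolding rep_cond_iff[OF D(3)[OF j]] by simp
    finally show "\<phi> j (t (\<gamma> \<otimes>\<^bsub>\<Gamma>\<^esub> \<gamma>', h)) = \<phi> j (pt_mult R G T (\<lambda>h. t (\<gamma>, h)) (\<lambda>h. t (\<gamma>', h)) h)"
      using g h by (simp add: D(5)[OF j])
  qed
  with t show ?thesis unfolding rep_cond_iff[OF D(1)] by blast
qed

sublocale univ: univ_algebra R "carrier \<Gamma> \<times> carrier G" "rep_cond R G \<Gamma>"
proof (rule univ_algebra.intro)
  show "univ_reflects R (carrier \<Gamma> \<times> carrier G) (rep_cond R G \<Gamma>)"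
    unfolding univ_reflects_def using reflect by blast
qed (rule cring_R)

lemma algebra_Rep: "algebra R Rep"
  unfolding rep_alg_def by (rule univ.algebra_univ)

lemma \<rho>_hom: "\<rho> \<in> hom \<Gamma> (pts Rep)"
  using univ.gen_cond unfolding rep_cond_def rep_alg_def univ_rep_def[abs_def] .

lemma \<rho>_closed: "\<gamma> \<in> carrier \<Gamma> \<Longrightarrow> \<rho> \<gamma> \<in> carrier (pts Rep)"
  using \<rho>_hom by (auto simp: hom_def)

lemma \<rho>_mult: "\<gamma> \<in> carrier \<Gamma> \<Longrightarrow> \<gamma>' \<in> carrier \<Gamma> \<Longrightarrow> \<rho> (\<gamma> \<otimes>\<^bsub>\<Gamma>\<^esub> \<gamma>') = pt_mult R G Rep (\<rho> \<gamma>) (\<rho> \<gamma>')"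
  using \<rho>_hom by (simp add: hom_def pts_mult)

lemma
  fixes C :: "('k, 'c) module"
  assumes C: "algebra R C" and x: "\<And>\<gamma>. \<gamma> \<in> carrier \<Gamma> \<Longrightarrow> x \<gamma> \<in> carrier (pts C)"
    and m: "\<And>\<gamma> \<gamma>'. \<gamma> \<in> carrier \<Gamma> \<Longrightarrow> \<gamma>' \<in> carrier \<Gamma> \<Longrightarrow> x (\<gamma> \<otimes>\<^bsub>\<Gamma>\<^esub> \<gamma>') = pt_mult R G C (x \<gamma>) (x \<gamma>')"
  shows classify_hom: "rep_classify R C x \<in> alg_hom R Rep C"
    and classify_\<rho>: "\<gamma> \<in> carrier \<Gamma> \<Longrightarrow> h \<in> carrier G \<Longrightarrow> rep_classify R C x (\<rho> \<gamma> h) = x \<gamma> h"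
proof -
  have v: "(\<lambda>(\<gamma>, h). x \<gamma> h) z \<in> carrier C" if "z \<in> carrier \<Gamma> \<times> carrier G" for z
    using that x by (auto intro: alg_hom_closed[OF pts_hom])
  have c: "rep_cond R G \<Gamma> C (\<lambda>(\<gamma>, h). x \<gamma> h)"
    unfolding rep_cond_iff[OF C] using x m by (simp add: pts_hom)
  note l = univ.lift_alg_hom[OF C v reflect[OF _ c] refl] univ.lift_gen[OF C v reflect[OF _ c] refl]
  show "rep_classify R C x \<in> alg_hom R Rep C"
    unfolding rep_classify_def rep_alg_def using l(1) .
  show "\<gamma> \<in> carrier \<Gamma> \<Longrightarrow> h \<in> carrier G \<Longrightarrow> rep_classify R C x (\<rho> \<gamma> h) = x \<gamma> h"
    unfolding rep_classify_def univ_rep_def by (simp add: l(2))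
qed

end

section \<open>Substitutions and their equivariance\<close>

context group_scheme
begin

lemma powI: "group_scheme_power R G"
  by (rule group_scheme_power.intro) (rule group_scheme_axioms)

lemma
  assumes z: "\<zeta> \<in> {1..m} \<rightarrow> {1..n}"
  shows subst_hom: "pc_subst R G n \<zeta> \<in> alg_hom R (gpow R G {1..m}) (gpow R G {1..n})"
    and eval_subst: "algebra R C \<Longrightarrow> (\<And>i. i \<in> {1..n} \<Longrightarrow> y i \<in> alg_hom R G C) \<Longrightarrow> f \<in> carrier (gpow R G {1..m}) \<Longrightarrow>
      (\<And>i. i \<in> {1..m} \<Longrightarrow> y' i = y (\<zeta> i)) \<Longrightarrow> gpow_eval R C y (pc_subst R G n \<zeta> f) = gpow_eval R C y' f"
proof -
  interpret m: group_scheme_power R G "{1..m}" by (rule powI)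
  interpret n: group_scheme_power R G "{1..n}" by (rule powI)
  have p: "n.pr (\<zeta> i) \<in> alg_hom R G n.OG" if "i \<in> {1..m}" for i
    using that z by (intro pts_hom[OF n.pr_closed]) auto
  show "pc_subst R G n \<zeta> \<in> alg_hom R m.OG n.OG"
    unfolding pc_subst_def by (rule m.eval_hom[OF n.algebra_OG p])
  assume C: "algebra R C" and y: "\<And>i. i \<in> {1..n} \<Longrightarrow> y i \<in> alg_hom R G C" and f: "f \<in> carrier m.OG"
    and y': "\<And>i. i \<in> {1..m} \<Longrightarrow> y' i = y (\<zeta> i)"
  have "y' i h = gpow_eval R C y (n.pr (\<zeta> i) h)" if "i \<in> {1..m}" "h \<in> carrier G" for i h
    using that z y' by (subst n.eval_pr[OF C y]) auto
  then show "gpow_eval R C y (pc_subst R G n \<zeta> f) = gpow_eval R C y' f"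
    unfolding pc_subst_def by (intro m.eval_natural[OF n.algebra_OG p C n.eval_hom[OF C y] f])
qed

lemma
  assumes n: "1 \<le> n"
  shows hat_hom: "pc_hat R G n \<in> alg_hom R (gpow R G {1..n}) (gpow R G {1..n + 1})"
    and eval_hat: "algebra R C \<Longrightarrow> (\<And>i. i \<in> {1..n + 1} \<Longrightarrow> y i \<in> alg_hom R G C) \<Longrightarrow> f \<in> carrier (gpow R G {1..n}) \<Longrightarrow>
      gpow_eval R C y (pc_hat R G n f) = gpow_eval R C (merge_last (pt_mult R G C) n y) f"
    and hat_pt_closed: "i \<in> {1..n} \<Longrightarrow>
      merge_last (pt_mult R G (gpow R G {1..n + 1})) n (gpow_pt R G {1..n + 1}) i \<in> carrier (pts (gpow R G {1..n + 1}))"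
proof -
  interpret m: group_scheme_power R G "{1..n}" by (rule powI)
  interpret n: group_scheme_power R G "{1..n + 1}" by (rule powI)
  have pr: "n.pr i \<in> alg_hom R G n.OG" if "i \<in> {1..n + 1}" for i
    by (rule pts_hom[OF n.pr_closed[OF that]])
  let ?x = "merge_last (pt_mult R G n.OG) n n.pr"
  have pm: "pt_mult R G n.OG (n.pr n) (n.pr (n + 1)) \<in> carrier (pts n.OG)"
    by (rule pt_mult_closed[OF n.algebra_OG pr pr]) (use n in auto)
  show x: "?x i \<in> carrier (pts n.OG)" if "i \<in> {1..n}" for i
    using that pm n.pr_closed[of i] by (auto simp: merge_last_def)
  show "pc_hat R G n \<in> alg_hom R m.OG n.OG"
    unfolding pc_hat_def Let_def by (rule m.eval_hom[OF n.algebra_OG pts_hom[OF x]])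
  assume C: "algebra R C" and y: "\<And>i. i \<in> {1..n + 1} \<Longrightarrow> y i \<in> alg_hom R G C" and f: "f \<in> carrier m.OG"
  have ep: "y i h = gpow_eval R C y (n.pr i h)" if "i \<in> {1..n + 1}" "h \<in> carrier G" for i h
    by (rule n.eval_pr[OF C y that, symmetric])
  have "merge_last (pt_mult R G C) n y i h = gpow_eval R C y (?x i h)" if i: "i \<in> {1..n}" and h: "h \<in> carrier G" for i h
  proof (cases "i = n")
    case True
    have "gpow_eval R C y (pt_mult R G n.OG (n.pr n) (n.pr (n + 1)) h) = pt_mult R G C (y n) (y (n + 1)) h"
      by (rule pt_mult_natural[OF n.algebra_OG pr pr C n.eval_hom[OF C y] h])
        (use n in simp, use n in simp, assumption, (rule ep, use n in simp, assumption)+)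
    with True n show ?thesis by (simp add: merge_last_def)
  next
    case False
    with i h ep[of i h] show ?thesis by (simp add: merge_last_def)
  qed
  then show "gpow_eval R C y (pc_hat R G n f) = gpow_eval R C (merge_last (pt_mult R G C) n y) f"
    unfolding pc_hat_def Let_def by (intro m.eval_natural[OF n.algebra_OG pts_hom[OF x] C n.eval_hom[OF C y] f])
qed

end

text \<open>The coinvariants are the equaliser of the two homomorphisms \<open>\<delta>\<close> and
  \<open>b \<mapsto> b \<otimes> 1\<close>.\<close>

lemma coinvariants_algebra:
  assumes B: "algebra R B" and C: "algebra R C" and d: "\<delta> \<in> alg_hom R B (tensor R B C)"
  shows "algebra R (coinvariants R B C \<delta>)"
proof -
  interpret B: algebra R B by fact
  interpret T: tensor_product R B C by (rule tensor_product.intro[OF B C])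
  let ?I = "coinvariants R B C \<delta>"
  have c: "b \<in> carrier ?I \<longleftrightarrow> b \<in> carrier B \<and> \<delta> b = T.inl b" for b
    by (simp add: coinvariants_def)
  have s: "mult ?I = mult B" "add ?I = add B" "one ?I = one B" "zero ?I = zero B" "smult ?I = smult B"
    by (simp_all add: coinvariants_def)
  note h = alg_hom_add[OF d] alg_hom_add[OF T.inl_hom] alg_hom_mult[OF d] alg_hom_mult[OF T.inl_hom]
    alg_hom_one[OF d] alg_hom_one[OF T.inl_hom] alg_hom_smult[OF d] alg_hom_smult[OF T.inl_hom]
    alg_hom_zero[OF d B T.algebra_T] alg_hom_zero[OF T.inl_hom B T.algebra_T]
  have "cring ?I"
  proof (rule cringI)
    show "abelian_group ?I"
    proof (rule abelian_groupI)
      fix x assume x: "x \<in> carrier ?I"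
      have "\<delta> (\<zero>\<^bsub>B\<^esub> \<ominus>\<^bsub>B\<^esub> x) = T.inl (\<zero>\<^bsub>B\<^esub> \<ominus>\<^bsub>B\<^esub> x)"
        using x by (simp add: c alg_hom_minus[OF d B T.algebra_T] alg_hom_minus[OF T.inl_hom B T.algebra_T] h)
      then have "\<zero>\<^bsub>B\<^esub> \<ominus>\<^bsub>B\<^esub> x \<in> carrier ?I" using x by (simp add: c algebra_minus_closed[OF B])
      moreover have "(\<zero>\<^bsub>B\<^esub> \<ominus>\<^bsub>B\<^esub> x) \<oplus>\<^bsub>?I\<^esub> x = \<zero>\<^bsub>?I\<^esub>"
        using x by (simp add: c s a_minus_def B.M.l_neg)
      ultimately show "\<exists>y \<in> carrier ?I. y \<oplus>\<^bsub>?I\<^esub> x = \<zero>\<^bsub>?I\<^esub>" by blast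
    qed (auto simp: c s h B.M.a_ac)
    show "comm_monoid ?I" by (rule comm_monoidI) (auto simp: c s h B.m_ac)
  qed (auto simp: c s B.l_distr)
  then show ?thesis
    by (intro algebraI B.R_cring)
      (auto simp: c s h B.smult_l_distr B.smult_r_distr B.smult_assoc1 B.smult_assoc2)
qed

section \<open>Compatibility of substitutions with invariants and the Reynolds operator\<close>

context torus_conjugation
begin

definition gpow_coact ("\<delta>") where
  "\<delta> I = gpow_eval R (tensor R (gpow R G I) G0) (\<lambda>i. univ_conj R G G0 \<iota> (gpow R G I) (gpow_pt R G I i))"

abbreviation "Inv I \<equiv> gpow_inv R G G0 \<iota> I"

definition "E I = reynolds (gpow R G I) (\<delta> I)"

lemma Inv_eq: "Inv I = coinvariants R (gpow R G I) G0 (\<delta> I)"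
  by (simp add: gpow_inv_def Let_def gpow_coact_def)

lemma Inv_carrier: "b \<in> carrier (Inv I) \<longleftrightarrow> b \<in> carrier (gpow R G I) \<and> \<delta> I b = tensor_inl R (gpow R G I) G0 b"
  by (simp add: Inv_eq coinvariants_def)

lemma Inv_simps:
  "mult (Inv I) = mult (gpow R G I)" "add (Inv I) = add (gpow R G I)" "one (Inv I) = one (gpow R G I)"
  "zero (Inv I) = zero (gpow R G I)" "smult (Inv I) = smult (gpow R G I)"
  by (simp_all add: Inv_eq coinvariants_def)

lemma gpow_algebra: "algebra R (gpow R G I)"
  by (rule group_scheme_power.algebra_OG[OF powI])

lemma gpow_pr: "i \<in> I \<Longrightarrow> gpow_pt R G I i \<in> carrier (pts (gpow R G I))"
  by (rule group_scheme_power.pr_closed[OF powI])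

lemma tensor_algebra: "algebra R B \<Longrightarrow> algebra R (tensor R B G0)"
  by (rule tensor_product.algebra_T[OF tensor_productI])

lemma coact_hom: "\<delta> I \<in> alg_hom R (gpow R G I) (tensor R (gpow R G I) G0)"
  unfolding gpow_coact_def
  by (rule group_scheme_power.eval_hom[OF powI tensor_algebra[OF gpow_algebra] pts_hom[OF univ_conj_closed[OF gpow_algebra gpow_pr]]])

lemma Inv_algebra: "algebra R (Inv I)"
  unfolding Inv_eq by (rule coinvariants_algebra[OF gpow_algebra T.algebra_G coact_hom])

lemma E_closed: "b \<in> carrier (gpow R G I) \<Longrightarrow> E I b \<in> carrier (Inv I)"
  unfolding Inv_carrier E_def
  using reynolds_gpow[of b I, folded gpow_coact_def]
    reynolds_closed[where \<delta> = "\<delta> I", OF gpow_algebra alg_hom_closed[OF coact_hom]] by blast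

lemma E_inv: "b \<in> carrier (Inv I) \<Longrightarrow> E I b = b"
  unfolding Inv_carrier E_def by (rule reynolds_coinvariant[OF gpow_algebra]) simp_all

lemma E_add:
  "a \<in> carrier (gpow R G I) \<Longrightarrow> b \<in> carrier (gpow R G I) \<Longrightarrow> E I (a \<oplus>\<^bsub>gpow R G I\<^esub> b) = E I a \<oplus>\<^bsub>gpow R G I\<^esub> E I b"
  unfolding E_def by (rule reynolds_add[OF gpow_algebra coact_hom])

text \<open>In terms of schemes: the morphism from \<open>Spec C\<close> to \<open>G\<close> given
  by \<open>y\<close> intertwines the action \<open>d\<close> with conjugation.\<close>

definition "equivariant C d y \<longleftrightarrow> (\<forall>h \<in> carrier G. d (y h) = univ_conj R G G0 \<iota> C y h)"

lemma equivariant_pr: "i \<in> I \<Longrightarrow> equivariant (gpow R G I) (\<delta> I) (gpow_pt R G I i)"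
  unfolding equivariant_def gpow_coact_def
  by (intro ballI group_scheme_power.eval_pr[OF powI] tensor_algebra gpow_algebra
      pts_hom[OF univ_conj_closed] gpow_pr)

lemma equivariant_mult:
  assumes C: "algebra R C" and d: "d \<in> alg_hom R C (tensor R C G0)"
    and x: "x \<in> carrier (pts C)" "equivariant C d x" and y: "y \<in> carrier (pts C)" "equivariant C d y"
  shows "equivariant C d (pt_mult R G C x y)"
  unfolding equivariant_def univ_conj_mult[OF C x(1) y(1)]
  using pt_mult_natural[OF C pts_hom[OF x(1)] pts_hom[OF y(1)] tensor_algebra[OF C] d] x(2) y(2)
  by (simp add: equivariant_def)

text \<open>A family of equivariant points is an equivariant morphism from \<open>Spec C\<close> to
  \<open>G^I\<close>. Its comorphism commutes with the coactions, hence with the Reynolds operators,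
  and maps invariants to invariants. Substitutions, the hat operation and the universal
  representation are all instances.\<close>

lemma
  assumes C: "algebra R C" and d: "d \<in> alg_hom R C (tensor R C G0)"
    and y: "\<And>i. i \<in> I \<Longrightarrow> y i \<in> carrier (pts C)" and e: "\<And>i. i \<in> I \<Longrightarrow> equivariant C d (y i)"
    and u: "u \<in> carrier (gpow R G I)"
  shows eval_reynolds: "reynolds C d (gpow_eval R C y u) = gpow_eval R C y (E I u)"
    and eval_Inv: "u \<in> carrier (Inv I) \<Longrightarrow> d (gpow_eval R C y u) = tensor_inl R C G0 (gpow_eval R C y u)"
proof -
  interpret I: group_scheme_power R G I by (rule powI)
  interpret BT: tensor_product R I.OG G0 by (rule tensor_productI[OF I.algebra_OG])
  interpret CT: tensor_product R C G0 by (rule tensor_productI[OF C])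
  let ?f = "gpow_eval R C y"
  have f: "?f \<in> alg_hom R I.OG C" by (rule I.eval_hom[OF C pts_hom[OF y]])
  have xl: "(\<lambda>b. CT.inl (?f b)) \<in> alg_hom R I.OG CT.T" by (rule alg_hom_compose[OF f CT.inl_hom])
  note l = CT.algebra_T xl CT.inr_hom
  have 1: "d (?f u) = tensor_lift R CT.T (\<lambda>b. CT.inl (?f b)) CT.inr (\<delta> I u)"
  proof (rule I.hom_eqI[OF alg_hom_compose[OF f d] alg_hom_compose[OF coact_hom BT.lift_hom[OF l]] _ u])
    fix i h assume i: "i \<in> I" and h: "h \<in> carrier G"
    have pr: "?f (I.pr i h) = y i h" if "h \<in> carrier G" for h
      by (rule I.eval_pr[OF C pts_hom[OF y] i that])
    have "\<delta> I (I.pr i h) = univ_conj R G G0 \<iota> I.OG (I.pr i) h"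
      using equivariant_pr[OF i] h by (simp add: equivariant_def)
    moreover have "tensor_lift R CT.T (\<lambda>b. CT.inl (?f b)) CT.inr (univ_conj R G G0 \<iota> I.OG (I.pr i) h)
        = univ_conj R G G0 \<iota> C (y i) h"
      by (rule univ_conj_natural[OF I.algebra_OG C f I.pr_closed[OF i] _ h]) (rule pr[symmetric])
    ultimately show "d (?f (I.pr i h)) = tensor_lift R CT.T (\<lambda>b. CT.inl (?f b)) CT.inr (\<delta> I (I.pr i h))"
      using e[OF i] h by (simp add: pr[OF h] equivariant_def)
  qed
  show "reynolds C d (?f u) = ?f (E I u)"
    unfolding E_def by (rule reynolds_natural[where \<delta> = "\<delta> I" and \<delta>' = d, OF I.algebra_OG C f alg_hom_closed[OF coact_hom u] 1])
  show "d (?f u) = CT.inl (?f u)" if "u \<in> carrier (Inv I)"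
    using that u unfolding 1 Inv_carrier by (simp add: BT.lift_inl[OF l])
qed

lemma
  assumes z: "\<zeta> \<in> {1..m} \<rightarrow> {1..n}" and u: "u \<in> carrier (gpow R G {1..m})"
  shows subst_Inv: "u \<in> carrier (Inv {1..m}) \<Longrightarrow> pc_subst R G n \<zeta> u \<in> carrier (Inv {1..n})"
    and subst_E: "pc_subst R G n \<zeta> (E {1..m} u) = E {1..n} (pc_subst R G n \<zeta> u)"
proof -
  have y: "gpow_pt R G {1..n} (\<zeta> i) \<in> carrier (pts (gpow R G {1..n}))"
    "equivariant (gpow R G {1..n}) (\<delta> {1..n}) (gpow_pt R G {1..n} (\<zeta> i))" if "i \<in> {1..m}" for i
    using that z by (auto intro!: gpow_pr equivariant_pr)
  note ev = gpow_algebra coact_hom y u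
  show "u \<in> carrier (Inv {1..m}) \<Longrightarrow> pc_subst R G n \<zeta> u \<in> carrier (Inv {1..n})"
    unfolding Inv_carrier[of _ "{1..n}"] using alg_hom_closed[OF subst_hom[OF z] u] eval_Inv[OF ev]
    by (simp add: pc_subst_def)
  show "pc_subst R G n \<zeta> (E {1..m} u) = E {1..n} (pc_subst R G n \<zeta> u)"
    unfolding E_def[of "{1..n}"] pc_subst_def by (rule eval_reynolds[OF ev, symmetric])
qed

text \<open>The coordinates are projections except the last one, a product of two projections. That
  product is equivariant because conjugation is multiplicative.\<close>

lemma
  assumes n: "1 \<le> n" and u: "u \<in> carrier (gpow R G {1..n})"
  shows hat_Inv: "u \<in> carrier (Inv {1..n}) \<Longrightarrow> pc_hat R G n u \<in> carrier (Inv {1..n + 1})"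
    and hat_E: "pc_hat R G n (E {1..n} u) = E {1..n + 1} (pc_hat R G n u)"
proof -
  let ?B = "gpow R G {1..n + 1}"
  let ?x = "merge_last (pt_mult R G ?B) n (gpow_pt R G {1..n + 1})"
  note x = hat_pt_closed[OF n]
  have e: "equivariant ?B (\<delta> {1..n + 1}) (?x i)" if i: "i \<in> {1..n}" for i
  proof (cases "i = n")
    case True
    have "equivariant ?B (\<delta> {1..n + 1}) (pt_mult R G ?B (gpow_pt R G {1..n + 1} n) (gpow_pt R G {1..n + 1} (n + 1)))"
      using n by (intro equivariant_mult gpow_algebra coact_hom gpow_pr equivariant_pr) auto
    with True n show ?thesis by (simp add: merge_last_def)
  next
    case False
    with i equivariant_pr[of i "{1..n + 1}"] show ?thesis by (simp add: merge_last_def)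
  qed
  note ev = gpow_algebra coact_hom x e u
  show "u \<in> carrier (Inv {1..n}) \<Longrightarrow> pc_hat R G n u \<in> carrier (Inv {1..n + 1})"
    unfolding Inv_carrier[of _ "{1..n + 1}"] using alg_hom_closed[OF hat_hom[OF n] u] eval_Inv[OF ev]
    by (simp add: pc_hat_def Let_def)
  show "pc_hat R G n (E {1..n} u) = E {1..n + 1} (pc_hat R G n u)"
    unfolding E_def[of "{1..n + 1}"] pc_hat_def Let_def by (rule eval_reynolds[OF ev, symmetric])
qed

end

section \<open>Pseudocharacters\<close>

text \<open>\<open>\<tau>\<close> enumerates the union of the values of both tuples without
  repetition, so each tuple is obtained from it by a substitution. The injectivity of
  \<open>\<tau>\<close> serves \<open>eval_F_inj\<close>.\<close>

lemma tuple_merge: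
  fixes n n' :: nat
  assumes g: "\<gamma> \<in> {1..n} \<rightarrow>\<^sub>E S" and g': "\<gamma>' \<in> {1..n'} \<rightarrow>\<^sub>E S" and n: "1 \<le> n"
  obtains N :: nat and \<tau> \<zeta> \<zeta>' where "1 \<le> N" "\<tau> \<in> {1..N} \<rightarrow>\<^sub>E S" "inj_on \<tau> {1..N}"
    "\<zeta> \<in> {1..n} \<rightarrow> {1..N}" "\<zeta>' \<in> {1..n'} \<rightarrow> {1..N}"
    "\<gamma> = (\<lambda>i \<in> {1..n}. \<tau> (\<zeta> i))" "\<gamma>' = (\<lambda>i \<in> {1..n'}. \<tau> (\<zeta>' i))"
proof -
  let ?U = "\<gamma> ` {1..n} \<union> \<gamma>' ` {1..n'}"
  obtain b where b: "bij_betw b {1..card ?U} ?U"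
    using ex_bij_betw_nat_finite_1[of ?U] by auto
  let ?N = "card ?U" and ?\<tau> = "restrict b {1..card ?U}"
  define \<zeta> where "\<zeta> = (\<lambda>i. inv_into {1..?N} b (\<gamma> i))"
  define \<zeta>' where "\<zeta>' = (\<lambda>i. inv_into {1..?N} b (\<gamma>' i))"
  have im: "b ` {1..?N} = ?U" using b by (simp add: bij_betw_def)
  have z: "\<zeta> i \<in> {1..?N}" "b (\<zeta> i) = \<gamma> i" if "i \<in> {1..n}" for i
  proof -
    have "\<gamma> i \<in> b ` {1..?N}" using that im by blast
    then show "\<zeta> i \<in> {1..?N}" "b (\<zeta> i) = \<gamma> i"
      unfolding \<zeta>_def by (simp_all only: inv_into_into f_inv_into_f)
  qed
  have z': "\<zeta>' i \<in> {1..?N}" "b (\<zeta>' i) = \<gamma>' i" if "i \<in> {1..n'}" for i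
  proof -
    have "\<gamma>' i \<in> b ` {1..?N}" using that im by blast
    then show "\<zeta>' i \<in> {1..?N}" "b (\<zeta>' i) = \<gamma>' i"
      unfolding \<zeta>'_def by (simp_all only: inv_into_into f_inv_into_f)
  qed
  show ?thesis
  proof (rule that[of ?N ?\<tau> \<zeta> \<zeta>'])
    \<comment> \<open>The first entry of \<open>\<gamma>\<close> makes the union nonempty.\<close>
    show "1 \<le> ?N" using z(1)[of 1] n by auto
    show "?\<tau> \<in> {1..?N} \<rightarrow>\<^sub>E S" 
    proof (rule restrict_PiE_iff[THEN iffD2], rule ballI)
      fix i assume "i \<in> {1..?N}"
      then have "b i \<in> ?U" using im by blast
      then show "b i \<in> S" using PiE_mem[OF g] PiE_mem[OF g'] by auto
    qed
    show "inj_on ?\<tau> {1..?N}" using b by (simp add: bij_betw_def inj_on_restrict_eq)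
    show "\<zeta> \<in> {1..n} \<rightarrow> {1..?N}" "\<zeta>' \<in> {1..n'} \<rightarrow> {1..?N}" using z(1) z'(1) by blast+
    show "\<gamma> = (\<lambda>i \<in> {1..n}. ?\<tau> (\<zeta> i))"
      using g z by (intro extensionalityI[of _ "{1..n}"]) (auto simp: PiE_def)
    show "\<gamma>' = (\<lambda>i \<in> {1..n'}. ?\<tau> (\<zeta>' i))"
      using g' z' by (intro extensionalityI[of _ "{1..n'}"]) (auto simp: PiE_def)
  qed
qed

locale pseudocharacters = torus_conjugation R G G0 M \<iota> \<phi> + \<Gamma>: group \<Gamma>
  for R :: "('k, 'm) ring_scheme" and G :: "('k, 'h, 's) hopf_scheme"
    and G0 :: "('k, 'h0, 't) hopf_scheme" and M :: "('n, 'u) monoid_scheme"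
    and \<iota> :: "'h \<Rightarrow> 'h0" and \<phi> :: "('n \<Rightarrow> 'k) \<Rightarrow> 'h0" and \<Gamma> :: "('g, 'v) monoid_scheme"
begin

sublocale rep: representation_scheme R G \<Gamma>
  by (intro representation_scheme.intro group_scheme_axioms \<Gamma>.group_axioms)

abbreviation tup :: "nat \<Rightarrow> (nat \<Rightarrow> 'g) set" where "tup n \<equiv> {1..n} \<rightarrow>\<^sub>E carrier \<Gamma>"
abbreviation pow :: "nat \<Rightarrow> ('k, ('k, nat \<times> 'h) univ) module" where "pow n \<equiv> gpow R G {1..n}"
abbreviation "X \<equiv> pc_vars R G G0 \<iota> \<Gamma>"
abbreviation "PCcond \<equiv> (\<lambda>T t. pseudocharacter R G G0 \<iota> \<Gamma> T (\<lambda>n f \<gamma>. t (n, f, \<gamma>)))"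
abbreviation "PC \<equiv> pc_alg R G G0 \<iota> \<Gamma>"

lemma X_iff: "(n, f, \<gamma>) \<in> X \<longleftrightarrow> 1 \<le> n \<and> f \<in> carrier (Inv {1..n}) \<and> \<gamma> \<in> tup n"
  by (simp add: pc_vars_def)

lemma tup_subst: "\<gamma> \<in> tup n \<Longrightarrow> \<zeta> \<in> {1..m} \<rightarrow> {1..n} \<Longrightarrow> (\<lambda>i \<in> {1..m}. \<gamma> (\<zeta> i)) \<in> tup m"
  by (auto simp: PiE_def Pi_def)

lemma tup_merge: "\<gamma> \<in> tup (n + 1) \<Longrightarrow> merge_last (mult \<Gamma>) n \<gamma> \<in> tup n"
  by (auto simp: PiE_def Pi_def merge_last_def)

lemma Inv_gpow: "f \<in> carrier (Inv I) \<Longrightarrow> f \<in> carrier (gpow R G I)"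
  by (simp add: Inv_carrier)

lemma alg_hom_Inv: "f \<in> alg_hom R (gpow R G I) C \<Longrightarrow> f \<in> alg_hom R (Inv I) C"
  by (auto simp: alg_hom_def ring_hom_def Inv_simps Inv_gpow)

text \<open>The substitution and multiplicativity axioms equate two generators each.
  \<open>subst_Inv\<close> and \<open>hat_Inv\<close> ensure that the transformed functions are
  invariant, so that the indices on the left lie in \<open>X\<close>.\<close>

lemma pc_reflect:
  assumes je: "jointly_embeds R X T t J C \<phi>' s"
    and c: "\<And>j. j \<in> J \<Longrightarrow> pseudocharacter R G G0 \<iota> \<Gamma> (C j) (\<lambda>n f \<gamma>. s j (n, f, \<gamma>))"
  shows "pseudocharacter R G G0 \<iota> \<Gamma> T (\<lambda>n f \<gamma>. t (n, f, \<gamma>))"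
  unfolding pseudocharacter_def
proof (intro conjI allI impI ballI)
  fix n \<gamma> assume n: "1 \<le> (n::nat)" and g: "\<gamma> \<in> tup n"
  show "(\<lambda>f. t (n, f, \<gamma>)) \<in> alg_hom R (Inv {1..n}) T"
  proof (rule alg_hom_reflect[where e = "\<lambda>f. (n, f, \<gamma>)", OF je Inv_algebra])
    show "(n, f, \<gamma>) \<in> X" if "f \<in> carrier (Inv {1..n})" for f using that n g by (simp add: X_iff)
    show "(\<lambda>f. s j (n, f, \<gamma>)) \<in> alg_hom R (Inv {1..n}) (C j)" if "j \<in> J" for j
      using c[OF that] n g unfolding pseudocharacter_def by blast
  qed
next
  note D = jointly_embedsD[OF je]
  fix m n \<zeta> f \<gamma> assume m: "1 \<le> (m::nat)" and n: "1 \<le> (n::nat)" and z: "\<zeta> \<in> {1..m} \<rightarrow> {1..n}"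
    and f: "f \<in> carrier (Inv {1..m})" and g: "\<gamma> \<in> tup n"
  have x1: "(n, pc_subst R G n \<zeta> f, \<gamma>) \<in> X" and x2: "(m, f, \<lambda>i \<in> {1..m}. \<gamma> (\<zeta> i)) \<in> X"
    unfolding X_iff using n m f g subst_Inv[OF z Inv_gpow[OF f] f] tup_subst[OF g z] by blast+
  show "t (n, pc_subst R G n \<zeta> f, \<gamma>) = t (m, f, \<lambda>i \<in> {1..m}. \<gamma> (\<zeta> i))"
  proof (rule jointly_embeds_eqI[OF je D(2)[OF x1] D(2)[OF x2]])
    fix j assume j: "j \<in> J"
    have "s j (n, pc_subst R G n \<zeta> f, \<gamma>) = s j (m, f, \<lambda>i \<in> {1..m}. \<gamma> (\<zeta> i))"
      using c[OF j] m n z f g unfolding pseudocharacter_def by blast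
    then show "\<phi>' j (t (n, pc_subst R G n \<zeta> f, \<gamma>)) = \<phi>' j (t (m, f, \<lambda>i \<in> {1..m}. \<gamma> (\<zeta> i)))"
      unfolding D(5)[OF j x1] D(5)[OF j x2] .
  qed
next
  note D = jointly_embedsD[OF je]
  fix n f \<gamma> assume n: "1 \<le> (n::nat)" and f: "f \<in> carrier (Inv {1..n})" and g: "\<gamma> \<in> tup (n + 1)"
  have x1: "(n + 1, pc_hat R G n f, \<gamma>) \<in> X" and x2: "(n, f, merge_last (mult \<Gamma>) n \<gamma>) \<in> X"
    unfolding X_iff using n f g hat_Inv[OF n Inv_gpow[OF f] f] tup_merge[OF g] by simp_all
  show "t (n + 1, pc_hat R G n f, \<gamma>) = t (n, f, merge_last (mult \<Gamma>) n \<gamma>)"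
  proof (rule jointly_embeds_eqI[OF je D(2)[OF x1] D(2)[OF x2]])
    fix j assume j: "j \<in> J"
    have "s j (n + 1, pc_hat R G n f, \<gamma>) = s j (n, f, merge_last (mult \<Gamma>) n \<gamma>)"
      using c[OF j] n f g unfolding pseudocharacter_def by blast
    then show "\<phi>' j (t (n + 1, pc_hat R G n f, \<gamma>)) = \<phi>' j (t (n, f, merge_last (mult \<Gamma>) n \<gamma>))"
      unfolding D(5)[OF j x1] D(5)[OF j x2] .
  qed
qed

sublocale pc: univ_algebra R X PCcond
proof (rule univ_algebra.intro)
  show "univ_reflects R X PCcond"
    unfolding univ_reflects_def using pc_reflect by blast
qed (rule cring_R)

lemma algebra_PC: "algebra R PC"
  unfolding pc_alg_def by (rule pc.algebra_univ)

definition "\<Theta> n f \<gamma> = univ_gen R X PCcond (n, f, \<gamma>)"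

lemma pseudocharacter_\<Theta>: "pseudocharacter R G G0 \<iota> \<Gamma> PC \<Theta>"
  using pc.gen_cond unfolding pc_alg_def \<Theta>_def[abs_def] .

lemma \<Theta>_hom: "1 \<le> n \<Longrightarrow> \<gamma> \<in> tup n \<Longrightarrow> (\<lambda>f. \<Theta> n f \<gamma>) \<in> alg_hom R (Inv {1..n}) PC"
  using pseudocharacter_\<Theta> unfolding pseudocharacter_def by blast

lemma \<Theta>_subst:
  "1 \<le> m \<Longrightarrow> 1 \<le> n \<Longrightarrow> \<zeta> \<in> {1..m} \<rightarrow> {1..n} \<Longrightarrow> f \<in> carrier (Inv {1..m}) \<Longrightarrow> \<gamma> \<in> tup n \<Longrightarrow>
    \<Theta> n (pc_subst R G n \<zeta> f) \<gamma> = \<Theta> m f (\<lambda>i \<in> {1..m}. \<gamma> (\<zeta> i))"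
  using pseudocharacter_\<Theta> unfolding pseudocharacter_def by blast

lemma \<Theta>_hat:
  "1 \<le> n \<Longrightarrow> f \<in> carrier (Inv {1..n}) \<Longrightarrow> \<gamma> \<in> tup (n + 1) \<Longrightarrow>
    \<Theta> (n + 1) (pc_hat R G n f) \<gamma> = \<Theta> n f (merge_last (mult \<Gamma>) n \<gamma>)"
  using pseudocharacter_\<Theta> unfolding pseudocharacter_def by blast

definition "is_value c \<longleftrightarrow> (\<exists>n f \<gamma>. 1 \<le> n \<and> f \<in> carrier (Inv {1..n}) \<and> \<gamma> \<in> tup n \<and> c = \<Theta> n f \<gamma>)"

lemma is_value_merge:
  assumes "is_value a" "is_value b"
  obtains N \<tau> f f' where "1 \<le> N" "\<tau> \<in> tup N" "f \<in> carrier (Inv {1..N})" "f' \<in> carrier (Inv {1..N})"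
    "a = \<Theta> N f \<tau>" "b = \<Theta> N f' \<tau>"
proof -
  obtain n f \<gamma> n' f' \<gamma>' where n: "1 \<le> n" "f \<in> carrier (Inv {1..n})" "\<gamma> \<in> tup n" "a = \<Theta> n f \<gamma>"
    and n': "1 \<le> n'" "f' \<in> carrier (Inv {1..n'})" "\<gamma>' \<in> tup n'" "b = \<Theta> n' f' \<gamma>'"
    using assms unfolding is_value_def by blast
  obtain N \<tau> \<zeta> \<zeta>' where N: "1 \<le> N" "\<tau> \<in> tup N" and z: "\<zeta> \<in> {1..n} \<rightarrow> {1..N}" and z': "\<zeta>' \<in> {1..n'} \<rightarrow> {1..N}"
    and e: "\<gamma> = (\<lambda>i \<in> {1..n}. \<tau> (\<zeta> i))" "\<gamma>' = (\<lambda>i \<in> {1..n'}. \<tau> (\<zeta>' i))"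
    using tuple_merge[OF n(3) n'(3) n(1)] by metis
  show ?thesis
  proof (rule that[OF N])
    show "pc_subst R G N \<zeta> f \<in> carrier (Inv {1..N})" "pc_subst R G N \<zeta>' f' \<in> carrier (Inv {1..N})"
      using subst_Inv[OF z Inv_gpow n(2)] subst_Inv[OF z' Inv_gpow n'(2)] n n' by blast+
    show "a = \<Theta> N (pc_subst R G N \<zeta> f) \<tau>" "b = \<Theta> N (pc_subst R G N \<zeta>' f') \<tau>"
      using \<Theta>_subst[OF n(1) N(1) z n(2) N(2)] \<Theta>_subst[OF n'(1) N(1) z' n'(2) N(2)] n(4) n'(4) e by simp_all
  qed
qed

text \<open>Two values can be taken at a common tuple by the substitution axiom, and at a fixed
  tuple \<open>\<Theta>\<close> is a homomorphism. So sums and products of values are single values,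
  not merely polynomials in them.\<close>

lemma PC_is_value: assumes "c \<in> carrier PC" shows "is_value c"
  using assms unfolding pc_alg_def
proof (induction c rule: pc.gen_induct)
  case (const k)
  \<comment> \<open>A constant function has the same value everywhere; since arities start at 1, a
    tuple of length one is used.\<close>
  let ?g = "\<lambda>i \<in> {1..1::nat}. \<one>\<^bsub>\<Gamma>\<^esub>"
  have g: "?g \<in> tup 1" by auto
  have "structure_map PC k = \<Theta> 1 (structure_map (Inv {1..1}) k) ?g"
    by (rule alg_hom_structure_map[OF \<Theta>_hom[OF order.refl g] Inv_algebra const, symmetric])
  then show ?case
    unfolding pc_alg_def[symmetric] is_value_def using g structure_map_closed[OF Inv_algebra const] by blast
next
  case (gen x)
  then show ?case by (cases x) (auto simp: X_iff \<Theta>_def is_value_def)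
next
  case (add a b)
  obtain N \<tau> f f' where N: "1 \<le> N" "\<tau> \<in> tup N" and f: "f \<in> carrier (Inv {1..N})" "f' \<in> carrier (Inv {1..N})"
    and e: "a = \<Theta> N f \<tau>" "b = \<Theta> N f' \<tau>" using is_value_merge[OF add.IH] by blast
  interpret I: algebra R "Inv {1..N}" by (rule Inv_algebra)
  have "a \<oplus>\<^bsub>PC\<^esub> b = \<Theta> N (f \<oplus>\<^bsub>Inv {1..N}\<^esub> f') \<tau>"
    unfolding e by (rule alg_hom_add[OF \<Theta>_hom[OF N] f, symmetric])
  moreover have "f \<oplus>\<^bsub>Inv {1..N}\<^esub> f' \<in> carrier (Inv {1..N})" using f by (rule I.M.a_closed)
  ultimately show ?case unfolding pc_alg_def[symmetric] is_value_def using N by blast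
next
  case (mult a b)
  obtain N \<tau> f f' where N: "1 \<le> N" "\<tau> \<in> tup N" and f: "f \<in> carrier (Inv {1..N})" "f' \<in> carrier (Inv {1..N})"
    and e: "a = \<Theta> N f \<tau>" "b = \<Theta> N f' \<tau>" using is_value_merge[OF mult.IH] by blast
  interpret I: algebra R "Inv {1..N}" by (rule Inv_algebra)
  have "a \<otimes>\<^bsub>PC\<^esub> b = \<Theta> N (f \<otimes>\<^bsub>Inv {1..N}\<^esub> f') \<tau>"
    unfolding e by (rule alg_hom_mult[OF \<Theta>_hom[OF N] f, symmetric])
  moreover have "f \<otimes>\<^bsub>Inv {1..N}\<^esub> f' \<in> carrier (Inv {1..N})" using f by (rule I.m_closed)
  ultimately show ?case unfolding pc_alg_def[symmetric] is_value_def using N by blast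
qed

section \<open>Functions evaluated at finite tuples of points\<close>

definition "eval_at C \<sigma> \<gamma> = gpow_eval R C (\<lambda>i :: nat. \<sigma> (\<gamma> i :: 'g))"

definition "evals C \<sigma> = {eval_at C \<sigma> \<gamma> g | n \<gamma> g. 1 \<le> n \<and> \<gamma> \<in> tup n \<and> g \<in> carrier (pow n)}"

context
  fixes C :: "('k, 'c) module" and \<sigma> :: "'g \<Rightarrow> 'h \<Rightarrow> 'c"
  assumes C: "algebra R C" and \<sigma>: "\<And>\<gamma>. \<gamma> \<in> carrier \<Gamma> \<Longrightarrow> \<sigma> \<gamma> \<in> carrier (pts C)"
begin

lemma \<sigma>_tup: "\<gamma> \<in> tup n \<Longrightarrow> i \<in> {1..n} \<Longrightarrow> \<sigma> (\<gamma> i) \<in> alg_hom R G C"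
  by (rule pts_hom[OF \<sigma>]) auto

lemma eval_at_hom: assumes "\<gamma> \<in> tup n" shows "eval_at C \<sigma> \<gamma> \<in> alg_hom R (pow n) C"
  unfolding eval_at_def by (rule group_scheme_power.eval_hom[OF powI C \<sigma>_tup[OF assms]])

lemma eval_at_pr:
  assumes "\<gamma> \<in> tup n" "i \<in> {1..n}" "h \<in> carrier G"
  shows "eval_at C \<sigma> \<gamma> (gpow_pt R G {1..n} i h) = \<sigma> (\<gamma> i) h"
  unfolding eval_at_def by (rule group_scheme_power.eval_pr[OF powI C \<sigma>_tup[OF assms(1)] assms(2,3)])

lemma eval_at_subst:
  assumes g: "\<gamma> \<in> tup n" and z: "\<zeta> \<in> {1..m} \<rightarrow> {1..n}" and f: "f \<in> carrier (pow m)"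
  shows "eval_at C \<sigma> \<gamma> (pc_subst R G n \<zeta> f) = eval_at C \<sigma> (\<lambda>i \<in> {1..m}. \<gamma> (\<zeta> i)) f"
  unfolding eval_at_def by (rule eval_subst[OF z C \<sigma>_tup[OF g] f]) simp_all

lemma evals_merge:
  assumes "u \<in> evals C \<sigma>" "u' \<in> evals C \<sigma>"
  obtains N \<tau> g g' where "1 \<le> N" "\<tau> \<in> tup N" "g \<in> carrier (pow N)" "g' \<in> carrier (pow N)"
    "u = eval_at C \<sigma> \<tau> g" "u' = eval_at C \<sigma> \<tau> g'"
proof -
  obtain n \<gamma> g n' \<gamma>' g' where n: "1 \<le> n" "\<gamma> \<in> tup n" "g \<in> carrier (pow n)" "u = eval_at C \<sigma> \<gamma> g"
    and n': "1 \<le> n'" "\<gamma>' \<in> tup n'" "g' \<in> carrier (pow n')" "u' = eval_at C \<sigma> \<gamma>' g'"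
    using assms unfolding evals_def by blast
  obtain N \<tau> \<zeta> \<zeta>' where N: "1 \<le> N" "\<tau> \<in> tup N" and z: "\<zeta> \<in> {1..n} \<rightarrow> {1..N}" and z': "\<zeta>' \<in> {1..n'} \<rightarrow> {1..N}"
    and e: "\<gamma> = (\<lambda>i \<in> {1..n}. \<tau> (\<zeta> i))" "\<gamma>' = (\<lambda>i \<in> {1..n'}. \<tau> (\<zeta>' i))"
    using tuple_merge[OF n(2) n'(2) n(1)] by metis
  show ?thesis
  proof (rule that[OF N])
    show "pc_subst R G N \<zeta> g \<in> carrier (pow N)" "pc_subst R G N \<zeta>' g' \<in> carrier (pow N)"
      using alg_hom_closed[OF subst_hom[OF z] n(3)] alg_hom_closed[OF subst_hom[OF z'] n'(3)] .
    show "u = eval_at C \<sigma> \<tau> (pc_subst R G N \<zeta> g)" "u' = eval_at C \<sigma> \<tau> (pc_subst R G N \<zeta>' g')"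
      using eval_at_subst[OF N(2) z n(3)] eval_at_subst[OF N(2) z' n'(3)] n(4) n'(4) e by simp_all
  qed
qed

lemma evals_add: assumes "u \<in> evals C \<sigma>" "u' \<in> evals C \<sigma>" shows "u \<oplus>\<^bsub>C\<^esub> u' \<in> evals C \<sigma>"
proof (rule evals_merge[OF assms])
  fix N \<tau> g g' assume N: "1 \<le> N" "\<tau> \<in> tup N" and g: "g \<in> carrier (pow N)" "g' \<in> carrier (pow N)"
    and u: "u = eval_at C \<sigma> \<tau> g" "u' = eval_at C \<sigma> \<tau> g'"
  interpret I: algebra R "pow N" by (rule gpow_algebra)
  have "u \<oplus>\<^bsub>C\<^esub> u' = eval_at C \<sigma> \<tau> (g \<oplus>\<^bsub>pow N\<^esub> g')" unfolding u by (rule alg_hom_add[OF eval_at_hom[OF N(2)] g, symmetric])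
  moreover have "g \<oplus>\<^bsub>pow N\<^esub> g' \<in> carrier (pow N)" using g by (rule I.M.a_closed)
  ultimately show ?thesis using N unfolding evals_def by blast
qed

lemma evals_mult: assumes "u \<in> evals C \<sigma>" "u' \<in> evals C \<sigma>" shows "u \<otimes>\<^bsub>C\<^esub> u' \<in> evals C \<sigma>"
proof (rule evals_merge[OF assms])
  fix N \<tau> g g' assume N: "1 \<le> N" "\<tau> \<in> tup N" and g: "g \<in> carrier (pow N)" "g' \<in> carrier (pow N)"
    and u: "u = eval_at C \<sigma> \<tau> g" "u' = eval_at C \<sigma> \<tau> g'"
  interpret I: algebra R "pow N" by (rule gpow_algebra)
  have "u \<otimes>\<^bsub>C\<^esub> u' = eval_at C \<sigma> \<tau> (g \<otimes>\<^bsub>pow N\<^esub> g')" unfolding u by (rule alg_hom_mult[OF eval_at_hom[OF N(2)] g, symmetric])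
  moreover have "g \<otimes>\<^bsub>pow N\<^esub> g' \<in> carrier (pow N)" using g by (rule I.m_closed)
  ultimately show ?thesis using N unfolding evals_def by blast
qed

lemma evals_const: assumes k: "k \<in> carrier R" shows "structure_map C k \<in> evals C \<sigma>"
proof -
  have g: "(\<lambda>i \<in> {1..1::nat}. \<one>\<^bsub>\<Gamma>\<^esub>) \<in> tup 1" by auto
  show ?thesis unfolding evals_def
    using alg_hom_structure_map[OF eval_at_hom[OF g] gpow_algebra k, symmetric]
      structure_map_closed[OF gpow_algebra k] g by blast
qed

lemma evals_gen: assumes g: "\<gamma> \<in> carrier \<Gamma>" and h: "h \<in> carrier G" shows "\<sigma> \<gamma> h \<in> evals C \<sigma>"
proof -
  let ?t = "\<lambda>i \<in> {1..1::nat}. \<gamma>"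
  have t: "?t \<in> tup 1" using g by auto
  have "eval_at C \<sigma> ?t (gpow_pt R G {1..1} 1 h) = \<sigma> (?t 1) h" by (rule eval_at_pr[OF t _ h]) simp
  moreover have "gpow_pt R G {1..1::nat} 1 h \<in> carrier (pow 1)"
    by (rule alg_hom_closed[OF pts_hom[OF gpow_pr] h]) simp
  moreover have "?t 1 = \<gamma>" by simp
  ultimately show ?thesis unfolding evals_def using t by (smt (verit, best) mem_Collect_eq order.refl)
qed

end

text \<open>The generators are coordinates of one \<open>\<rho> \<gamma>\<close>, and sums and
  products can be formed over a common tuple. The functions are not yet invariant; the Reynolds
  operator takes care of that in \<open>\<kappa>_image\<close>.\<close>

lemma evals_Rep: "u \<in> carrier rep.Rep \<Longrightarrow> u \<in> evals rep.Rep rep.\<rho>"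
  unfolding rep_alg_def
proof (induction u rule: rep.univ.gen_induct)
  case (const k)
  from evals_const[OF rep.algebra_Rep rep.\<rho>_closed this] show ?case unfolding rep_alg_def .
next
  case (gen x)
  then obtain \<gamma> h where x: "x = (\<gamma>, h)" "\<gamma> \<in> carrier \<Gamma>" "h \<in> carrier G" by blast
  have "rep.\<rho> \<gamma> h \<in> evals rep.Rep rep.\<rho>" by (rule evals_gen[OF rep.algebra_Rep rep.\<rho>_closed x(2,3)])
  moreover have "rep.\<rho> \<gamma> h = rep.univ.gen x" using x by (simp add: univ_rep_def)
  ultimately show ?case unfolding rep_alg_def by simp
next
  case (add a b)
  from evals_add[OF rep.algebra_Rep rep.\<rho>_closed add.IH[folded rep_alg_def]] show ?case unfolding rep_alg_def .
next
  case (mult a b)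
  from evals_mult[OF rep.algebra_Rep rep.\<rho>_closed mult.IH[folded rep_alg_def]] show ?case unfolding rep_alg_def .
qed

end

context pseudocharacters
begin

subsection \<open>The comorphism and its image\<close>

abbreviation "\<kappa> \<equiv> rep_to_pc R G \<Gamma>"
abbreviation "RepInv \<equiv> rep_inv R G G0 \<iota> \<Gamma>"

text \<open>The first two axioms are formal properties of evaluation; the third is where the
  multiplicativity of \<open>\<rho>\<close> enters.\<close>

lemma pseudocharacter_of_rep: "pseudocharacter R G G0 \<iota> \<Gamma> rep.Rep (pc_of_rep R rep.Rep rep.\<rho>)"
  unfolding pseudocharacter_def pc_of_rep_def eval_at_def[symmetric]
proof (intro conjI allI impI ballI)
  fix n :: nat and \<gamma> assume "\<gamma> \<in> tup n"
  then show "eval_at rep.Rep rep.\<rho> \<gamma> \<in> alg_hom R (Inv {1..n}) rep.Rep"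
    by (intro alg_hom_Inv eval_at_hom rep.algebra_Rep rep.\<rho>_closed)
next
  fix m n :: nat and \<zeta> f \<gamma> assume "\<zeta> \<in> {1..m} \<rightarrow> {1..n}" "f \<in> carrier (Inv {1..m})" "\<gamma> \<in> tup n"
  then show "eval_at rep.Rep rep.\<rho> \<gamma> (pc_subst R G n \<zeta> f) = eval_at rep.Rep rep.\<rho> (\<lambda>i \<in> {1..m}. \<gamma> (\<zeta> i)) f"
    by (intro eval_at_subst rep.algebra_Rep rep.\<rho>_closed Inv_gpow)
next
  fix n :: nat and f \<gamma> assume n: "1 \<le> n" and f: "f \<in> carrier (Inv {1..n})" and g: "\<gamma> \<in> tup (n + 1)"
  interpret pw: group_scheme_power R G "{1..n}" by (rule powI)
  have g': "\<gamma> i \<in> carrier \<Gamma>" if "i \<in> {1..n + 1}" for i using g that by (rule PiE_mem)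
  have "eval_at rep.Rep rep.\<rho> \<gamma> (pc_hat R G n f)
      = gpow_eval R rep.Rep (merge_last (pt_mult R G rep.Rep) n (\<lambda>i. rep.\<rho> (\<gamma> i))) f"
    unfolding eval_at_def
    by (rule eval_hat[OF n rep.algebra_Rep \<sigma>_tup[OF rep.algebra_Rep rep.\<rho>_closed g] Inv_gpow[OF f]])
  also have "\<dots> = eval_at rep.Rep rep.\<rho> (merge_last (mult \<Gamma>) n \<gamma>) f"
    unfolding eval_at_def
  proof (rule pw.eval_natural[OF rep.algebra_Rep _ rep.algebra_Rep alg_hom_id Inv_gpow[OF f]])
    have m: "merge_last (pt_mult R G rep.Rep) n (\<lambda>i. rep.\<rho> (\<gamma> i)) i = rep.\<rho> (merge_last (mult \<Gamma>) n \<gamma> i)"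
      if "i \<in> {1..n}" for i
      using that g'[of n] g'[of "n + 1"] n by (simp add: merge_last_def rep.\<rho>_mult)
    show "merge_last (pt_mult R G rep.Rep) n (\<lambda>i. rep.\<rho> (\<gamma> i)) i \<in> alg_hom R G rep.Rep" if "i \<in> {1..n}" for i
      unfolding m[OF that] by (rule \<sigma>_tup[OF rep.algebra_Rep rep.\<rho>_closed tup_merge[OF g] that])
    show "rep.\<rho> (merge_last (mult \<Gamma>) n \<gamma> i) h = merge_last (pt_mult R G rep.Rep) n (\<lambda>i. rep.\<rho> (\<gamma> i)) i h"
      if "i \<in> {1..n}" for i h by (simp only: m[OF that])
  qed
  finally show "eval_at rep.Rep rep.\<rho> \<gamma> (pc_hat R G n f) = eval_at rep.Rep rep.\<rho> (merge_last (mult \<Gamma>) n \<gamma>) f" .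
qed

lemma \<kappa>_hom: "\<kappa> \<in> alg_hom R PC rep.Rep"
  and \<kappa>_\<Theta>: "1 \<le> n \<Longrightarrow> f \<in> carrier (Inv {1..n}) \<Longrightarrow> \<gamma> \<in> tup n \<Longrightarrow> \<kappa> (\<Theta> n f \<gamma>) = eval_at rep.Rep rep.\<rho> \<gamma> f"
proof -
  let ?v = "\<lambda>(n, f, \<gamma>). pc_of_rep R rep.Rep rep.\<rho> n f \<gamma>"
  have v: "?v x \<in> carrier rep.Rep" if x: "x \<in> X" for x
  proof -
    obtain n f \<gamma> where e: "x = (n, f, \<gamma>)" by (cases x)
    with x have f: "f \<in> carrier (pow n)" and g: "\<gamma> \<in> tup n" by (simp_all add: X_iff Inv_gpow)
    show ?thesis
      using alg_hom_closed[OF eval_at_hom[OF rep.algebra_Rep rep.\<rho>_closed g] f]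
      by (simp add: e pc_of_rep_def eval_at_def)
  qed
  have c: "pseudocharacter R G G0 \<iota> \<Gamma> rep.Rep (\<lambda>n f \<gamma>. ?v (n, f, \<gamma>))"
    using pseudocharacter_of_rep by simp
  have r: "pseudocharacter R G G0 \<iota> \<Gamma> T (\<lambda>n f \<gamma>. t (n, f, \<gamma>))"
    if "jointly_embeds R X T t {()} (\<lambda>_. rep.Rep) \<phi>' (\<lambda>_. ?v)" for T t \<phi>'
    by (rule pc_reflect[OF that c])
  have l1: "univ_lift R rep.Rep ?v \<in> alg_hom R pc.U rep.Rep"
    by (rule pc.lift_alg_hom[where v = ?v, OF rep.algebra_Rep v r refl])
  have l2: "univ_lift R rep.Rep ?v (pc.gen x) = ?v x" if "x \<in> X" for x
    by (rule pc.lift_gen[where v = ?v, OF rep.algebra_Rep v r refl that])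
  show "\<kappa> \<in> alg_hom R PC rep.Rep"
    unfolding rep_to_pc_def pc_classify_def pc_alg_def by (rule l1)
  assume a: "1 \<le> n" "f \<in> carrier (Inv {1..n})" "\<gamma> \<in> tup n"
  then have x: "(n, f, \<gamma>) \<in> X" by (simp add: X_iff)
  have "\<kappa> (\<Theta> n f \<gamma>) = ?v (n, f, \<gamma>)"
    unfolding rep_to_pc_def pc_classify_def \<Theta>_def by (rule l2[OF x])
  then show "\<kappa> (\<Theta> n f \<gamma>) = eval_at rep.Rep rep.\<rho> \<gamma> f" by (simp add: pc_of_rep_def eval_at_def)
qed

definition "\<delta>R = rep_classify R (tensor R rep.Rep G0) (\<lambda>\<gamma>. univ_conj R G G0 \<iota> rep.Rep (rep.\<rho> \<gamma>))"

text \<open>Conjugating the universal representation by the universal point of \<open>G0\<close>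
  gives again a representation, since conjugation is multiplicative, and \<open>\<delta>R\<close>
  classifies it.\<close>

lemma \<delta>R_hom: "\<delta>R \<in> alg_hom R rep.Rep (tensor R rep.Rep G0)"
  and \<delta>R_equivariant: "\<gamma> \<in> carrier \<Gamma> \<Longrightarrow> equivariant rep.Rep \<delta>R (rep.\<rho> \<gamma>)"
proof -
  let ?x = "\<lambda>\<gamma>. univ_conj R G G0 \<iota> rep.Rep (rep.\<rho> \<gamma>)"
  have x: "?x \<gamma> \<in> carrier (pts (tensor R rep.Rep G0))" if "\<gamma> \<in> carrier \<Gamma>" for \<gamma>
    by (rule univ_conj_closed[OF rep.algebra_Rep rep.\<rho>_closed[OF that]])
  have m: "?x (\<gamma> \<otimes>\<^bsub>\<Gamma>\<^esub> \<gamma>') = pt_mult R G (tensor R rep.Rep G0) (?x \<gamma>) (?x \<gamma>')"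
    if "\<gamma> \<in> carrier \<Gamma>" "\<gamma>' \<in> carrier \<Gamma>" for \<gamma> \<gamma>'
    unfolding rep.\<rho>_mult[OF that]
    by (rule univ_conj_mult[OF rep.algebra_Rep rep.\<rho>_closed[OF that(1)] rep.\<rho>_closed[OF that(2)]])
  show "\<delta>R \<in> alg_hom R rep.Rep (tensor R rep.Rep G0)"
    unfolding \<delta>R_def by (rule rep.classify_hom[OF tensor_algebra[OF rep.algebra_Rep] x m])
  show "equivariant rep.Rep \<delta>R (rep.\<rho> \<gamma>)" if "\<gamma> \<in> carrier \<Gamma>"
    unfolding equivariant_def \<delta>R_def
    using rep.classify_\<rho>[OF tensor_algebra[OF rep.algebra_Rep] x m that] by blast
qed

lemma rep_inv_eq: "RepInv = coinvariants R rep.Rep G0 \<delta>R"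
  by (simp add: rep_inv_def Let_def \<delta>R_def)

lemma rep_inv_carrier:
  "b \<in> carrier RepInv \<longleftrightarrow> b \<in> carrier rep.Rep \<and> \<delta>R b = tensor_inl R rep.Rep G0 b"
  by (simp add: rep_inv_eq coinvariants_def)

lemma
  assumes g: "\<gamma> \<in> tup n" and f: "f \<in> carrier (pow n)"
  shows eval_rep_inv: "f \<in> carrier (Inv {1..n}) \<Longrightarrow> eval_at rep.Rep rep.\<rho> \<gamma> f \<in> carrier RepInv"
    and eval_rep_E: "eval_at rep.Rep rep.\<rho> \<gamma> (E {1..n} f) = reynolds rep.Rep \<delta>R (eval_at rep.Rep rep.\<rho> \<gamma> f)"
proof -
  have g': "\<gamma> i \<in> carrier \<Gamma>" if "i \<in> {1..n}" for i using g that by (rule PiE_mem)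
  note ev = rep.algebra_Rep \<delta>R_hom rep.\<rho>_closed[OF g'] \<delta>R_equivariant[OF g'] f
  show "f \<in> carrier (Inv {1..n}) \<Longrightarrow> eval_at rep.Rep rep.\<rho> \<gamma> f \<in> carrier RepInv"
    unfolding rep_inv_carrier
    using alg_hom_closed[OF eval_at_hom[OF rep.algebra_Rep rep.\<rho>_closed g] f] eval_Inv[OF ev]
    by (simp add: eval_at_def)
  show "eval_at rep.Rep rep.\<rho> \<gamma> (E {1..n} f) = reynolds rep.Rep \<delta>R (eval_at rep.Rep rep.\<rho> \<gamma> f)"
    unfolding eval_at_def by (rule eval_reynolds[OF ev, symmetric])
qed

text \<open>An invariant \<open>b\<close> is the value of some function \<open>f\<close> at
  \<open>\<rho>\<close>. It equals its own Reynolds image, so \<open>f\<close> may be replaced by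
  the invariant function \<open>E f\<close>, whose value comes from \<open>O(PC)\<close>.\<close>

lemma \<kappa>_image: "\<kappa> ` carrier PC = carrier RepInv"
proof (intro equalityI subsetI)
  fix b assume "b \<in> \<kappa> ` carrier PC"
  then obtain c where c: "c \<in> carrier PC" "b = \<kappa> c" by blast
  obtain n f \<gamma> where n: "1 \<le> n" "f \<in> carrier (Inv {1..n})" "\<gamma> \<in> tup n" "c = \<Theta> n f \<gamma>"
    using PC_is_value[OF c(1)] unfolding is_value_def by blast
  show "b \<in> carrier RepInv"
    unfolding c(2) n(4) \<kappa>_\<Theta>[OF n(1-3)] by (rule eval_rep_inv[OF n(3) Inv_gpow[OF n(2)] n(2)])
next
  fix b assume b: "b \<in> carrier RepInv"
  then have bR: "b \<in> carrier rep.Rep" and bi: "\<delta>R b = tensor_inl R rep.Rep G0 b" by (simp_all add: rep_inv_carrier)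
  obtain n \<gamma> f where n: "1 \<le> n" "\<gamma> \<in> tup n" "f \<in> carrier (pow n)" "b = eval_at rep.Rep rep.\<rho> \<gamma> f"
    using evals_Rep[OF bR] unfolding evals_def by blast
  have "b = reynolds rep.Rep \<delta>R b"
    by (rule reynolds_coinvariant[where \<delta> = \<delta>R, OF rep.algebra_Rep bR bi, symmetric])
  also have "\<dots> = \<kappa> (\<Theta> n (E {1..n} f) \<gamma>)"
    unfolding \<kappa>_\<Theta>[OF n(1) E_closed[OF n(3)] n(2)] eval_rep_E[OF n(2,3)] n(4) ..
  moreover have "\<Theta> n (E {1..n} f) \<gamma> \<in> carrier PC"
    by (rule alg_hom_closed[OF \<Theta>_hom[OF n(1,2)] E_closed[OF n(3)]])
  ultimately show "b \<in> \<kappa> ` carrier PC" by blast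
qed

subsection \<open>Injectivity\<close>

text \<open>\<open>F\<close> is the coordinate ring of \<open>G\<^sup>\<Gamma>\<close>. Composing the Reynolds operator with the universal
  pseudocharacter gives an additive map \<open>L : F \<longrightarrow> \<O>(PC)\<close>; the largest ideal contained in its kernel
  already makes the tautological map \<open>\<Gamma> \<longrightarrow> G(F / I)\<close> multiplicative, so it contains the kernel of
  \<open>F \<longrightarrow> \<O>(Rep)\<close>.\<close>

abbreviation "F \<equiv> gpow R G (carrier \<Gamma>)"
abbreviation "pr \<equiv> gpow_pt R G (carrier \<Gamma>)"

lemma F_\<sigma>: "\<gamma> \<in> tup n \<Longrightarrow> i \<in> {1..n} \<Longrightarrow> pr (\<gamma> i) \<in> alg_hom R G F"
  by (rule \<sigma>_tup[where \<sigma> = pr, OF gpow_algebra gpow_pr])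

lemma F_hom: "\<gamma> \<in> tup n \<Longrightarrow> eval_at F pr \<gamma> \<in> alg_hom R (pow n) F"
  by (rule eval_at_hom[where \<sigma> = pr, OF gpow_algebra gpow_pr])

lemma F_pr:
  "\<gamma> \<in> tup n \<Longrightarrow> i \<in> {1..n} \<Longrightarrow> h \<in> carrier G \<Longrightarrow> eval_at F pr \<gamma> (gpow_pt R G {1..n} i h) = pr (\<gamma> i) h"
  by (rule eval_at_pr[where \<sigma> = pr, OF gpow_algebra gpow_pr])

lemma F_subst:
  "\<gamma> \<in> tup n \<Longrightarrow> \<zeta> \<in> {1..m} \<rightarrow> {1..n} \<Longrightarrow> f \<in> carrier (pow m) \<Longrightarrow>
    eval_at F pr \<gamma> (pc_subst R G n \<zeta> f) = eval_at F pr (\<lambda>i \<in> {1..m}. \<gamma> (\<zeta> i)) f"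
  by (rule eval_at_subst[where \<sigma> = pr, OF gpow_algebra gpow_pr])

lemma evals_F: "u \<in> carrier F \<Longrightarrow> u \<in> evals F pr"
proof -
  interpret p: group_scheme_power R G "carrier \<Gamma>" by (rule powI)
  show "u \<in> carrier F \<Longrightarrow> u \<in> evals F pr"
    unfolding gpow_def
  proof (induction u rule: p.univ.gen_induct)
    case (const k)
    from evals_const[OF gpow_algebra gpow_pr this] show ?case unfolding gpow_def .
  next
    case (gen x)
    then obtain \<gamma> h where x: "x = (\<gamma>, h)" "\<gamma> \<in> carrier \<Gamma>" "h \<in> carrier G" by blast
    have "pr \<gamma> h \<in> evals F pr" by (rule evals_gen[OF gpow_algebra gpow_pr x(2,3)])
    moreover have "pr \<gamma> h = p.univ.gen x" using x by (simp add: gpow_pt_def)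
    ultimately show ?case unfolding gpow_def by simp
  next
    case (add a b)
    from evals_add[OF gpow_algebra gpow_pr add.IH[folded gpow_def]] show ?case unfolding gpow_def .
  next
    case (mult a b)
    from evals_mult[OF gpow_algebra gpow_pr mult.IH[folded gpow_def]] show ?case unfolding gpow_def .
  qed
qed

text \<open>For distinct entries the projection from \<open>G^\<Gamma>\<close> to \<open>G^N\<close>
  along \<open>\<tau>\<close> has a section, which places the coordinate number
  \<open>j \<gamma>\<close> at \<open>\<gamma>\<close>. Its comorphism \<open>?\<theta>\<close> is a
  left inverse of the evaluation.\<close>

lemma eval_F_inj:
  assumes N: "1 \<le> N" and t: "\<tau> \<in> tup N" and inj: "inj_on \<tau> {1..N}"
    and g: "g \<in> carrier (pow N)" and g': "g' \<in> carrier (pow N)" and eq: "eval_at F pr \<tau> g = eval_at F pr \<tau> g'"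
  shows "g = g'"
proof -
  interpret p: group_scheme_power R G "carrier \<Gamma>" by (rule powI)
  interpret q: group_scheme_power R G "{1..N}" by (rule powI)
  \<comment> \<open>Away from the entries of \<open>\<tau>\<close> any index would do; 1 is one
    since \<open>1 \<le> N\<close>.\<close>
  define j where "j \<gamma> = (if \<gamma> \<in> \<tau> ` {1..N} then inv_into {1..N} \<tau> \<gamma> else 1)" for \<gamma>
  have j: "j \<gamma> \<in> {1..N}" for \<gamma> using N inv_into_into[of \<gamma> \<tau> "{1..N}"] by (simp add: j_def)
  have jt: "j (\<tau> i) = i" if "i \<in> {1..N}" for i
    using that inj unfolding j_def by (simp add: inv_into_f_f)
  let ?\<theta> = "gpow_eval R (pow N) (\<lambda>\<gamma>. q.pr (j \<gamma>))"
  have pj: "q.pr (j \<gamma>) \<in> alg_hom R G (pow N)" for \<gamma> by (rule pts_hom[OF q.pr_closed[OF j]])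
  have \<theta>: "?\<theta> \<in> alg_hom R F (pow N)" by (rule p.eval_hom[OF q.algebra_OG pj])
  have "?\<theta> (eval_at F pr \<tau> a) = a" if a: "a \<in> carrier (pow N)" for a
  proof (rule q.hom_eqI[OF alg_hom_compose[OF F_hom[OF t] \<theta>] alg_hom_id _ a])
    fix i h assume i: "i \<in> {1..N}" and h: "h \<in> carrier G"
    have ti: "\<tau> i \<in> carrier \<Gamma>" using t i by (rule PiE_mem)
    have "eval_at F pr \<tau> (q.pr i h) = pr (\<tau> i) h"
      by (rule F_pr[OF t i h])
    moreover have "?\<theta> (pr (\<tau> i) h) = q.pr (j (\<tau> i)) h"
      by (rule p.eval_pr[OF q.algebra_OG pj ti h])
    ultimately show "?\<theta> (eval_at F pr \<tau> (q.pr i h)) = q.pr i h"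
      by (simp only: jt[OF i])
  qed
  from this[OF g] this[OF g'] eq show ?thesis by metis
qed

text \<open>The graph of \<open>L\<close>. It is introduced as a relation because an element of
  \<open>F\<close> has many presentations as a function of finitely many coordinates.\<close>

definition "Rel u w \<longleftrightarrow> (\<exists>n \<gamma> g. 1 \<le> n \<and> \<gamma> \<in> tup n \<and> g \<in> carrier (pow n) \<and>
  u = eval_at F pr \<gamma> g \<and> w = \<Theta> n (E {1..n} g) \<gamma>)"

lemma RelI:
  "1 \<le> n \<Longrightarrow> \<gamma> \<in> tup n \<Longrightarrow> g \<in> carrier (pow n) \<Longrightarrow> Rel (eval_at F pr \<gamma> g) (\<Theta> n (E {1..n} g) \<gamma>)"
  unfolding Rel_def by blast

text \<open>Passing to the common tuple changes neither component of a pair: \<open>E\<close>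
  commutes with substitutions, and \<open>\<Theta>\<close> satisfies the substitution axiom on the
  invariant function \<open>E g\<close>.\<close>

lemma Rel_merge:
  assumes "Rel u w" "Rel u' w'"
  obtains N \<tau> g g' where "1 \<le> N" "\<tau> \<in> tup N" "inj_on \<tau> {1..N}" "g \<in> carrier (pow N)" "g' \<in> carrier (pow N)"
    "u = eval_at F pr \<tau> g" "u' = eval_at F pr \<tau> g'" "w = \<Theta> N (E {1..N} g) \<tau>" "w' = \<Theta> N (E {1..N} g') \<tau>"
proof -
  obtain n \<gamma> g n' \<gamma>' g' where n: "1 \<le> n" "\<gamma> \<in> tup n" "g \<in> carrier (pow n)" "u = eval_at F pr \<gamma> g" "w = \<Theta> n (E {1..n} g) \<gamma>"
    and n': "1 \<le> n'" "\<gamma>' \<in> tup n'" "g' \<in> carrier (pow n')" "u' = eval_at F pr \<gamma>' g'" "w' = \<Theta> n' (E {1..n'} g') \<gamma>'"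
    using assms unfolding Rel_def by blast
  obtain N \<tau> \<zeta> \<zeta>' where N: "1 \<le> N" "\<tau> \<in> tup N" "inj_on \<tau> {1..N}"
    and z: "\<zeta> \<in> {1..n} \<rightarrow> {1..N}" and z': "\<zeta>' \<in> {1..n'} \<rightarrow> {1..N}"
    and e: "\<gamma> = (\<lambda>i \<in> {1..n}. \<tau> (\<zeta> i))" "\<gamma>' = (\<lambda>i \<in> {1..n'}. \<tau> (\<zeta>' i))"
    using tuple_merge[OF n(2) n'(2) n(1)] by metis
  show ?thesis
  proof (rule that[OF N])
    show "pc_subst R G N \<zeta> g \<in> carrier (pow N)" "pc_subst R G N \<zeta>' g' \<in> carrier (pow N)"
      using alg_hom_closed[OF subst_hom[OF z] n(3)] alg_hom_closed[OF subst_hom[OF z'] n'(3)] .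
    show "u = eval_at F pr \<tau> (pc_subst R G N \<zeta> g)" "u' = eval_at F pr \<tau> (pc_subst R G N \<zeta>' g')"
      unfolding F_subst[OF N(2) z n(3)] F_subst[OF N(2) z' n'(3)]
      using n(4) n'(4) e by simp_all
    show "w = \<Theta> N (E {1..N} (pc_subst R G N \<zeta> g)) \<tau>"
      unfolding subst_E[OF z n(3), symmetric] \<Theta>_subst[OF n(1) N(1) z E_closed[OF n(3)] N(2)] n(5) e(1)[symmetric] ..
    show "w' = \<Theta> N (E {1..N} (pc_subst R G N \<zeta>' g')) \<tau>"
      unfolding subst_E[OF z' n'(3), symmetric] \<Theta>_subst[OF n'(1) N(1) z' E_closed[OF n'(3)] N(2)] n'(5) e(2)[symmetric] ..
  qed
qed

text \<open>Over a common tuple of distinct elements the two presenting functions coincide by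
  \<open>eval_F_inj\<close>.\<close>

lemma Rel_unique: assumes "Rel u w" "Rel u w'" shows "w = w'"
  using assms by (rule Rel_merge) (use eval_F_inj in metis)

lemma Rel_total: assumes "u \<in> carrier F" obtains w where "Rel u w"
  using evals_F[OF assms] unfolding evals_def Rel_def by blast

lemma Rel_add: assumes "Rel u w" "Rel u' w'" shows "Rel (u \<oplus>\<^bsub>F\<^esub> u') (w \<oplus>\<^bsub>PC\<^esub> w')"
proof (rule Rel_merge[OF assms])
  fix N \<tau> g g' assume N: "1 \<le> N" "\<tau> \<in> tup N" and g: "g \<in> carrier (pow N)" "g' \<in> carrier (pow N)"
    and u: "u = eval_at F pr \<tau> g" "u' = eval_at F pr \<tau> g'" and w: "w = \<Theta> N (E {1..N} g) \<tau>" "w' = \<Theta> N (E {1..N} g') \<tau>"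
  interpret I: algebra R "pow N" by (rule gpow_algebra)
  have "u \<oplus>\<^bsub>F\<^esub> u' = eval_at F pr \<tau> (g \<oplus>\<^bsub>pow N\<^esub> g')"
    unfolding u by (rule alg_hom_add[OF F_hom[OF N(2)] g, symmetric])
  moreover have "w \<oplus>\<^bsub>PC\<^esub> w' = \<Theta> N (E {1..N} (g \<oplus>\<^bsub>pow N\<^esub> g')) \<tau>"
    unfolding w E_add[OF g] using alg_hom_add[OF \<Theta>_hom[OF N] E_closed[OF g(1)] E_closed[OF g(2)]]
    by (simp add: Inv_simps)
  moreover have "g \<oplus>\<^bsub>pow N\<^esub> g' \<in> carrier (pow N)" using g by (rule I.M.a_closed)
  ultimately show ?thesis using RelI[OF N] by simp
qed

definition "L u = (THE w. Rel u w)"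

lemma L_eq: assumes "Rel u w" shows "L u = w"
  unfolding L_def by (rule the_equality, rule assms) (rule Rel_unique[OF _ assms])

lemma L_add: assumes "u \<in> carrier F" "u' \<in> carrier F" shows "L (u \<oplus>\<^bsub>F\<^esub> u') = L u \<oplus>\<^bsub>PC\<^esub> L u'"
proof -
  obtain w w' where "Rel u w" "Rel u' w'" using Rel_total assms by metis
  then show ?thesis using Rel_add L_eq by metis
qed

lemma L_closed: assumes "u \<in> carrier F" shows "L u \<in> carrier PC"
proof -
  obtain w where w: "Rel u w" using Rel_total assms by metis
  then obtain n \<gamma> g where n: "1 \<le> n" "\<gamma> \<in> tup n" "g \<in> carrier (pow n)" "w = \<Theta> n (E {1..n} g) \<gamma>"
    unfolding Rel_def by blast
  show ?thesis unfolding L_eq[OF w] n(4) by (rule alg_hom_closed[OF \<Theta>_hom[OF n(1,2)] E_closed[OF n(3)]])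
qed

lemma L_zero: "L \<zero>\<^bsub>F\<^esub> = \<zero>\<^bsub>PC\<^esub>"
proof -
  interpret F: algebra R F by (rule gpow_algebra)
  interpret PC: algebra R PC by (rule algebra_PC)
  have "L \<zero>\<^bsub>F\<^esub> = L \<zero>\<^bsub>F\<^esub> \<oplus>\<^bsub>PC\<^esub> L \<zero>\<^bsub>F\<^esub>"
    using L_add[OF F.M.zero_closed F.M.zero_closed] F.M.l_zero[OF F.M.zero_closed] by metis
  then show ?thesis using L_closed[OF F.M.zero_closed] by (metis PC.M.add.r_cancel_one')
qed

lemma L_minus_eq_zero:
  assumes u: "u \<in> carrier F" "u' \<in> carrier F" and eq: "L u = L u'"
  shows "L (u \<ominus>\<^bsub>F\<^esub> u') = \<zero>\<^bsub>PC\<^esub>"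
proof -
  interpret F: algebra R F by (rule gpow_algebra)
  interpret PC: algebra R PC by (rule algebra_PC)
  have m: "u \<ominus>\<^bsub>F\<^esub> u' \<in> carrier F" by (rule algebra_minus_closed[OF gpow_algebra u])
  have "u \<ominus>\<^bsub>F\<^esub> u' \<oplus>\<^bsub>F\<^esub> u' = u" using u by (simp add: a_minus_def F.M.a_assoc F.M.l_neg)
  then have "L (u \<ominus>\<^bsub>F\<^esub> u') \<oplus>\<^bsub>PC\<^esub> L u' = L u'" using L_add[OF m u(2)] eq by metis
  then show ?thesis by (rule PC.M.add.r_cancel_one[OF L_closed[OF u(2)] L_closed[OF m], THEN iffD1])
qed

definition "I = {p \<in> carrier F. \<forall>q \<in> carrier F. L (q \<otimes>\<^bsub>F\<^esub> p) = \<zero>\<^bsub>PC\<^esub>}"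

lemma ideal_I: "ideal I F"
proof -
  interpret F: algebra R F by (rule gpow_algebra)
  interpret PC: algebra R PC by (rule algebra_PC)
  have mem: "p \<in> I \<longleftrightarrow> p \<in> carrier F \<and> (\<forall>q \<in> carrier F. L (q \<otimes>\<^bsub>F\<^esub> p) = \<zero>\<^bsub>PC\<^esub>)" for p by (simp add: I_def)
  show ?thesis
  proof (rule idealI)
    show "ring F" by (rule algebra_ring[OF gpow_algebra])
    show "subgroup I (add_monoid F)"
    proof (rule F.M.add.subgroupI)
      show "I \<subseteq> carrier F" by (auto simp: mem)
      have "\<zero>\<^bsub>F\<^esub> \<in> I" by (simp add: mem L_zero)
      then show "I \<noteq> {}" by blast
    next
      fix a assume a: "a \<in> I"
      have "L (q \<otimes>\<^bsub>F\<^esub> (\<ominus>\<^bsub>F\<^esub> a)) = \<zero>\<^bsub>PC\<^esub>" if q: "q \<in> carrier F" for q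
      proof -
        have "q \<otimes>\<^bsub>F\<^esub> (\<ominus>\<^bsub>F\<^esub> a) = (\<ominus>\<^bsub>F\<^esub> q) \<otimes>\<^bsub>F\<^esub> a" using a q by (simp add: mem F.r_minus F.l_minus)
        then show ?thesis using a q by (simp add: mem)
      qed
      then show "\<ominus>\<^bsub>F\<^esub> a \<in> I" using a by (simp add: mem)
    next
      fix a b assume "a \<in> I" "b \<in> I"
      then show "a \<oplus>\<^bsub>F\<^esub> b \<in> I" by (simp add: mem F.r_distr L_add)
    qed
  next
    fix a x assume a: "a \<in> I" and x: "x \<in> carrier F"
    have "L (q \<otimes>\<^bsub>F\<^esub> (x \<otimes>\<^bsub>F\<^esub> a)) = \<zero>\<^bsub>PC\<^esub>" if "q \<in> carrier F" for q
      using a x that by (simp add: mem F.m_assoc[symmetric])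
    then show "x \<otimes>\<^bsub>F\<^esub> a \<in> I" using a x by (simp add: mem)
    then show "a \<otimes>\<^bsub>F\<^esub> x \<in> I" using a x by (simp add: mem F.m_comm)
  qed
qed

text \<open>Both arguments of \<open>L\<close> come from one function \<open>?g\<close>, the product
  of \<open>q\<close> with \<open>h\<close> in a fresh variable. The left one is \<open>?g\<close>
  at \<open>(\<beta>, \<gamma>\<gamma>')\<close>, the right one is its hat at
  \<open>(\<beta>, \<gamma>, \<gamma>')\<close>. The arbitrary factor \<open>q\<close> is what makes
  the relation survive in the ideal \<open>I\<close>.\<close>

lemma L_mult:
  assumes g: "\<gamma> \<in> carrier \<Gamma>" "\<gamma>' \<in> carrier \<Gamma>" and h: "h \<in> carrier G" and q: "q \<in> carrier F"
  shows "L (q \<otimes>\<^bsub>F\<^esub> pr (\<gamma> \<otimes>\<^bsub>\<Gamma>\<^esub> \<gamma>') h) = L (q \<otimes>\<^bsub>F\<^esub> pt_mult R G F (pr \<gamma>) (pr \<gamma>') h)"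
proof -
  obtain n \<beta> a where n: "1 \<le> n" "\<beta> \<in> tup n" "a \<in> carrier (pow n)" "q = eval_at F pr \<beta> a"
    using evals_F[OF q] unfolding evals_def by blast
  \<comment> \<open>Slot \<open>k\<close> is the fresh variable reserved for \<open>h\<close>; the
    slots up to \<open>n\<close> carry \<open>q\<close>.\<close>
  obtain k where k: "k = n + 1" by simp
  have k1: "1 \<le> k" using k by simp
  interpret K: algebra R "pow k" by (rule gpow_algebra)
  have z: "(\<lambda>i. i) \<in> {1..n} \<rightarrow> {1..k}" using k by auto
  let ?a = "pc_subst R G k (\<lambda>i. i) a" and ?h = "gpow_pt R G {1..k} k h"
  let ?g = "?a \<otimes>\<^bsub>pow k\<^esub> ?h"
  have a: "?a \<in> carrier (pow k)" by (rule alg_hom_closed[OF subst_hom[OF z] n(3)])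
  have hk: "?h \<in> carrier (pow k)" using k1 by (intro alg_hom_closed[OF pts_hom[OF gpow_pr] h]) simp
  have gk: "?g \<in> carrier (pow k)" using a hk by (rule K.m_closed)
  have \<beta>: "\<beta> i \<in> carrier \<Gamma>" if "i \<in> {1..n}" for i using n(2) that by (rule PiE_mem)
  have ev: "gpow_eval R F y ?g = q \<otimes>\<^bsub>F\<^esub> y k h"
    if y: "\<And>i. i \<in> {1..k} \<Longrightarrow> y i \<in> alg_hom R G F" and yb: "\<And>i. i \<in> {1..n} \<Longrightarrow> y i = pr (\<beta> i)" for y
  proof -
    have "gpow_eval R F y ?g = gpow_eval R F y ?a \<otimes>\<^bsub>F\<^esub> gpow_eval R F y ?h"
      by (rule alg_hom_mult[OF group_scheme_power.eval_hom[OF powI gpow_algebra y] a hk])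
    moreover have "gpow_eval R F y ?a = q"
      unfolding n(4) eval_at_def by (rule eval_subst[OF z gpow_algebra y n(3)]) (simp_all add: yb)
    moreover have "gpow_eval R F y ?h = y k h"
      using k1 by (intro group_scheme_power.eval_pr[OF powI gpow_algebra y _ h]) simp_all
    ultimately show ?thesis by simp
  qed
  \<comment> \<open>Merging the last two entries of \<open>?s\<close> gives \<open>?t\<close>;
    \<open>\<gamma>\<close> and \<open>\<gamma>'\<close> sit in the slots \<open>k\<close> and
    \<open>k + 1\<close>, which are the ones multiplied by \<open>pc_hat R G k\<close>.\<close>
  let ?t = "\<lambda>i \<in> {1..k}. if i = k then \<gamma> \<otimes>\<^bsub>\<Gamma>\<^esub> \<gamma>' else \<beta> i"
  let ?s = "\<lambda>i \<in> {1..k + 1}. if i = k then \<gamma> else if i = k + 1 then \<gamma>' else \<beta> i"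
  have t: "?t \<in> tup k" using g \<beta> k by (intro restrict_PiE_iff[THEN iffD2]) auto
  have s: "?s \<in> tup (k + 1)" using g \<beta> k by (intro restrict_PiE_iff[THEN iffD2]) auto
  have st: "merge_last (mult \<Gamma>) k ?s = ?t"
    unfolding merge_last_def using k1 by (intro restrict_ext) auto
  have "eval_at F pr ?t ?g = q \<otimes>\<^bsub>F\<^esub> pr (?t k) h"
    unfolding eval_at_def by (rule ev[OF F_\<sigma>[OF t]]) (use k in auto)
  also have "?t k = \<gamma> \<otimes>\<^bsub>\<Gamma>\<^esub> \<gamma>'" using k1 by simp
  finally have e1: "eval_at F pr ?t ?g = q \<otimes>\<^bsub>F\<^esub> pr (\<gamma> \<otimes>\<^bsub>\<Gamma>\<^esub> \<gamma>') h" .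
  have 1: "Rel (q \<otimes>\<^bsub>F\<^esub> pr (\<gamma> \<otimes>\<^bsub>\<Gamma>\<^esub> \<gamma>') h) (\<Theta> k (E {1..k} ?g) ?t)"
    using RelI[OF k1 t gk] unfolding e1 .
  let ?y = "merge_last (pt_mult R G F) k (\<lambda>i. pr (?s i))"
  have "eval_at F pr ?s (pc_hat R G k ?g) = gpow_eval R F ?y ?g"
    unfolding eval_at_def by (rule eval_hat[OF k1 gpow_algebra F_\<sigma>[OF s] gk])
  also have "\<dots> = q \<otimes>\<^bsub>F\<^esub> ?y k h"
  proof (rule ev)
    fix i assume i: "i \<in> {1..k}"
    have "pt_mult R G F (pr \<gamma>) (pr \<gamma>') \<in> alg_hom R G F"
      by (intro pts_hom[OF pt_mult_closed] gpow_algebra pts_hom[OF gpow_pr] g)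
    moreover have "pr (\<beta> i) \<in> alg_hom R G F" if "i \<noteq> k"
      using that i k by (intro pts_hom[OF gpow_pr] \<beta>) auto
    ultimately show "?y i \<in> alg_hom R G F" using i by (cases "i = k") (simp_all add: merge_last_def)
  next
    fix i assume "i \<in> {1..n}"
    then show "?y i = pr (\<beta> i)" using k by (simp add: merge_last_def)
  qed
  also have "?y k = pt_mult R G F (pr \<gamma>) (pr \<gamma>')" using k1 by (simp add: merge_last_def)
  finally have e2: "eval_at F pr ?s (pc_hat R G k ?g) = q \<otimes>\<^bsub>F\<^esub> pt_mult R G F (pr \<gamma>) (pr \<gamma>') h" .
  have "1 \<le> k + 1" by simp
  from RelI[OF this s alg_hom_closed[OF hat_hom[OF k1] gk]]
  have 2: "Rel (q \<otimes>\<^bsub>F\<^esub> pt_mult R G F (pr \<gamma>) (pr \<gamma>') h) (\<Theta> (k + 1) (E {1..k + 1} (pc_hat R G k ?g)) ?s)"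
    unfolding e2 .
  \<comment> \<open>\<open>E\<close> commutes with the hat operation, so the multiplicativity axiom
    can be applied to the invariant function \<open>E {1..k} ?g\<close>.\<close>
  have 3: "\<Theta> (k + 1) (E {1..k + 1} (pc_hat R G k ?g)) ?s = \<Theta> k (E {1..k} ?g) ?t"
    unfolding hat_E[OF k1 gk, symmetric] \<Theta>_hat[OF k1 E_closed[OF gk] s] st ..
  show ?thesis unfolding L_eq[OF 1] L_eq[OF 2] 3 ..
qed

text \<open>By \<open>L_mult\<close> the tautological family in \<open>G(F / I)\<close> is a
  representation, classified by \<open>?S\<close> on \<open>O(Rep)\<close>. Composing
  \<open>?S\<close> with the map from \<open>F\<close> to \<open>O(Rep)\<close> gives the quotient
  map, so what vanishes in \<open>O(Rep)\<close> lies in \<open>I\<close>; taking the multiplier 1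
  shows that \<open>L\<close> kills it.\<close>

lemma eval_rep_zero:
  assumes u: "u \<in> carrier F" and 0: "gpow_eval R rep.Rep rep.\<rho> u = \<zero>\<^bsub>rep.Rep\<^esub>"
  shows "L u = \<zero>\<^bsub>PC\<^esub>"
proof -
  interpret p: group_scheme_power R G "carrier \<Gamma>" by (rule powI)
  interpret F: algebra R F by (rule gpow_algebra)
  interpret Q: algebra_quotient R F I by (rule algebra_quotient.intro[OF gpow_algebra ideal_I])
  let ?x = "\<lambda>\<gamma>. compose (carrier G) Q.cls (pr \<gamma>)"
  have x: "?x \<gamma> \<in> carrier (pts Q.Q)" if "\<gamma> \<in> carrier \<Gamma>" for \<gamma>
    by (rule pts_compose_closed[OF pts_hom[OF gpow_pr[OF that]] Q.cls_alg_hom])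
  have m: "?x (\<gamma> \<otimes>\<^bsub>\<Gamma>\<^esub> \<gamma>') = pt_mult R G Q.Q (?x \<gamma>) (?x \<gamma>')" if g: "\<gamma> \<in> carrier \<Gamma>" "\<gamma>' \<in> carrier \<Gamma>" for \<gamma> \<gamma>'
  proof -
    note pg = pts_hom[OF gpow_pr[OF g(1)]] pts_hom[OF gpow_pr[OF g(2)]] pts_hom[OF gpow_pr[OF \<Gamma>.m_closed[OF g]]]
    have pm: "pt_mult R G F (pr \<gamma>) (pr \<gamma>') \<in> alg_hom R G F"
      by (rule pts_hom[OF pt_mult_closed[OF gpow_algebra pg(1,2)]])
    have "?x (\<gamma> \<otimes>\<^bsub>\<Gamma>\<^esub> \<gamma>') = compose (carrier G) Q.cls (pt_mult R G F (pr \<gamma>) (pr \<gamma>'))"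
      unfolding compose_def
    proof (rule restrict_ext)
      fix h assume h: "h \<in> carrier G"
      note c = alg_hom_closed[OF pg(3) h] alg_hom_closed[OF pm h]
      let ?d = "pr (\<gamma> \<otimes>\<^bsub>\<Gamma>\<^esub> \<gamma>') h \<ominus>\<^bsub>F\<^esub> pt_mult R G F (pr \<gamma>) (pr \<gamma>') h"
      have "L (q \<otimes>\<^bsub>F\<^esub> ?d) = \<zero>\<^bsub>PC\<^esub>" if q: "q \<in> carrier F" for q
      proof -
        have e: "q \<otimes>\<^bsub>F\<^esub> ?d = q \<otimes>\<^bsub>F\<^esub> pr (\<gamma> \<otimes>\<^bsub>\<Gamma>\<^esub> \<gamma>') h \<ominus>\<^bsub>F\<^esub> q \<otimes>\<^bsub>F\<^esub> pt_mult R G F (pr \<gamma>) (pr \<gamma>') h"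
          using c q unfolding a_minus_def by (simp only: F.r_distr F.M.a_inv_closed F.r_minus)
        show ?thesis unfolding e
          by (rule L_minus_eq_zero[OF F.m_closed[OF q c(1)] F.m_closed[OF q c(2)] L_mult[OF g h q]])
      qed
      then have "?d \<in> I" unfolding I_def using algebra_minus_closed[OF gpow_algebra c] by blast
      then show "Q.cls (pr (\<gamma> \<otimes>\<^bsub>\<Gamma>\<^esub> \<gamma>') h) = Q.cls (pt_mult R G F (pr \<gamma>) (pr \<gamma>') h)"
        using Q.cls_eq_iff[OF c] by blast
    qed
    also have "\<dots> = pt_mult R G Q.Q (?x \<gamma>) (?x \<gamma>')"
      by (rule compose_pt_mult[OF gpow_algebra pg(1,2) Q.algebra_Q Q.cls_alg_hom]) (simp_all add: compose_def)
    finally show ?thesis .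
  qed
  let ?S = "rep_classify R Q.Q ?x" and ?r = "gpow_eval R rep.Rep rep.\<rho>"
  have S: "?S \<in> alg_hom R rep.Rep Q.Q" by (rule rep.classify_hom[OF Q.algebra_Q x m])
  have r: "?r \<in> alg_hom R F rep.Rep" by (rule p.eval_hom[OF rep.algebra_Rep pts_hom[OF rep.\<rho>_closed]])
  have "?S (?r u) = Q.cls u"
  proof (rule p.hom_eqI[OF alg_hom_compose[OF r S] Q.cls_alg_hom _ u])
    fix \<gamma> h assume gh: "\<gamma> \<in> carrier \<Gamma>" "h \<in> carrier G"
    have "?r (pr \<gamma> h) = rep.\<rho> \<gamma> h" by (rule p.eval_pr[OF rep.algebra_Rep pts_hom[OF rep.\<rho>_closed] gh])
    moreover have "?S (rep.\<rho> \<gamma> h) = ?x \<gamma> h" by (rule rep.classify_\<rho>[OF Q.algebra_Q x m gh])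
    moreover have "?x \<gamma> h = Q.cls (pr \<gamma> h)" by (rule compose_eq[OF gh(2)])
    ultimately show "?S (?r (pr \<gamma> h)) = Q.cls (pr \<gamma> h)" by metis
  qed
  moreover have "?S \<zero>\<^bsub>rep.Rep\<^esub> = \<zero>\<^bsub>Q.Q\<^esub>" by (rule alg_hom_zero[OF S rep.algebra_Rep Q.algebra_Q])
  moreover have "\<zero>\<^bsub>Q.Q\<^esub> = I" by (simp add: alg_quot_def FactRing_def)
  ultimately have "Q.cls u = I" using 0 by metis
  then have "u \<in> I" using Q.a_rcos_self[OF u] by metis
  then have "L (\<one>\<^bsub>F\<^esub> \<otimes>\<^bsub>F\<^esub> u) = \<zero>\<^bsub>PC\<^esub>" unfolding I_def using F.one_closed by blast
  then show ?thesis using F.l_one[OF u] by metis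
qed

text \<open>A difference in the kernel of \<open>\<kappa>\<close> is a single value
  \<open>\<Theta>\<close> of an invariant \<open>f\<close> at \<open>\<gamma>\<close>. The same
  \<open>f\<close> at the tautological points is an element \<open>?u\<close> of \<open>F\<close>
  that vanishes in \<open>O(Rep)\<close>, hence \<open>L ?u\<close> is zero.\<close>

lemma \<kappa>_inj: "inj_on \<kappa> (carrier PC)"
proof (rule inj_onI)
  fix c c' assume c: "c \<in> carrier PC" "c' \<in> carrier PC" and eq: "\<kappa> c = \<kappa> c'"
  let ?d = "c \<ominus>\<^bsub>PC\<^esub> c'"
  have d: "?d \<in> carrier PC" by (rule algebra_minus_closed[OF algebra_PC c])
  have "\<kappa> ?d = \<kappa> c \<ominus>\<^bsub>rep.Rep\<^esub> \<kappa> c'" by (rule alg_hom_minus[OF \<kappa>_hom algebra_PC rep.algebra_Rep c])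
  then have \<kappa>0: "\<kappa> ?d = \<zero>\<^bsub>rep.Rep\<^esub>"
    using algebra_minus_eq_zero_iff[OF rep.algebra_Rep alg_hom_closed[OF \<kappa>_hom c(1)] alg_hom_closed[OF \<kappa>_hom c(2)]] eq by metis
  obtain n f \<gamma> where n: "1 \<le> n" "f \<in> carrier (Inv {1..n})" "\<gamma> \<in> tup n" "?d = \<Theta> n f \<gamma>"
    using PC_is_value[OF d] unfolding is_value_def by blast
  note f = Inv_gpow[OF n(2)]
  interpret p: group_scheme_power R G "carrier \<Gamma>" by (rule powI)
  interpret q: group_scheme_power R G "{1..n}" by (rule powI)
  let ?u = "eval_at F pr \<gamma> f"
  have u: "?u \<in> carrier F" by (rule alg_hom_closed[OF F_hom[OF n(3)] f])
  have r: "gpow_eval R rep.Rep rep.\<rho> \<in> alg_hom R F rep.Rep"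
    by (rule p.eval_hom[OF rep.algebra_Rep pts_hom[OF rep.\<rho>_closed]])
  have "gpow_eval R rep.Rep rep.\<rho> ?u = eval_at rep.Rep rep.\<rho> \<gamma> f"
    unfolding eval_at_def
  proof (rule q.eval_natural[OF gpow_algebra F_\<sigma>[OF n(3)] rep.algebra_Rep r f])
    fix i h assume i: "i \<in> {1..n}" and h: "h \<in> carrier G"
    show "rep.\<rho> (\<gamma> i) h = gpow_eval R rep.Rep rep.\<rho> (pr (\<gamma> i) h)"
      by (rule p.eval_pr[OF rep.algebra_Rep pts_hom[OF rep.\<rho>_closed] PiE_mem[OF n(3) i] h, symmetric])
  qed
  also have "\<dots> = \<zero>\<^bsub>rep.Rep\<^esub>" using \<kappa>0 unfolding n(4) \<kappa>_\<Theta>[OF n(1-3)] .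
  finally have "L ?u = \<zero>\<^bsub>PC\<^esub>" by (rule eval_rep_zero[OF u])
  \<comment> \<open>\<open>E\<close> fixes the invariant function \<open>f\<close>, so
    \<open>L\<close> returns the value one started from.\<close>
  moreover have "L ?u = ?d"
    using L_eq[OF RelI[OF n(1,3) f]] unfolding E_inv[OF n(2)] n(4) .
  ultimately have "?d = \<zero>\<^bsub>PC\<^esub>" by metis
  then show "c = c'" using algebra_minus_eq_zero_iff[OF algebra_PC c] by blast
qed

theorem \<kappa>_iso: "\<kappa> \<in> alg_iso R PC RepInv"
proof -
  have c: "\<kappa> a \<in> carrier RepInv" if "a \<in> carrier PC" for a
    using that \<kappa>_image by blast
  have s: "mult RepInv = mult rep.Rep" "add RepInv = add rep.Rep"
    "one RepInv = one rep.Rep" "smult RepInv = smult rep.Rep"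
    by (simp_all add: rep_inv_eq coinvariants_def)
  have "\<kappa> \<in> alg_hom R PC RepInv"
    by (intro alg_homI ring_hom_memI c)
      (simp_all add: s alg_hom_mult[OF \<kappa>_hom] alg_hom_add[OF \<kappa>_hom] alg_hom_one[OF \<kappa>_hom] alg_hom_smult[OF \<kappa>_hom])
  moreover have "bij_betw \<kappa> (carrier PC) (carrier RepInv)"
    unfolding bij_betw_def using \<kappa>_inj \<kappa>_image by blast
  ultimately show ?thesis by (simp add: alg_iso_def)
qed

end

theorem theorem1p8:
  fixes R :: "'k ring"
    and G :: "('k, 'h) hopf"
    and G0 :: "('k, 'h0) hopf"
    and \<iota> :: "'h \<Rightarrow> 'h0"
    and D :: "'d monoid"
    and \<pi> :: "('d \<Rightarrow> 'k) \<Rightarrow> 'h"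
    and \<Gamma> :: "'g monoid"
  assumes "cring R"
    and "connected_space (zariski R)"
    and "affine_group_scheme R G"
    and "smooth R G"
    and "affine_group_scheme R G0"
    and "is_neutral_component R G G0 \<iota>"
    and "split_torus R G0"
    and "group D" and "finite (carrier D)"
    and "is_quotient_by R G G0 \<iota> (constant_group_scheme R D) \<pi>"
    and "group \<Gamma>"
  shows "rep_to_pc R G \<Gamma> \<in> alg_iso R (pc_alg R G G0 \<iota> \<Gamma>) (rep_inv R G G0 \<iota> \<Gamma>)"
proof -
  obtain r \<phi> where \<phi>: "\<phi> \<in> hopf_iso R (diagonalisable R (free_Abelian_group {..<r::nat})) G0"
    using \<open>split_torus R G0\<close> unfolding split_torus_def by blast
  have \<iota>: "\<iota> \<in> hopf_hom R G G0"
    using \<open>is_neutral_component R G G0 \<iota>\<close> unfolding is_neutral_component_def by blast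
  interpret pseudocharacters R G G0 "free_Abelian_group {..<r}" \<iota> \<phi> \<Gamma>
    by (intro pseudocharacters.intro torus_conjugation.intro torus_conjugation_axioms.intro
        group_scheme.intro assms \<iota> \<phi> comm_group.axioms(1) abelian_free_Abelian_group)
  show ?thesis by (rule \<kappa>_iso)
qed

end
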